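(* Let $H_0$ be the negative discrete Laplacian on $\ell^2(\mathbb{Z}^d)$ and let $V:\mathbb{Z}^d\to\mathbb{R}$. \begin{itemize} \item[(i)] If $d\geq 4$ and $V\in \ell^{\frac{d}{3},\infty}(\mathbb{Z}^d)$, then \[\sup_{z\in\mathbb{C}\setminus\mathbb{R}}\big\||V|^{1/2}(H_0-z)^{-1}|V|^{1/2}\big\|_{B(\ell^2(\mathbb{Z}^d))}<\infty.\] \item[(ii)] If $d\geq 3$ and there is $C>0$ with $|V(x)|\leq C(1+|x|)^{-2}$ for all $x\in\mathbb{Z}^d$, then the same uniform bound holds. \end{itemize}
   Context: $H_0u(x)=-\sum_{y\in\mathbb{Z}^d,\,|x-y|=1}(u(y)-u(x))$ on $\ell^2(\mathbb{Z}^d)$; its spectrum is $[0,4d]$. $|V|^{1/2}$ denotes the multiplication operator by $|V(x)|^{1/2}$. For $1\le p\le\infty$, $\ell^{p,\infty}(\mathbb{Z}^d)$ is the weak-$\ell^p$ (Lorentz) space of functions $f$ on $\mathbb{Z}^d$ with $\sup_{\alpha>0}\alpha\,\#\{x:|f(x)|>\alpha\}^{1/p}<\infty$. *)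

theory Defs
  imports "HOL-Analysis.Analysis"
begin

text \<open>Points of the lattice Z^d are modelled as int^'n, with d = CARD('n).\<close>

definition lat_norm :: "int ^ 'n \<Rightarrow> real" where
  "lat_norm x = sqrt (\<Sum>i\<in>UNIV. (real_of_int (x $ i))\<^sup>2)"

definition H0 :: "(int ^ 'n \<Rightarrow> complex) \<Rightarrow> int ^ 'n \<Rightarrow> complex" where
  "H0 u x = - (\<Sum>y\<in>{y. lat_norm (x - y) = 1}. (u y - u x))"

definition is_l2 :: "(int ^ 'n \<Rightarrow> complex) \<Rightarrow> bool" where
  "is_l2 u \<longleftrightarrow> (\<lambda>x. (cmod (u x))\<^sup>2) summable_on UNIV"

definition l2_norm :: "(int ^ 'n \<Rightarrow> complex) \<Rightarrow> real" where
  "l2_norm u = sqrt (infsum (\<lambda>x. (cmod (u x))\<^sup>2) UNIV)"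

definition resolvent :: "complex \<Rightarrow> (int ^ 'n \<Rightarrow> complex) \<Rightarrow> int ^ 'n \<Rightarrow> complex" where
  "resolvent z f = (THE w. is_l2 w \<and> (\<forall>x. H0 w x - z * w x = f x))"

definition weak_lp :: "real \<Rightarrow> (int ^ 'n \<Rightarrow> real) \<Rightarrow> bool" where
  "weak_lp p f \<longleftrightarrow> (\<forall>\<alpha>>0. finite {x. \<bar>f x\<bar> > \<alpha>}) \<and>
     (\<exists>C. \<forall>\<alpha>>0. \<alpha> * (real (card {x. \<bar>f x\<bar> > \<alpha>})) powr (1 / p) \<le> C)"

definition uniform_resolvent_bound :: "(int ^ 'n \<Rightarrow> real) \<Rightarrow> bool" where
  "uniform_resolvent_bound V \<longleftrightarrow> (\<exists>M. \<forall>z. Im z \<noteq> 0 \<longrightarrow> (\<forall>u. is_l2 u \<longrightarrow>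
     l2_norm (\<lambda>x. complex_of_real (sqrt \<bar>V x\<bar>) *
        resolvent z (\<lambda>y. complex_of_real (sqrt \<bar>V y\<bar>) * u y) x) \<le> M * l2_norm u))"

end

theory Submission
  imports Defs "HOL-Probability.Probability"
begin

text \<open>
  After Fourier transform, \<open>H\<^sub>0\<close> is multiplication by \<open>h = \<Sum>\<^sub>j (2 - 2 cos \<xi>\<^sub>j)\<close>, and it suffices to bound the forms
  \<open>\<integral> \<phi> \<psi>\<^sup>* / (h - z)\<close> for trigonometric polynomials \<open>\<phi>\<close>, \<open>\<psi>\<close> and \<open>Im z > 0\<close>.

  For inverse-square decay, the form is deformed to \<open>\<integral> |\<phi>|\<^sup>2 / (h - z - i \<epsilon> b)\<close> with \<open>b = \<Sum>\<^sub>j sin\<^sup>2 \<xi>\<^sub>j\<close>. Integration by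
  parts along \<open>grad h\<close> bounds its \<open>\<epsilon>\<close>-derivative by the form itself and by \<open>\<integral> |\<phi>|\<^sup>2 / b\<close>, which a Hardy
  inequality controls in dimension at least three; a Gronwall argument then reaches \<open>\<epsilon> = 0\<close>.

  For weak-type potentials, the kernel of \<open>exp (-i t H\<^sub>0)\<close> decays like \<open>t\<close> to the power \<open>-d/3\<close>. The potential is cut into
  dyadic level sets, and for two of them \<open>(h - z)\<close> inverse is split at a time scale \<open>S\<close> between their natural
  scales: long times are handled by the dispersive decay, short times by duality on the smaller set.
  The resulting blocks decay geometrically off the diagonal, so they can be summed by Schur's test.
\<close>

subsection \<open>Bounded measurable functions on the torus\<close>

text \<open>The obstacle is that \<open>hsym\<close> has critical points inside the spectrum and not
  only at its edges: its gradient vanishes wherever all \<open>sin (\<xi> j)\<close> do.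
  \<open>bsym\<close> is a quarter of the squared gradient. It vanishes quadratically and exactly at
  those points, which is why a Hardy inequality with weight \<open>1 / bsym\<close> can replace a
  strictly positive commutator. The exponent \<open>d/3\<close>, instead of the \<open>d/2\<close>
  of the continuous Laplacian, is due to the points with \<open>cos (\<xi> j) = 0\<close>, where the
  second derivative of \<open>hsym\<close> in that coordinate vanishes, so that each coordinate
  contributes only \<open>t powr (-1/3)\<close>. From dimension four on, \<open>d/3\<close> exceeds
  1 and the decay is integrable in time with exponent \<open>1/3\<close> to spare; half of the spare
  exponent pays for the gain off the diagonal. All estimates are made at fixed
  \<open>Im z > 0\<close> and for finitely supported data. Every integrand is then bounded, and
  differentiation under the integral becomes an explicit quadratic remainder estimate whose constant
  may depend on \<open>z\<close>; only the final bounds are uniform.\<close>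

abbreviation period :: "real set" where
  "period \<equiv> {- (pi / 2)..3 * pi / 2}"

text \<open>Total mass one makes the characters orthonormal without prefactors. Starting the period
  at \<open>- (pi / 2)\<close> puts the zeros of \<open>cos\<close> at its two ends and its
  midpoint, so that the phase of the later oscillatory integral has a second derivative of constant
  sign on each half.\<close>

definition circle_measure :: "real measure" where
  "circle_measure = density lborel (\<lambda>s. ennreal (indicator period s / (2 * pi)))"

definition torus :: "('n \<Rightarrow> real) measure" where
  "torus = Pi\<^sub>M UNIV (\<lambda>_. circle_measure)"

text \<open>A bound at every point is stable under the algebra below and gives integrability at once
  on a probability space. Quotients stay in the class because the denominators that occur are
  bounded below, by \<open>\<bar>Im z\<bar>\<close> or by a regularising
  \<open>\<eta>\<close>.\<close>

definition bounded_meas :: "(('n::finite \<Rightarrow> real) \<Rightarrow> 'b::real_normed_vector) \<Rightarrow> bool" where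
  "bounded_meas f \<longleftrightarrow> f \<in> borel_measurable torus \<and> (\<exists>B. \<forall>\<xi>. norm (f \<xi>) \<le> B)"

lemma sets_circle_measure [measurable_cong, simp]: "sets circle_measure = sets borel"
  by (simp add: circle_measure_def)

lemma space_circle_measure [simp]: "space circle_measure = UNIV"
  by (simp add: circle_measure_def)

lemma space_torus [simp]: "space torus = UNIV"
  by (simp add: torus_def space_PiM)

lemma prob_space_circle_measure: "prob_space circle_measure"
proof
  have "emeasure circle_measure (space circle_measure)
      = (\<integral>\<^sup>+s. ennreal (indicator period s / (2 * pi)) \<partial>lborel)"
    by (simp add: circle_measure_def emeasure_density)
  also have "\<dots> = (\<integral>\<^sup>+s. ennreal (1 / (2 * pi)) * indicator period s \<partial>lborel)"
    by (intro nn_integral_cong) (auto split: split_indicator)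
  also have "\<dots> = 1"
    by (simp add: nn_integral_cmult flip: ennreal_mult')
  finally show "emeasure circle_measure (space circle_measure) = 1" .
qed

lemma product_prob_space_circle: "product_prob_space (\<lambda>_. circle_measure)"
  using prob_space_circle_measure
  by (simp add: product_prob_space_def product_prob_space_axioms_def product_sigma_finite_def
      prob_space_imp_sigma_finite)

interpretation circles: product_prob_space "\<lambda>_. circle_measure" I for I
  by (rule product_prob_space_circle)

lemma prob_space_torus: "prob_space torus"
  unfolding torus_def by (rule prob_space_PiM[OF prob_space_circle_measure])

interpretation torus: prob_space torus
  by (rule prob_space_torus)

lemma measurable_torus_component [measurable]: "(\<lambda>\<xi>. \<xi> j) \<in> borel_measurable torus"
proof -
  have "(\<lambda>\<xi>. \<xi> j) \<in> measurable torus circle_measure"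
    unfolding torus_def by measurable
  then show ?thesis by (simp cong: measurable_cong_sets)
qed

text \<open>The bridge from the Bochner integral, used for Fubini, to the gauge integral, used for
  the fundamental theorem of calculus.\<close>

lemma circle_measure_has_integral:
  fixes g :: "real \<Rightarrow> 'b::euclidean_space"
  assumes [measurable]: "g \<in> borel_measurable borel" and B: "\<And>s. norm (g s) \<le> B"
  shows "(g has_integral (2 * pi) *\<^sub>R (\<integral>s. g s \<partial>circle_measure)) period"
proof -
  have 1: "(\<integral>s. g s \<partial>circle_measure)
      = (\<integral>s. (indicator period s / (2 * pi)) *\<^sub>R g s \<partial>lborel)"
    unfolding circle_measure_def by (rule integral_density) auto
  have "integrable lborel (\<lambda>s. indicator period s *\<^sub>R g s)"
    by (rule integrableI_bounded_set_indicator[where B = B]) (use B in \<open>auto simp: emeasure_lborel_Icc_eq\<close>)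
  from has_integral_integral_lborel[OF this]
  have "((\<lambda>s. indicator period s *\<^sub>R g s) has_integral
      (\<integral>s. indicator period s *\<^sub>R g s \<partial>lborel)) UNIV" .
  moreover have "(\<integral>s. indicator period s *\<^sub>R g s \<partial>lborel)
      = (2 * pi) *\<^sub>R (\<integral>s. g s \<partial>circle_measure)"
    unfolding 1 by (simp flip: integral_scaleR_right)
  moreover have "(\<lambda>s. indicator period s *\<^sub>R g s) = (\<lambda>s. if s \<in> period then g s else 0)"
    by (auto split: split_indicator)
  ultimately show ?thesis
    by (simp add: has_integral_restrict_UNIV del: atLeastAtMost_iff)
qed

lemma product_fubini_component:
  assumes f: "integrable torus (f :: ('n::finite \<Rightarrow> real) \<Rightarrow> 'b::euclidean_space)"
  shows "integral\<^sup>L torus f = (\<integral>\<xi>. (\<integral>s. f (\<xi>(j := s)) \<partial>circle_measure) \<partial>Pi\<^sub>M (UNIV - {j}) (\<lambda>_. circle_measure))"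
proof -
  have *: "UNIV = insert j (UNIV - {j})" by auto
  show ?thesis
    using circles.product_integral_insert[of "UNIV - {j}" j f] f *
    by (simp add: torus_def)
qed

lemma torus_integral_prod:
  fixes w :: "'n::finite \<Rightarrow> real \<Rightarrow> complex"
  assumes "\<And>j. integrable circle_measure (w j)"
  shows "(\<integral>\<xi>. (\<Prod>j\<in>UNIV. w j (\<xi> j)) \<partial>torus) = (\<Prod>j\<in>UNIV. integral\<^sup>L circle_measure (w j))"
  unfolding torus_def by (rule circles.product_integral_prod) (use assms in auto)

section \<open>Closure properties of bounded measurable functions, and Cauchy-Schwarz\<close>

lemma bounded_meas_integrable:
  fixes f :: "('n::finite \<Rightarrow> real) \<Rightarrow> 'b::{banach, second_countable_topology}"
  assumes "bounded_meas f"
  shows "integrable torus f"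
  using assms unfolding bounded_meas_def
  by (auto intro: torus.integrable_const_bound)

lemma bounded_meas_const: "bounded_meas (\<lambda>_. c)"
  by (auto simp: bounded_meas_def)

lemma bounded_meas_mult:
  fixes f g :: "('n::finite \<Rightarrow> real) \<Rightarrow> 'b::{real_normed_algebra, second_countable_topology}"
  assumes "bounded_meas f" "bounded_meas g"
  shows "bounded_meas (\<lambda>\<xi>. f \<xi> * g \<xi>)"
proof -
  obtain A B where "\<And>\<xi>. norm (f \<xi>) \<le> A" "\<And>\<xi>. norm (g \<xi>) \<le> B"
    using assms by (auto simp: bounded_meas_def)
  then have "norm (f \<xi> * g \<xi>) \<le> A * B" for \<xi>
    by (meson mult_mono norm_ge_zero norm_mult_ineq order_trans)
  with assms show ?thesis by (auto simp: bounded_meas_def)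
qed

lemma bounded_meas_add:
  fixes f g :: "('n::finite \<Rightarrow> real) \<Rightarrow> 'b::{real_normed_vector, second_countable_topology}"
  assumes "bounded_meas f" "bounded_meas g"
  shows "bounded_meas (\<lambda>\<xi>. f \<xi> + g \<xi>)"
proof -
  obtain A B where "\<And>\<xi>. norm (f \<xi>) \<le> A" "\<And>\<xi>. norm (g \<xi>) \<le> B"
    using assms by (auto simp: bounded_meas_def)
  then have "norm (f \<xi> + g \<xi>) \<le> A + B" for \<xi>
    by (meson add_mono norm_triangle_ineq order_trans)
  with assms show ?thesis by (auto simp: bounded_meas_def)
qed

lemma bounded_meas_minus:
  fixes f :: "('n::finite \<Rightarrow> real) \<Rightarrow> 'b::{real_normed_vector, second_countable_topology}"
  assumes "bounded_meas f"
  shows "bounded_meas (\<lambda>\<xi>. - f \<xi>)"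
  using assms by (auto simp: bounded_meas_def)

lemma bounded_meas_diff:
  fixes f g :: "('n::finite \<Rightarrow> real) \<Rightarrow> 'b::{real_normed_vector, second_countable_topology}"
  assumes "bounded_meas f" "bounded_meas g"
  shows "bounded_meas (\<lambda>\<xi>. f \<xi> - g \<xi>)"
  using bounded_meas_add[OF assms(1) bounded_meas_minus[OF assms(2)]] by simp

lemma bounded_meas_sum:
  fixes f :: "'a \<Rightarrow> ('n::finite \<Rightarrow> real) \<Rightarrow> 'b::{real_normed_vector, second_countable_topology}"
  assumes "\<And>i. i \<in> I \<Longrightarrow> bounded_meas (f i)"
  shows "bounded_meas (\<lambda>\<xi>. \<Sum>i\<in>I. f i \<xi>)"
  using assms
  by (induction I rule: infinite_finite_induct) (auto intro: bounded_meas_const bounded_meas_add)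

lemma bounded_meas_prod:
  fixes f :: "'a \<Rightarrow> ('n::finite \<Rightarrow> real) \<Rightarrow> 'b::{real_normed_field, second_countable_topology}"
  assumes "\<And>i. i \<in> I \<Longrightarrow> bounded_meas (f i)"
  shows "bounded_meas (\<lambda>\<xi>. \<Prod>i\<in>I. f i \<xi>)"
  using assms
  by (induction I rule: infinite_finite_induct) (auto intro: bounded_meas_const bounded_meas_mult)

lemma bounded_meas_power:
  fixes f :: "('n::finite \<Rightarrow> real) \<Rightarrow> 'b::{real_normed_field, second_countable_topology}"
  assumes "bounded_meas f"
  shows "bounded_meas (\<lambda>\<xi>. f \<xi> ^ k)"
  using assms by (induction k) (auto intro: bounded_meas_const bounded_meas_mult)

lemma bounded_meas_of_real:
  "bounded_meas f \<Longrightarrow> bounded_meas (\<lambda>\<xi>. complex_of_real (f \<xi>))"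
  by (auto simp: bounded_meas_def)

lemma bounded_meas_norm:
  fixes f :: "('n::finite \<Rightarrow> real) \<Rightarrow> 'b::{real_normed_vector, second_countable_topology}"
  shows "bounded_meas f \<Longrightarrow> bounded_meas (\<lambda>\<xi>. norm (f \<xi>))"
  by (auto simp: bounded_meas_def)

lemma bounded_meas_cnj:
  assumes "bounded_meas f"
  shows "bounded_meas (\<lambda>\<xi>. cnj (f \<xi>))"
proof -
  have [measurable]: "cnj \<in> borel_measurable borel"
    by (intro borel_measurable_continuous_onI continuous_intros)
  show ?thesis using assms by (auto simp: bounded_meas_def)
qed

lemma bounded_meas_Re: "bounded_meas f \<Longrightarrow> bounded_meas (\<lambda>\<xi>. Re (f \<xi>))"
  by (auto simp: bounded_meas_def) (meson abs_Re_le_cmod order_trans)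

lemma bounded_meas_component:
  fixes p :: "real \<Rightarrow> 'b::real_normed_vector"
  assumes "continuous_on UNIV p" "\<And>s. norm (p s) \<le> B"
  shows "bounded_meas (\<lambda>\<xi>. p (\<xi> j))"
proof -
  have [measurable]: "p \<in> borel_measurable borel"
    by (rule borel_measurable_continuous_onI) (rule assms)
  show ?thesis using assms(2) by (auto simp: bounded_meas_def)
qed

lemma bounded_meas_divide:
  fixes f g :: "('n::finite \<Rightarrow> real) \<Rightarrow> 'b::{real_normed_field, second_countable_topology}"
  assumes "bounded_meas f" "bounded_meas g" "\<And>\<xi>. norm (g \<xi>) \<ge> \<delta>" "\<delta> > 0"
  shows "bounded_meas (\<lambda>\<xi>. f \<xi> / g \<xi>)"
proof -
  have "norm (inverse (g \<xi>)) \<le> inverse \<delta>" for \<xi>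
    using assms(3)[of \<xi>] assms(4) by (simp add: norm_inverse le_imp_inverse_le)
  then have "bounded_meas (\<lambda>\<xi>. inverse (g \<xi>))"
    using assms(2) by (auto simp: bounded_meas_def)
  from bounded_meas_mult[OF assms(1) this] show ?thesis by (simp add: divide_inverse)
qed

lemmas bounded_meas_intros = bounded_meas_const bounded_meas_mult bounded_meas_add
  bounded_meas_minus bounded_meas_diff bounded_meas_sum bounded_meas_prod bounded_meas_power
  bounded_meas_of_real bounded_meas_norm bounded_meas_cnj bounded_meas_Re

text \<open>The discriminant argument: integrating the square of
  \<open>cmod (f \<xi>) - s * cmod (g \<xi>)\<close> gives an inequality quadratic in
  \<open>s\<close>. It is used at \<open>s = C / B\<close>, or, if \<open>B = 0\<close>, at an
  \<open>s\<close> with \<open>2 * s * C = A + 1\<close>.\<close>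

lemma torus_integral_cauchy_schwarz:
  fixes f g :: "('n::finite \<Rightarrow> real) \<Rightarrow> complex"
  assumes f: "bounded_meas f" and g: "bounded_meas g"
  shows "cmod (\<integral>\<xi>. f \<xi> * cnj (g \<xi>) \<partial>torus)
    \<le> sqrt (\<integral>\<xi>. (cmod (f \<xi>))\<^sup>2 \<partial>torus) * sqrt (\<integral>\<xi>. (cmod (g \<xi>))\<^sup>2 \<partial>torus)"
proof -
  define A where "A = (\<integral>\<xi>. (cmod (f \<xi>))\<^sup>2 \<partial>torus)"
  define B where "B = (\<integral>\<xi>. (cmod (g \<xi>))\<^sup>2 \<partial>torus)"
  define C where "C = (\<integral>\<xi>. cmod (f \<xi>) * cmod (g \<xi>) \<partial>torus)"
  have AB: "A \<ge> 0" "B \<ge> 0" "C \<ge> 0" unfolding A_def B_def C_def by auto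
  note I = bounded_meas_integrable bounded_meas_intros f g
  have quad: "2 * s * C \<le> A + s\<^sup>2 * B" for s
  proof -
    have "2 * s * C = (\<integral>\<xi>. 2 * s * (cmod (f \<xi>) * cmod (g \<xi>)) \<partial>torus)"
      unfolding C_def by simp
    also have "\<dots> \<le> (\<integral>\<xi>. (cmod (f \<xi>))\<^sup>2 + s\<^sup>2 * (cmod (g \<xi>))\<^sup>2 \<partial>torus)"
    proof (rule integral_mono)
      fix \<xi>
      have "0 \<le> (cmod (f \<xi>) - s * cmod (g \<xi>))\<^sup>2" by simp
      then show "2 * s * (cmod (f \<xi>) * cmod (g \<xi>)) \<le> (cmod (f \<xi>))\<^sup>2 + s\<^sup>2 * (cmod (g \<xi>))\<^sup>2"
        by (simp add: power2_eq_square algebra_simps)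
    qed (intro I)+
    also have "\<dots> = A + s\<^sup>2 * B"
      unfolding A_def B_def by (subst Bochner_Integration.integral_add) (auto intro!: I)
    finally show ?thesis .
  qed
  have "C\<^sup>2 \<le> A * B"
  proof (cases "B = 0")
    case True
    have "C = 0"
    proof (rule ccontr)
      assume "C \<noteq> 0"
      then show False using quad[of "(A + 1) / (2 * C)"] True by simp
    qed
    then show ?thesis using True by simp
  next
    case False
    then have "B > 0" using AB by simp
    then show ?thesis using quad[of "C / B"]
      by (simp add: power2_eq_square field_simps)
  qed
  then have "C \<le> sqrt A * sqrt B"
    using AB by (metis real_le_rsqrt real_sqrt_mult)
  moreover have "cmod (\<integral>\<xi>. f \<xi> * cnj (g \<xi>) \<partial>torus) \<le> C"
    unfolding C_def by (rule order_trans[OF integral_norm_bound]) (simp add: norm_mult)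
  ultimately show ?thesis unfolding A_def B_def by linarith
qed

subsection \<open>Characters and trigonometric polynomials\<close>

definition ch :: "int ^ 'n \<Rightarrow> ('n \<Rightarrow> real) \<Rightarrow> complex" where
  "ch x \<xi> = (\<Prod>j\<in>UNIV. cis (real_of_int (x $ j) * \<xi> j))"

definition trig :: "(int ^ 'n) set \<Rightarrow> (int ^ 'n \<Rightarrow> complex) \<Rightarrow> ('n \<Rightarrow> real) \<Rightarrow> complex" where
  "trig F f \<xi> = (\<Sum>x\<in>F. f x * ch x \<xi>)"

lemma ch_0 [simp]: "ch 0 \<xi> = 1"
  by (simp add: ch_def)

lemma ch_add: "ch (x + y) \<xi> = ch x \<xi> * ch y \<xi>"
  by (simp add: ch_def cis_mult prod.distrib[symmetric] algebra_simps)

lemma cnj_ch: "cnj (ch x \<xi>) = ch (- x) \<xi>"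
  by (simp add: ch_def cis_cnj)

lemma norm_ch [simp]: "cmod (ch x \<xi>) = 1"
  by (simp add: ch_def prod_norm[symmetric])

lemma ch_axis: "ch (axis j k) \<xi> = cis (real_of_int k * \<xi> j)"
proof -
  have "ch (axis j k) \<xi> = (\<Prod>i\<in>UNIV. if i = j then cis (real_of_int k * \<xi> j) else 1)"
    unfolding ch_def by (intro prod.cong) (auto simp: axis_def)
  then show ?thesis by (simp add: prod.delta)
qed

lemma borel_measurable_cis [measurable]: "cis \<in> borel_measurable borel"
  by (intro borel_measurable_continuous_onI continuous_intros)

lemma bounded_meas_ch: "bounded_meas (ch x)"
proof -
  have "bounded_meas (\<lambda>\<xi>. ch x \<xi>)"
    unfolding ch_def
    by (intro bounded_meas_prod bounded_meas_component[where B = 1]) (auto intro!: continuous_intros)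
  then show ?thesis by simp
qed

lemma bounded_meas_trig: "bounded_meas (trig F f)"
proof -
  have "bounded_meas (\<lambda>\<xi>. trig F f \<xi>)"
    unfolding trig_def by (intro bounded_meas_intros bounded_meas_ch)
  then show ?thesis by simp
qed

lemma circle_integral_cis:
  "(\<integral>s. cis (real_of_int n * s) \<partial>circle_measure) = (if n = 0 then 1 else 0)"
proof (cases "n = 0")
  case True
  then show ?thesis by (simp add: circles.M.prob_space[simplified])
next
  case False
  define P where "P s = cis (real_of_int n * s) / (\<i> * of_int n)" for s
  have d: "(P has_vector_derivative cis (real_of_int n * s)) (at s within A)" for s A
  proof -
    have "((\<lambda>s. cis (real_of_int n * s)) has_vector_derivative real_of_int n *\<^sub>R (\<i> * cis (real_of_int n * s))) (at s within A)"
      unfolding has_vector_derivative_def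
      by (auto intro!: derivative_eq_intros simp: scaleR_conv_of_real)
    from has_vector_derivative_divide[OF this, of "\<i> * of_int n"]
    show ?thesis using False by (simp add: P_def[abs_def] scaleR_conv_of_real)
  qed
  have "((\<lambda>s. cis (real_of_int n * s)) has_integral P (3 * pi / 2) - P (- (pi / 2))) period"
    by (rule fundamental_theorem_of_calculus) (auto intro!: d)
  moreover have "P (3 * pi / 2) = P (- (pi / 2))"
  proof -
    have "cis (real_of_int n * (3 * pi / 2)) = cis (real_of_int n * (- (pi / 2)) + 2 * pi * n)"
      by (rule arg_cong[of _ _ cis]) (simp add: field_simps)
    also have "\<dots> = cis (real_of_int n * (- (pi / 2)))"
      unfolding cis_mult[symmetric] by (simp add: cis_multiple_2pi)
    finally show ?thesis by (simp add: P_def)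
  qed
  moreover have "((\<lambda>s. cis (real_of_int n * s)) has_integral
     (2 * pi) *\<^sub>R (\<integral>s. cis (real_of_int n * s) \<partial>circle_measure)) period"
    by (rule circle_measure_has_integral[where B = 1]) auto
  ultimately have "(2 * pi) *\<^sub>R (\<integral>s. cis (real_of_int n * s) \<partial>circle_measure) = 0"
    by (metis diff_self has_integral_unique)
  then show ?thesis using False by simp
qed

lemma integrable_circle_bounded:
  fixes g :: "real \<Rightarrow> complex"
  assumes "g \<in> borel_measurable borel" "\<And>s. norm (g s) \<le> B"
  shows "integrable circle_measure g"
  using assms by (intro circles.M.integrable_const_bound[where B = B]) (auto cong: measurable_cong_sets)

lemma torus_integral_ch: "(\<integral>\<xi>. ch x \<xi> \<partial>torus) = (if x = 0 then 1 else 0)"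
proof -
  have "(\<integral>\<xi>. ch x \<xi> \<partial>torus)
      = (\<Prod>j\<in>UNIV. \<integral>s. cis (real_of_int (x $ j) * s) \<partial>circle_measure)"
    unfolding ch_def by (rule torus_integral_prod) (auto intro!: integrable_circle_bounded[where B = 1])
  also have "\<dots> = (\<Prod>j\<in>UNIV. if x $ j = 0 then 1 else 0)"
    by (simp add: circle_integral_cis)
  also have "\<dots> = (if x = 0 then 1 else 0)"
    by (auto simp: vec_eq_iff prod_zero_iff)
  finally show ?thesis .
qed

lemma trig_parseval:
  assumes F: "finite F"
  shows "(\<integral>\<xi>. trig F f \<xi> * cnj (trig F g \<xi>) \<partial>torus) = (\<Sum>x\<in>F. f x * cnj (g x))"
proof -
  have "(\<integral>\<xi>. trig F f \<xi> * cnj (trig F g \<xi>) \<partial>torus)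
     = (\<integral>\<xi>. (\<Sum>x\<in>F. \<Sum>y\<in>F. f x * cnj (g y) * ch (x - y) \<xi>) \<partial>torus)"
    by (intro Bochner_Integration.integral_cong)
      (simp_all add: trig_def sum_product cnj_ch ch_add flip: ch_add, simp add: ac_simps flip: ch_add)
  also have "\<dots> = (\<Sum>x\<in>F. \<Sum>y\<in>F. f x * cnj (g y) * (\<integral>\<xi>. ch (x - y) \<xi> \<partial>torus))"
    by (subst Bochner_Integration.integral_sum Bochner_Integration.integral_mult_right;
        (intro bounded_meas_integrable bounded_meas_intros bounded_meas_ch)?)+ simp
  also have "\<dots> = (\<Sum>x\<in>F. f x * cnj (g x))"
    using F by (simp add: torus_integral_ch if_distrib[of "\<lambda>c. _ * c"] cong: if_cong)
  finally show ?thesis .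
qed

lemma trig_parseval_norm:
  assumes F: "finite F"
  shows "(\<integral>\<xi>. (cmod (trig F f \<xi>))\<^sup>2 \<partial>torus) = (\<Sum>x\<in>F. (cmod (f x))\<^sup>2)"
proof -
  have "complex_of_real (\<integral>\<xi>. (cmod (trig F f \<xi>))\<^sup>2 \<partial>torus) = (\<integral>\<xi>. trig F f \<xi> * cnj (trig F f \<xi>) \<partial>torus)"
    unfolding complex_norm_square[symmetric] integral_complex_of_real ..
  also have "\<dots> = complex_of_real (\<Sum>x\<in>F. (cmod (f x))\<^sup>2)"
    by (simp only: trig_parseval[OF F] of_real_sum complex_norm_square)
  finally show ?thesis by (simp only: of_real_eq_iff)
qed

text \<open>Pairing \<open>G\<close> with the polynomial built from its own coefficients gives the
  left side \<open>S\<close>; Cauchy-Schwarz and orthonormality turn this into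
  \<open>S \<le> sqrt A * sqrt S\<close>. It is the source of all square summability of
  \<open>green z\<close>.\<close>

lemma fourier_bessel:
  fixes G :: "('n::finite \<Rightarrow> real) \<Rightarrow> complex"
  assumes F: "finite F" and G: "bounded_meas G"
  shows "(\<Sum>x\<in>F. (cmod (\<integral>\<xi>. cnj (ch x \<xi>) * G \<xi> \<partial>torus))\<^sup>2) \<le> (\<integral>\<xi>. (cmod (G \<xi>))\<^sup>2 \<partial>torus)"
proof -
  define c where "c x = (\<integral>\<xi>. cnj (ch x \<xi>) * G \<xi> \<partial>torus)" for x
  define S where "S = (\<Sum>x\<in>F. (cmod (c x))\<^sup>2)"
  define A where "A = (\<integral>\<xi>. (cmod (G \<xi>))\<^sup>2 \<partial>torus)"
  have S0: "S \<ge> 0" "A \<ge> 0" unfolding S_def A_def by (auto intro: sum_nonneg)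
  have "(\<integral>\<xi>. G \<xi> * cnj (trig F c \<xi>) \<partial>torus) = (\<integral>\<xi>. (\<Sum>x\<in>F. cnj (c x) * (cnj (ch x \<xi>) * G \<xi>)) \<partial>torus)"
    by (simp add: trig_def sum_distrib_left ac_simps)
  also have "\<dots> = (\<Sum>x\<in>F. cnj (c x) * c x)"
    unfolding c_def
    by (subst Bochner_Integration.integral_sum)
      (auto intro!: bounded_meas_integrable bounded_meas_intros bounded_meas_ch G)
  also have "\<dots> = complex_of_real S"
    by (simp add: S_def flip: complex_norm_square mult.commute[of "c _"])
  finally have "S = cmod (\<integral>\<xi>. G \<xi> * cnj (trig F c \<xi>) \<partial>torus)"
    using S0 by simp
  also have "\<dots> \<le> sqrt A * sqrt S"
    using torus_integral_cauchy_schwarz[OF G bounded_meas_trig, of F c] F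
    by (simp add: trig_parseval_norm A_def S_def)
  finally have "sqrt S * sqrt S \<le> sqrt A * sqrt S" using S0 by simp
  then have "S \<le> A"
    using S0 by (cases "S = 0") (auto simp del: real_sqrt_mult_self)
  then show ?thesis by (simp add: S_def A_def c_def)
qed

subsection \<open>The resolvent on the Fourier side\<close>

definition hsym :: "('n::finite \<Rightarrow> real) \<Rightarrow> real" where
  "hsym \<xi> = (\<Sum>j\<in>UNIV. 2 - 2 * cos (\<xi> j))"

definition green :: "complex \<Rightarrow> int ^ 'n \<Rightarrow> complex" where
  "green z x = (\<integral>\<xi>. cnj (ch x \<xi>) / (of_real (hsym \<xi>) - z) \<partial>torus)"

lemma bounded_meas_hsym: "bounded_meas hsym"
proof -
  have "bounded_meas (\<lambda>\<xi>. hsym \<xi>)"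
    unfolding hsym_def
    by (intro bounded_meas_sum bounded_meas_component[where B = 4])
      (auto intro!: continuous_intros simp: abs_le_iff, (smt (verit) cos_le_one cos_ge_minus_one)+)
  then show ?thesis by simp
qed

lemma norm_hsym_diff_ge: "cmod (of_real (hsym \<xi>) - z) \<ge> \<bar>Im z\<bar>"
  using abs_Im_le_cmod[of "of_real (hsym \<xi>) - z"] by simp

lemma bounded_meas_div_hsym:
  assumes "bounded_meas f" "Im z \<noteq> 0"
  shows "bounded_meas (\<lambda>\<xi>. f \<xi> / (of_real (hsym \<xi>) - z))"
  by (intro bounded_meas_divide[where \<delta> = "\<bar>Im z\<bar>"] bounded_meas_intros bounded_meas_hsym assms(1) norm_hsym_diff_ge)
    (use assms in auto)

text \<open>Integer squares that sum to one: a single coordinate is nonzero, and it is a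
  unit.\<close>

lemma lat_norm_eq_1_iff:
  "lat_norm v = 1 \<longleftrightarrow> (\<exists>j. v = axis j 1 \<or> v = - axis j 1)"
proof
  assume "lat_norm v = 1"
  then have "(\<Sum>i\<in>UNIV. (real_of_int (v $ i))\<^sup>2) = 1" by (simp add: lat_norm_def)
  then have "real_of_int (\<Sum>i\<in>UNIV. (v $ i)\<^sup>2) = 1" by simp
  then have s: "(\<Sum>i\<in>UNIV. (v $ i)\<^sup>2) = 1" by linarith
  then obtain j where j: "v $ j \<noteq> 0"
    by (metis power_zero_numeral sum.neutral zero_neq_one)
  have split: "(v $ j)\<^sup>2 + (\<Sum>i\<in>UNIV - {j}. (v $ i)\<^sup>2) = 1"
    using s by (simp add: sum.remove[of UNIV j])
  have "(v $ j)\<^sup>2 \<ge> 1" using j by (smt (verit) zero_less_power2)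
  moreover have nn: "(\<Sum>i\<in>UNIV - {j}. (v $ i)\<^sup>2) \<ge> 0" by (intro sum_nonneg) auto
  ultimately have *: "(v $ j)\<^sup>2 = 1" "(\<Sum>i\<in>UNIV - {j}. (v $ i)\<^sup>2) = 0" using split by linarith+
  then have "\<forall>i\<in>UNIV - {j}. (v $ i)\<^sup>2 = 0"
    by (subst (asm) sum_nonneg_eq_0_iff) auto
  then have z: "\<And>i. i \<noteq> j \<Longrightarrow> v $ i = 0" by auto
  from * have "v $ j = 1 \<or> v $ j = -1" by (simp add: power2_eq_1_iff)
  then show "\<exists>j. v = axis j 1 \<or> v = - axis j 1"
    using z by (intro exI[of _ j]) (auto simp: vec_eq_iff axis_def)
next
  assume "\<exists>j. v = axis j 1 \<or> v = - axis j 1"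
  then obtain j where j: "v = axis j 1 \<or> v = - axis j 1" by blast
  have "(real_of_int (v $ i))\<^sup>2 = (if i = j then 1 else 0)" for i
    using j by (auto simp: axis_def)
  then show "lat_norm v = 1" by (simp add: lat_norm_def)
qed

lemma H0_eq: "H0 u x = (\<Sum>j\<in>UNIV. 2 * u x - u (x + axis j 1) - u (x - axis j 1))"
proof -
  have ne: "axis i (1::int) \<noteq> - axis j 1" for i j :: 'a
    by (auto simp: vec_eq_iff axis_def dest!: spec[of _ i])
  have nb: "{y. lat_norm (x - y) = 1} = range (\<lambda>j. x + axis j 1) \<union> range (\<lambda>j. x - axis j 1)"
    unfolding lat_norm_eq_1_iff
    by (auto simp: algebra_simps image_iff)
  have disj: "range (\<lambda>j. x + axis j 1) \<inter> range (\<lambda>j. x - axis j 1) = {}"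
    using ne by (auto simp: algebra_simps) (metis add.right_inverse add_left_cancel ne add_eq_0_iff)
  have inj: "inj (\<lambda>j. x + axis j (1::int))" "inj (\<lambda>j. x - axis j (1::int))"
    by (auto simp: inj_def axis_eq_axis)
  have "H0 u x = - ((\<Sum>j\<in>UNIV. u (x + axis j 1) - u x) + (\<Sum>j\<in>UNIV. u (x - axis j 1) - u x))"
    unfolding H0_def nb
    by (subst sum.union_disjoint) (use disj inj in \<open>auto simp: sum.reindex\<close>)
  also have "\<dots> = (\<Sum>j\<in>UNIV. 2 * u x - u (x + axis j 1) - u (x - axis j 1))"
    by (simp add: sum.distrib[symmetric] sum_negf[symmetric] algebra_simps del: sum_constant)
  finally show ?thesis .
qed

text \<open>The two neighbours in direction \<open>j\<close> together contribute the factor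
  \<open>2 * cos (\<xi> j)\<close>.\<close>

lemma H0_fourier:
  fixes G :: "('n::finite \<Rightarrow> real) \<Rightarrow> complex"
  assumes G: "bounded_meas G"
  shows "H0 (\<lambda>x. \<integral>\<xi>. cnj (ch x \<xi>) * G \<xi> \<partial>torus) x = (\<integral>\<xi>. cnj (ch x \<xi>) * (of_real (hsym \<xi>) * G \<xi>) \<partial>torus)"
proof -
  note I = bounded_meas_integrable bounded_meas_intros bounded_meas_ch G bounded_meas_hsym
  have cc: "cnj (ch (x + axis j 1) \<xi>) + cnj (ch (x - axis j 1) \<xi>) = of_real (2 * cos (\<xi> j)) * cnj (ch x \<xi>)"
    for j and \<xi> :: "'n \<Rightarrow> real"
  proof -
    have e: "- axis j (1::int) = axis j (-1)" by (simp add: vec_eq_iff axis_def)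
    have "cnj (ch (x + axis j 1) \<xi>) + cnj (ch (x - axis j 1) \<xi>)
        = cnj (ch x \<xi>) * (cis (- \<xi> j) + cis (\<xi> j))"
      unfolding diff_conv_add_uminus[of x] ch_add e ch_axis by (simp add: cis_cnj algebra_simps)
    also have "cis (- \<xi> j) + cis (\<xi> j) = of_real (2 * cos (\<xi> j))"
      by (simp add: complex_eq_iff)
    finally show ?thesis by simp
  qed
  have "H0 (\<lambda>x. \<integral>\<xi>. cnj (ch x \<xi>) * G \<xi> \<partial>torus) x =
    (\<Sum>j\<in>UNIV. \<integral>\<xi>. 2 * (cnj (ch x \<xi>) * G \<xi>) - cnj (ch (x + axis j 1) \<xi>) * G \<xi> - cnj (ch (x - axis j 1) \<xi>) * G \<xi> \<partial>torus)"
    unfolding H0_eq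
    by (intro sum.cong refl, subst Bochner_Integration.integral_diff Bochner_Integration.integral_mult_right;
        (subst Bochner_Integration.integral_diff)?) (auto intro!: I)
  also have "\<dots> = (\<integral>\<xi>. (\<Sum>j\<in>UNIV. 2 * (cnj (ch x \<xi>) * G \<xi>) - cnj (ch (x + axis j 1) \<xi>) * G \<xi> - cnj (ch (x - axis j 1) \<xi>) * G \<xi>) \<partial>torus)"
    by (subst Bochner_Integration.integral_sum) (intro I refl)+
  also have "\<dots> = (\<integral>\<xi>. cnj (ch x \<xi>) * (of_real (hsym \<xi>) * G \<xi>) \<partial>torus)"
  proof (intro Bochner_Integration.integral_cong refl)
    fix \<xi> :: "'n \<Rightarrow> real"
    have "2 * (cnj (ch x \<xi>) * G \<xi>) - cnj (ch (x + axis j 1) \<xi>) * G \<xi> - cnj (ch (x - axis j 1) \<xi>) * G \<xi>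
       = of_real (2 - 2 * cos (\<xi> j)) * (cnj (ch x \<xi>) * G \<xi>)" for j
      using cc[of j \<xi>] by (simp add: algebra_simps flip: distrib_left distrib_right)
    then show "(\<Sum>j\<in>UNIV. 2 * (cnj (ch x \<xi>) * G \<xi>) - cnj (ch (x + axis j 1) \<xi>) * G \<xi> - cnj (ch (x - axis j 1) \<xi>) * G \<xi>)
       = cnj (ch x \<xi>) * (of_real (hsym \<xi>) * G \<xi>)"
      by (simp only: hsym_def of_real_sum sum_distrib_right[symmetric]) (simp add: ac_simps)
  qed
  finally show ?thesis .
qed

text \<open>The sesquilinear form of the resolvent on functions cut off to \<open>F\<close>. Both
  main estimates are statements about it.\<close>

definition rform :: "complex \<Rightarrow> (int ^ 'n) set \<Rightarrow> (int ^ 'n \<Rightarrow> complex) \<Rightarrow> (int ^ 'n \<Rightarrow> complex) \<Rightarrow> complex" where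
  "rform z F f g = (\<integral>\<xi>. trig F f \<xi> * cnj (trig F g \<xi>) / (of_real (hsym \<xi>) - z) \<partial>torus)"

section \<open>Square summable functions and uniqueness for the resolvent equation\<close>

lemma H0_diff: "H0 (\<lambda>x. u x - v x) x = H0 u x - H0 v x"
  unfolding H0_eq by (simp add: sum_subtractf[symmetric] algebra_simps)

lemma is_l2_shift:
  assumes "is_l2 u"
  shows "is_l2 (\<lambda>x. u (x + a))"
proof -
  have "bij_betw (\<lambda>x. x + a) UNIV UNIV"
    by (rule bij_betwI[of _ _ _ "\<lambda>x. x - a"]) auto
  from summable_on_reindex_bij_betw[OF this, of "\<lambda>x. (cmod (u x))\<^sup>2"]
  show ?thesis using assms by (simp add: is_l2_def)
qed

lemma is_l2_neg:
  assumes "is_l2 u"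
  shows "is_l2 (\<lambda>x. u (a - x))"
proof -
  have "bij_betw (\<lambda>x. a - x) UNIV UNIV"
    by (rule bij_betwI[of _ _ _ "\<lambda>x. a - x"]) auto
  from summable_on_reindex_bij_betw[OF this, of "\<lambda>x. (cmod (u x))\<^sup>2"]
  show ?thesis using assms by (simp add: is_l2_def)
qed

lemma is_l2_mult_summable:
  assumes "is_l2 u" "is_l2 v"
  shows "(\<lambda>x. norm (u x * v x)) summable_on UNIV"
proof (rule Infinite_Sum.abs_summable_on_comparison_test)
  show "(\<lambda>x. norm ((cmod (u x))\<^sup>2 + (cmod (v x))\<^sup>2)) summable_on UNIV"
    using assms unfolding is_l2_def by (auto intro!: summable_on_add)
  fix x
  have "0 \<le> (cmod (u x) - cmod (v x))\<^sup>2" by simp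
  then have "2 * (cmod (u x) * cmod (v x)) \<le> (cmod (u x))\<^sup>2 + (cmod (v x))\<^sup>2"
    by (simp add: power2_eq_square algebra_simps)
  moreover have "0 \<le> cmod (u x) * cmod (v x)" by simp
  ultimately show "norm (u x * v x) \<le> norm ((cmod (u x))\<^sup>2 + (cmod (v x))\<^sup>2)"
    unfolding norm_mult real_norm_def by linarith
qed

lemma is_l2_diff:
  assumes "is_l2 u" "is_l2 v"
  shows "is_l2 (\<lambda>x. u x - v x)"
proof -
  have "(\<lambda>x. (cmod (u x - v x))\<^sup>2) summable_on UNIV"
  proof (rule abs_summable_summable, rule Infinite_Sum.abs_summable_on_comparison_test)
    show "(\<lambda>x. norm (2 * (cmod (u x))\<^sup>2 + 2 * (cmod (v x))\<^sup>2)) summable_on UNIV"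
      using assms unfolding is_l2_def by (auto intro!: summable_on_add summable_on_cmult_right)
    fix x
    have "(cmod (u x - v x))\<^sup>2 \<le> (cmod (u x) + cmod (v x))\<^sup>2"
      by (intro power_mono norm_triangle_ineq4) auto
    also have "\<dots> \<le> 2 * (cmod (u x))\<^sup>2 + 2 * (cmod (v x))\<^sup>2"
      using zero_le_power2[of "cmod (u x) - cmod (v x)"]
      by (simp add: power2_eq_square algebra_simps)
    finally show "norm ((cmod (u x - v x))\<^sup>2) \<le> norm (2 * (cmod (u x))\<^sup>2 + 2 * (cmod (v x))\<^sup>2)"
      by simp
  qed
  then show ?thesis by (simp add: is_l2_def)
qed

lemma has_sum_sum_finite:
  fixes f :: "'i \<Rightarrow> 'a \<Rightarrow> 'b::{comm_monoid_add, topological_comm_monoid_add}"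
  assumes "\<And>i. i \<in> I \<Longrightarrow> (f i has_sum s i) A"
  shows "((\<lambda>x. \<Sum>i\<in>I. f i x) has_sum (\<Sum>i\<in>I. s i)) A"
  using assms by (induction I rule: infinite_finite_induct) (auto intro!: has_sum_add)

text \<open>The imaginary part of \<^term>\<open>cnj (d x) * H0 d x\<close> is a discrete divergence, so it sums to zero.\<close>

lemma H0_eigenfunction_zero:
  assumes d: "is_l2 d" and eq: "\<And>x. H0 d x = z * d x" and z: "Im z \<noteq> 0"
  shows "d x = 0"
proof -
  define q where "q j x = Im (cnj (d x) * d (x + axis j 1))" for j x
  have "((\<lambda>x. q j (x - axis j 1) - q j x) has_sum 0) UNIV" for j
  proof -
    have "is_l2 (\<lambda>x. cnj (d x))" using d by (simp add: is_l2_def)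
    from is_l2_mult_summable[OF this is_l2_shift[OF d, of "axis j 1"]]
    have "(\<lambda>x. cnj (d x) * d (x + axis j 1)) summable_on UNIV"
      by (rule abs_summable_summable)
    then have "q j summable_on UNIV"
      unfolding q_def by (rule summable_on_Im)
    then obtain s where s: "(q j has_sum s) UNIV" by (auto simp: summable_on_def)
    have "((\<lambda>x. q j (x - axis j 1)) has_sum s) UNIV"
    proof -
      have "bij_betw (\<lambda>x. x - axis j (1::int)) UNIV UNIV"
        by (rule bij_betwI[of _ _ _ "\<lambda>x. x + axis j 1"]) auto
      from has_sum_reindex_bij_betw[OF this, of "q j"] s show ?thesis by simp
    qed
    moreover have "((\<lambda>x. - q j x) has_sum - s) UNIV" using s by (simp add: has_sum_uminus)
    ultimately have "((\<lambda>x. q j (x - axis j 1) + - q j x) has_sum s + - s) UNIV" by (rule has_sum_add)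
    then show ?thesis by simp
  qed
  then have "((\<lambda>x. \<Sum>j\<in>UNIV. q j (x - axis j 1) - q j x) has_sum (\<Sum>j\<in>(UNIV::'a set). 0)) UNIV"
    by (intro has_sum_sum_finite) auto
  moreover have "(\<Sum>j\<in>UNIV. q j (x - axis j 1) - q j x) = Im z * (cmod (d x))\<^sup>2" for x
  proof -
    have "Im z * (cmod (d x))\<^sup>2 = Im (cnj (d x) * (z * d x))"
      unfolding cmod_power2 by (simp add: power2_eq_square algebra_simps)
    also have "\<dots> = Im (\<Sum>j\<in>UNIV. cnj (d x) * (2 * d x - d (x + axis j 1) - d (x - axis j 1)))"
      unfolding eq[symmetric] H0_eq sum_distrib_left ..
    also have "\<dots> = (\<Sum>j\<in>UNIV. q j (x - axis j 1) - q j x)"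
      unfolding Im_sum by (intro sum.cong) (simp_all add: q_def algebra_simps)
    finally show ?thesis ..
  qed
  ultimately have "((\<lambda>x. Im z * (cmod (d x))\<^sup>2) has_sum 0) UNIV" by simp
  then have "((\<lambda>x. inverse (Im z) * (Im z * (cmod (d x))\<^sup>2)) has_sum inverse (Im z) * 0) UNIV"
    by (rule has_sum_cmult_right)
  then have "((\<lambda>x. (cmod (d x))\<^sup>2) has_sum 0) UNIV" using z by (simp add: mult.assoc[symmetric])
  from nonneg_has_sum_le_0D[OF this, of x] show ?thesis by simp
qed

lemma H0_solution_unique:
  assumes "is_l2 v" "is_l2 w" "\<And>x. H0 v x - z * v x = f x" "\<And>x. H0 w x - z * w x = f x" "Im z \<noteq> 0"
  shows "v = w"
proof
  fix x
  have "v x - w x = 0"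
  proof (rule H0_eigenfunction_zero[where d = "\<lambda>x. v x - w x" and z = z])
    fix x
    show "H0 (\<lambda>x. v x - w x) x = z * (v x - w x)"
      using assms(3)[of x] assms(4)[of x] by (simp add: H0_diff algebra_simps)
  qed (use assms in \<open>auto intro: is_l2_diff\<close>)
  then show "v x = w x" by simp
qed

section \<open>The resolvent as a limit of finite convolutions with the Green kernel\<close>

lemma green_trunc:
  assumes z: "Im z \<noteq> 0"
  shows "(\<Sum>y\<in>F. green z (x - y) * f y) = (\<integral>\<xi>. cnj (ch x \<xi>) * (trig F f \<xi> / (of_real (hsym \<xi>) - z)) \<partial>torus)"
proof -
  have e: "cnj (ch x \<xi>) * (trig F f \<xi> / (of_real (hsym \<xi>) - z))
     = (\<Sum>y\<in>F. f y * (cnj (ch (x - y) \<xi>) / (of_real (hsym \<xi>) - z)))" for \<xi>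
  proof -
    have "cnj (ch (x - y) \<xi>) = cnj (ch x \<xi>) * ch y \<xi>" for y
      by (simp add: cnj_ch flip: ch_add)
    then show ?thesis
      by (simp add: trig_def sum_divide_distrib sum_distrib_left ac_simps)
  qed
  show ?thesis unfolding e green_def
    by (subst Bochner_Integration.integral_sum)
      (auto intro!: bounded_meas_integrable bounded_meas_intros bounded_meas_div_hsym bounded_meas_ch z
         simp: mult.commute simp del: times_divide_eq_right times_divide_eq_left)
qed

lemma green_trunc_solves:
  fixes f :: "int ^ 'n \<Rightarrow> complex"
  assumes z: "Im z \<noteq> 0" and F: "finite F"
  defines "w \<equiv> \<lambda>x. \<Sum>y\<in>F. green z (x - y) * f y"
  shows "H0 w x - z * w x = (if x \<in> F then f x else 0)"
proof -
  note I = bounded_meas_integrable bounded_meas_intros bounded_meas_ch bounded_meas_trig bounded_meas_div_hsym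
     bounded_meas_hsym z
  define G where "G \<xi> = trig F f \<xi> / (of_real (hsym \<xi>) - z)" for \<xi>
  have G: "bounded_meas G" unfolding G_def by (intro I)
  have w: "w = (\<lambda>x. \<integral>\<xi>. cnj (ch x \<xi>) * G \<xi> \<partial>torus)"
    unfolding w_def G_def green_trunc[OF z] ..
  have "H0 w x - z * w x = (\<integral>\<xi>. cnj (ch x \<xi>) * (of_real (hsym \<xi>) * G \<xi>) \<partial>torus) - (\<integral>\<xi>. z * (cnj (ch x \<xi>) * G \<xi>) \<partial>torus)"
    unfolding w H0_fourier[OF G] by simp
  also have "\<dots> = (\<integral>\<xi>. cnj (ch x \<xi>) * (of_real (hsym \<xi>) * G \<xi>) - z * (cnj (ch x \<xi>) * G \<xi>) \<partial>torus)"
    by (rule Bochner_Integration.integral_diff[symmetric]) (intro I G)+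
  also have "\<dots> = (\<integral>\<xi>. (\<Sum>y\<in>F. f y * ch (y - x) \<xi>) \<partial>torus)"
  proof (intro Bochner_Integration.integral_cong refl)
    fix \<xi> :: "'n \<Rightarrow> real"
    have ne: "of_real (hsym \<xi>) - z \<noteq> 0" using z by (auto simp: complex_eq_iff)
    have "cnj (ch x \<xi>) * (of_real (hsym \<xi>) * G \<xi>) - z * (cnj (ch x \<xi>) * G \<xi>)
        = cnj (ch x \<xi>) * ((of_real (hsym \<xi>) - z) * G \<xi>)" by (simp add: algebra_simps)
    also have "\<dots> = cnj (ch x \<xi>) * trig F f \<xi>" using ne by (simp add: G_def)
    also have "\<dots> = (\<Sum>y\<in>F. f y * ch (y - x) \<xi>)"
      by (simp add: trig_def sum_distrib_left cnj_ch ac_simps flip: ch_add)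
    finally show "cnj (ch x \<xi>) * (of_real (hsym \<xi>) * G \<xi>) - z * (cnj (ch x \<xi>) * G \<xi>) = (\<Sum>y\<in>F. f y * ch (y - x) \<xi>)" .
  qed
  also have "\<dots> = (\<Sum>y\<in>F. f y * (\<integral>\<xi>. ch (y - x) \<xi> \<partial>torus))"
    by (subst Bochner_Integration.integral_sum) (auto intro!: I)
  also have "\<dots> = (if x \<in> F then f x else 0)"
    using F by (simp add: torus_integral_ch if_distrib[of "\<lambda>c. _ * c"] cong: if_cong)
  finally show ?thesis .
qed

text \<open>Bessel moves the sum over \<open>G\<close> to the torus, where
  \<open>\<bar>Im z\<bar>\<close> bounds the denominator from below. The bound is free of
  \<open>G\<close> and sees \<open>F\<close> only through the norm of \<open>f\<close>, which lets
  both truncations be removed later.\<close>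

lemma green_trunc_l2:
  fixes f :: "int ^ 'n \<Rightarrow> complex"
  assumes z: "Im z \<noteq> 0" and F: "finite F" and G: "finite G"
  shows "(\<Sum>x\<in>G. (cmod (\<Sum>y\<in>F. green z (x - y) * f y))\<^sup>2) \<le> (\<Sum>y\<in>F. (cmod (f y))\<^sup>2) / (Im z)\<^sup>2"
proof -
  note I = bounded_meas_integrable bounded_meas_intros bounded_meas_ch bounded_meas_trig bounded_meas_div_hsym
     bounded_meas_hsym z
  have "(\<Sum>x\<in>G. (cmod (\<Sum>y\<in>F. green z (x - y) * f y))\<^sup>2)
    \<le> (\<integral>\<xi>. (cmod (trig F f \<xi> / (of_real (hsym \<xi>) - z)))\<^sup>2 \<partial>torus)"
    unfolding green_trunc[OF z] by (intro fourier_bessel G I)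
  also have "\<dots> \<le> (\<integral>\<xi>. inverse ((Im z)\<^sup>2) * (cmod (trig F f \<xi>))\<^sup>2 \<partial>torus)"
  proof (rule integral_mono)
    fix \<xi> :: "'n \<Rightarrow> real"
    have "(Im z)\<^sup>2 \<le> (cmod (of_real (hsym \<xi>) - z))\<^sup>2"
      using norm_hsym_diff_ge[of z \<xi>] by (metis abs_le_square_iff abs_norm_cancel)
    then show "(cmod (trig F f \<xi> / (of_real (hsym \<xi>) - z)))\<^sup>2 \<le> inverse ((Im z)\<^sup>2) * (cmod (trig F f \<xi>))\<^sup>2"
      unfolding norm_divide power_divide divide_inverse[of "_ ^ 2"] mult.commute[of "inverse _"]
      using z by (intro mult_left_mono le_imp_inverse_le) auto
  qed (intro I)+
  also have "\<dots> = (\<Sum>y\<in>F. (cmod (f y))\<^sup>2) / (Im z)\<^sup>2"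
    by (simp add: trig_parseval_norm[OF F] divide_inverse mult.commute)
  finally show ?thesis .
qed

lemma green_is_l2:
  assumes z: "Im z \<noteq> 0"
  shows "is_l2 (green z)"
proof -
  have "(\<lambda>x. (cmod (green z x))\<^sup>2) summable_on UNIV"
  proof (rule nonneg_bdd_above_summable_on)
    show "bdd_above (sum (\<lambda>x. (cmod (green z x))\<^sup>2) ` {F. F \<subseteq> UNIV \<and> finite F})"
      using green_trunc_l2[OF z, of "{0}" _ "\<lambda>_. 1"] by (auto intro!: bdd_aboveI[where M = "1 / (Im z)\<^sup>2"])
  qed auto
  then show ?thesis by (simp add: is_l2_def)
qed

lemma sum_le_l2_norm:
  assumes "is_l2 u" "finite F"
  shows "(\<Sum>x\<in>F. (cmod (u x))\<^sup>2) \<le> (l2_norm u)\<^sup>2"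
  using assms unfolding l2_norm_def is_l2_def
  by (simp add: infsum_nonneg) (rule finite_sum_le_infsum, auto)

lemma is_l2_boundedI:
  assumes "\<And>F. finite F \<Longrightarrow> (\<Sum>x\<in>F. (cmod (u x))\<^sup>2) \<le> B"
  shows "is_l2 u"
  unfolding is_l2_def
  by (rule nonneg_bdd_above_summable_on) (use assms in \<open>auto intro!: bdd_aboveI[where M = B]\<close>)

lemma l2_norm_le:
  assumes "\<And>F. finite F \<Longrightarrow> (\<Sum>x\<in>F. (cmod (u x))\<^sup>2) \<le> B\<^sup>2" "B \<ge> 0"
  shows "l2_norm u \<le> B"
proof -
  have "is_l2 u" using assms(1) by (rule is_l2_boundedI)
  then have "infsum (\<lambda>x. (cmod (u x))\<^sup>2) UNIV \<le> B\<^sup>2"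
    unfolding is_l2_def by (rule infsum_le_finite_sums) (rule assms(1))
  then show ?thesis unfolding l2_norm_def
    using assms(2) by (intro real_le_lsqrt) (auto intro: infsum_nonneg)
qed

text \<open>\<open>resolvent\<close> is a definite description, so the equation must be shown to
  have exactly one square summable solution. The convolution of \<open>green z\<close> with
  \<open>f\<close> converges absolutely, as a product of two such functions; that it is square
  summable and solves the equation passes to the limit from the truncations, since \<open>H0\<close>
  couples only finitely many points.\<close>

lemma resolvent_eq:
  fixes f :: "int ^ 'n \<Rightarrow> complex"
  assumes z: "Im z \<noteq> 0" and f: "is_l2 f"
  shows "((\<lambda>F. \<Sum>y\<in>F. green z (x - y) * f y) \<longlongrightarrow> resolvent z f x) (finite_subsets_at_top UNIV)"
proof -
  define w where "w x = infsum (\<lambda>y. green z (x - y) * f y) UNIV" for x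
  have lim: "((\<lambda>F. \<Sum>y\<in>F. green z (x - y) * f y) \<longlongrightarrow> w x) (finite_subsets_at_top UNIV)" for x
  proof -
    have "(\<lambda>y. green z (x - y) * f y) summable_on UNIV"
      by (rule abs_summable_summable[OF is_l2_mult_summable[OF is_l2_neg[OF green_is_l2[OF z]] f]])
    then show ?thesis unfolding w_def by (rule infsum_tendsto)
  qed
  have w: "is_l2 w"
  proof (rule is_l2_boundedI)
    fix G :: "(int^'n) set" assume G: "finite G"
    show "(\<Sum>x\<in>G. (cmod (w x))\<^sup>2) \<le> (l2_norm f)\<^sup>2 / (Im z)\<^sup>2"
    proof (rule tendsto_upperbound)
      show "((\<lambda>F. \<Sum>x\<in>G. (cmod (\<Sum>y\<in>F. green z (x - y) * f y))\<^sup>2) \<longlongrightarrow> (\<Sum>x\<in>G. (cmod (w x))\<^sup>2)) (finite_subsets_at_top UNIV)"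
        by (intro tendsto_intros lim)
      show "\<forall>\<^sub>F F in finite_subsets_at_top UNIV. (\<Sum>x\<in>G. (cmod (\<Sum>y\<in>F. green z (x - y) * f y))\<^sup>2) \<le> (l2_norm f)\<^sup>2 / (Im z)\<^sup>2"
      proof (rule eventually_finite_subsets_at_top_weakI)
        fix F :: "(int^'n) set" assume F: "finite F"
        show "(\<Sum>x\<in>G. (cmod (\<Sum>y\<in>F. green z (x - y) * f y))\<^sup>2) \<le> (l2_norm f)\<^sup>2 / (Im z)\<^sup>2"
          using green_trunc_l2[OF z F G, of f] sum_le_l2_norm[OF f F]
          by (meson divide_right_mono order_trans zero_le_power2)
      qed
    qed simp
  qed
  have eq: "H0 w x - z * w x = f x" for x
  proof (rule tendsto_unique)
    let ?W = "\<lambda>F x. \<Sum>y\<in>F. green z (x - y) * f y"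
    show "((\<lambda>F. H0 (?W F) x - z * ?W F x) \<longlongrightarrow> H0 w x - z * w x) (finite_subsets_at_top UNIV)"
      unfolding H0_eq by (intro tendsto_intros lim)
    \<comment> \<open>Once the truncation contains \<open>x\<close>, the truncated equation holds
      exactly at \<open>x\<close>.\<close>
    have "\<forall>\<^sub>F F in finite_subsets_at_top UNIV. f x = H0 (?W F) x - z * ?W F x"
      unfolding eventually_finite_subsets_at_top
      by (rule exI[of _ "{x}"]) (auto simp: green_trunc_solves[OF z])
    then show "((\<lambda>F. H0 (?W F) x - z * ?W F x) \<longlongrightarrow> f x) (finite_subsets_at_top UNIV)"
      by (rule Lim_transform_eventually[OF tendsto_const])
  qed simp
  have "resolvent z f = w"
    unfolding resolvent_def
  proof (rule the_equality)
    show "is_l2 w \<and> (\<forall>x. H0 w x - z * w x = f x)" using w eq by simp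
    show "v = w" if "is_l2 v \<and> (\<forall>x. H0 v x - z * v x = f x)" for v
      using that by (intro H0_solution_unique[OF _ w _ eq z]) simp_all
  qed
  then show ?thesis using lim by simp
qed

section \<open>Reduction of the uniform bound to an estimate on forms\<close>

lemma rform_cnj: "rform (cnj z) F f g = cnj (rform z F g f)"
proof -
  have "cnj (rform z F g f) = (\<integral>\<xi>. cnj (trig F g \<xi> * cnj (trig F f \<xi>) / (of_real (hsym \<xi>) - z)) \<partial>torus)"
    unfolding rform_def by (rule Bochner_Integration.integral_cnj[symmetric])
  then show ?thesis by (simp add: rform_def mult.commute)
qed

lemma rform_eq_sum:
  assumes z: "Im z \<noteq> 0"
  shows "rform z F f g = (\<Sum>x\<in>F. (\<Sum>y\<in>F. green z (x - y) * f y) * cnj (g x))"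
proof -
  have "rform z F f g = (\<integral>\<xi>. (\<Sum>x\<in>F. cnj (g x) * (cnj (ch x \<xi>) * (trig F f \<xi> / (of_real (hsym \<xi>) - z)))) \<partial>torus)"
    unfolding rform_def trig_def[of F g]
    by (intro Bochner_Integration.integral_cong refl) (simp add: sum_distrib_left sum_divide_distrib ac_simps)
  also have "\<dots> = (\<Sum>x\<in>F. (\<Sum>y\<in>F. green z (x - y) * f y) * cnj (g x))"
    unfolding green_trunc[OF z]
    by (subst Bochner_Integration.integral_sum)
      (auto intro!: bounded_meas_integrable bounded_meas_intros bounded_meas_div_hsym bounded_meas_ch bounded_meas_trig z
        simp: mult.commute simp del: times_divide_eq_right times_divide_eq_left)
  finally show ?thesis .
qed

text \<open>Duality. A right side that is additive in \<open>u\<close> and \<open>v\<close> suffices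
  because \<open>v\<close> may be rescaled, and it is the shape in which both main estimates arrive.
  Boundedness of \<open>V\<close> keeps the data square summable, where the resolvent is
  characterised; the lower half plane follows by conjugation.\<close>

lemma uniform_resolvent_boundI:
  fixes V :: "int ^ 'n \<Rightarrow> real"
  assumes V: "\<And>x. \<bar>V x\<bar> \<le> K" and M: "M > 0"
    and form: "\<And>z F u v. Im z > 0 \<Longrightarrow> finite F \<Longrightarrow>
      cmod (rform z F (\<lambda>x. of_real (sqrt \<bar>V x\<bar>) * u x) (\<lambda>x. of_real (sqrt \<bar>V x\<bar>) * v x))
        \<le> M * ((\<Sum>x\<in>F. (cmod (u x))\<^sup>2) + (\<Sum>x\<in>F. (cmod (v x))\<^sup>2))"
  shows "uniform_resolvent_bound V"
proof -
  let ?q = "\<lambda>x. complex_of_real (sqrt \<bar>V x\<bar>)"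
  have form': "cmod (rform z F (\<lambda>x. ?q x * u x) (\<lambda>x. ?q x * v x))
        \<le> M * ((\<Sum>x\<in>F. (cmod (u x))\<^sup>2) + (\<Sum>x\<in>F. (cmod (v x))\<^sup>2))"
    if z: "Im z \<noteq> 0" and F: "finite F" for z F u v
  proof (cases "Im z > 0")
    case False
    then have "Im (cnj z) > 0" using z by simp
    from form[OF this F, of v u] rform_cnj[of z F "\<lambda>x. ?q x * v x" "\<lambda>x. ?q x * u x"] z
    show ?thesis by (simp add: add.commute)
  qed (use form F in auto)
  have key: "(\<Sum>x\<in>G. (cmod (?q x * (\<Sum>y\<in>F. green z (x - y) * (?q y * u y))))\<^sup>2)
       \<le> (2 * M)\<^sup>2 * (\<Sum>x\<in>F. (cmod (u x))\<^sup>2)"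
    if z: "Im z \<noteq> 0" and F: "finite F" and G: "finite G" for z F G u
  proof -
    define H where "H = F \<union> G"
    have H: "finite H" using F G by (simp add: H_def)
    define u' where "u' x = (if x \<in> F then u x else 0)" for x
    define w where "w x = (\<Sum>y\<in>F. green z (x - y) * (?q y * u y))" for x
    define N where "N = (\<Sum>x\<in>G. (cmod (?q x * w x))\<^sup>2)"
    define U where "U = (\<Sum>x\<in>F. (cmod (u x))\<^sup>2)"
    \<comment> \<open>With \<open>v\<close> below, the form estimate reads
      \<open>t * N \<le> M * (U + t\<^sup>2 * N)\<close>. This \<open>t\<close> makes the last term
      half of the left side, which yields the operator bound \<open>2 * M\<close>.\<close>
    define t where "t = 1 / (2 * M)"
    define v where "v x = (if x \<in> G then of_real t * (?q x * w x) else 0)" for x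
    have w': "(\<Sum>y\<in>H. green z (x - y) * (?q y * u' y)) = w x" for x
      unfolding w_def H_def
      by (rule sum.mono_neutral_cong_right) (use F G in \<open>auto simp: u'_def\<close>)
    have "rform z H (\<lambda>x. ?q x * u' x) (\<lambda>x. ?q x * v x) = (\<Sum>x\<in>H. w x * cnj (?q x * v x))"
      unfolding rform_eq_sum[OF z] w' ..
    also have "\<dots> = (\<Sum>x\<in>G. of_real t * complex_of_real ((cmod (?q x * w x))\<^sup>2))"
      unfolding complex_norm_square H_def
      by (rule sum.mono_neutral_cong_right) (use F G in \<open>auto simp: v_def ac_simps\<close>)
    also have "\<dots> = of_real (t * N)"
      unfolding N_def of_real_mult of_real_sum sum_distrib_left ..
    finally have rf: "rform z H (\<lambda>x. ?q x * u' x) (\<lambda>x. ?q x * v x) = of_real (t * N)" .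
    have "t * N \<ge> 0"
      using M unfolding t_def N_def by (intro mult_nonneg_nonneg sum_nonneg) auto
    then have "cmod (rform z H (\<lambda>x. ?q x * u' x) (\<lambda>x. ?q x * v x)) = t * N"
      unfolding rf norm_of_real by simp
    moreover have "(\<Sum>x\<in>H. (cmod (u' x))\<^sup>2) = U"
      unfolding U_def H_def
      by (rule sum.mono_neutral_cong_right) (use F G in \<open>auto simp: u'_def\<close>)
    moreover have "(\<Sum>x\<in>H. (cmod (v x))\<^sup>2) = t\<^sup>2 * N"
    proof -
      have "(\<Sum>x\<in>H. (cmod (v x))\<^sup>2) = (\<Sum>x\<in>G. t\<^sup>2 * (cmod (?q x * w x))\<^sup>2)"
        unfolding H_def
        by (rule sum.mono_neutral_cong_right) (use F G in \<open>auto simp: v_def norm_mult power_mult_distrib\<close>)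
      then show ?thesis by (simp add: N_def sum_distrib_left)
    qed
    ultimately have "t * N \<le> M * (U + t\<^sup>2 * N)"
      using form'[OF z H, of u' v] by simp
    then have "N \<le> (2 * M)\<^sup>2 * U"
      using M by (simp add: t_def power2_eq_square field_simps)
    then show ?thesis unfolding N_def U_def w_def .
  qed
  show ?thesis
    unfolding uniform_resolvent_bound_def
  proof (intro exI allI impI)
    fix z and u :: "int^'n \<Rightarrow> complex" assume z: "Im z \<noteq> 0" and u: "is_l2 u"
    have f: "is_l2 (\<lambda>y. ?q y * u y)"
    proof (rule is_l2_boundedI)
      fix F :: "(int^'n) set" assume F: "finite F"
      have "(\<Sum>x\<in>F. (cmod (?q x * u x))\<^sup>2) \<le> (\<Sum>x\<in>F. K * (cmod (u x))\<^sup>2)"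
        using V by (intro sum_mono) (auto simp: norm_mult power_mult_distrib intro!: mult_right_mono)
      also have "\<dots> = K * (\<Sum>x\<in>F. (cmod (u x))\<^sup>2)" by (simp add: sum_distrib_left)
      also have "\<dots> \<le> K * (l2_norm u)\<^sup>2"
        using V[of 0] by (intro mult_left_mono sum_le_l2_norm u F) linarith
      finally show "(\<Sum>x\<in>F. (cmod (?q x * u x))\<^sup>2) \<le> K * (l2_norm u)\<^sup>2" .
    qed
    show "l2_norm (\<lambda>x. ?q x * resolvent z (\<lambda>y. ?q y * u y) x) \<le> (2 * M) * l2_norm u"
    proof (rule l2_norm_le)
      show "0 \<le> 2 * M * l2_norm u" using M by (simp add: l2_norm_def infsum_nonneg)
      fix G :: "(int^'n) set" assume G: "finite G"
      show "(\<Sum>x\<in>G. (cmod (?q x * resolvent z (\<lambda>y. ?q y * u y) x))\<^sup>2) \<le> (2 * M * l2_norm u)\<^sup>2"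
      proof (rule tendsto_upperbound)
        show "((\<lambda>F. \<Sum>x\<in>G. (cmod (?q x * (\<Sum>y\<in>F. green z (x - y) * (?q y * u y))))\<^sup>2) \<longlongrightarrow>
          (\<Sum>x\<in>G. (cmod (?q x * resolvent z (\<lambda>y. ?q y * u y) x))\<^sup>2)) (finite_subsets_at_top UNIV)"
          by (intro tendsto_intros resolvent_eq z f)
        show "\<forall>\<^sub>F F in finite_subsets_at_top UNIV.
           (\<Sum>x\<in>G. (cmod (?q x * (\<Sum>y\<in>F. green z (x - y) * (?q y * u y))))\<^sup>2) \<le> (2 * M * l2_norm u)\<^sup>2"
        proof (rule eventually_finite_subsets_at_top_weakI)
          fix F :: "(int^'n) set" assume F: "finite F"
          have "(2 * M)\<^sup>2 * (\<Sum>x\<in>F. (cmod (u x))\<^sup>2) \<le> (2 * M * l2_norm u)\<^sup>2"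
            using sum_le_l2_norm[OF u F] by (simp only: power_mult_distrib mult_left_mono zero_le_power2 zero_le_mult_iff)
              (simp add: mult_left_mono)
          with key[OF z F G, of u]
          show "(\<Sum>x\<in>G. (cmod (?q x * (\<Sum>y\<in>F. green z (x - y) * (?q y * u y))))\<^sup>2) \<le> (2 * M * l2_norm u)\<^sup>2"
            by linarith
        qed
      qed simp
    qed
  qed
qed

subsection \<open>Integration by parts on the torus\<close>

text \<open>Fubini isolates the coordinate \<open>j\<close>; the fundamental theorem over one period
  leaves boundary terms that cancel.\<close>

lemma torus_integral_partial_derivative:
  fixes \<Phi> \<Phi>' :: "('n::finite \<Rightarrow> real) \<Rightarrow> complex"
  assumes bm: "bounded_meas \<Phi>'"
    and deriv: "\<And>\<xi>. ((\<lambda>s. \<Phi> (\<xi>(j := s))) has_vector_derivative \<Phi>' \<xi>) (at (\<xi> j))"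
    and per: "\<And>\<xi>. \<Phi> (\<xi>(j := 3 * pi / 2)) = \<Phi> (\<xi>(j := - (pi / 2)))"
  shows "(\<integral>\<xi>. \<Phi>' \<xi> \<partial>torus) = 0"
proof -
  have inner: "(\<integral>s. \<Phi>' (\<xi>(j := s)) \<partial>circle_measure) = 0" for \<xi>
  proof -
    have upd: "(\<lambda>s. \<xi>(j := s)) \<in> measurable borel torus"
      unfolding torus_def
      by (rule measurable_PiM_single') (auto simp: space_PiM cong: measurable_cong_sets)
    obtain B where B: "\<And>\<xi>. cmod (\<Phi>' \<xi>) \<le> B" and m: "\<Phi>' \<in> borel_measurable torus"
      using bm by (auto simp: bounded_meas_def)
    have "((\<lambda>s. \<Phi>' (\<xi>(j := s))) has_integral (2 * pi) *\<^sub>R (\<integral>s. \<Phi>' (\<xi>(j := s)) \<partial>circle_measure)) period"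
      by (rule circle_measure_has_integral[where B = B]) (use B measurable_compose[OF upd m] in auto)
    moreover have "((\<lambda>s. \<Phi>' (\<xi>(j := s))) has_integral (\<Phi> (\<xi>(j := 3 * pi / 2)) - \<Phi> (\<xi>(j := - (pi / 2))))) period"
    proof (rule fundamental_theorem_of_calculus)
      fix s :: real
      show "((\<lambda>s. \<Phi> (\<xi>(j := s))) has_vector_derivative \<Phi>' (\<xi>(j := s))) (at s within period)"
        using deriv[of "\<xi>(j := s)"] by (auto intro: has_vector_derivative_at_within)
    qed simp
    ultimately have "(2 * pi) *\<^sub>R (\<integral>s. \<Phi>' (\<xi>(j := s)) \<partial>circle_measure) = 0"
      by (metis per diff_self has_integral_unique)
    then show ?thesis by simp
  qed
  show ?thesis
    by (subst product_fubini_component[OF bounded_meas_integrable[OF bm], of j]) (simp add: inner)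
qed

abbreviation dtrig :: "'n \<Rightarrow> (int ^ 'n) set \<Rightarrow> (int ^ 'n \<Rightarrow> complex) \<Rightarrow> ('n \<Rightarrow> real) \<Rightarrow> complex" where
  "dtrig j F f \<equiv> trig F (\<lambda>x. \<i> * of_int (x $ j) * f x)"

lemma ch_update: "ch x (\<xi>(j := s)) = cis (real_of_int (x $ j) * (s - \<xi> j)) * ch x \<xi>"
proof -
  have "ch x (\<xi>(j := s)) = cis (real_of_int (x $ j) * s) * (\<Prod>i\<in>UNIV - {j}. cis (real_of_int (x $ i) * \<xi> i))"
    unfolding ch_def by (subst prod.remove[of _ j]) auto
  moreover have "ch x \<xi> = cis (real_of_int (x $ j) * \<xi> j) * (\<Prod>i\<in>UNIV - {j}. cis (real_of_int (x $ i) * \<xi> i))"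
    unfolding ch_def by (subst prod.remove[of _ j]) auto
  ultimately show ?thesis
    by (simp add: cis_mult algebra_simps flip: mult.assoc)
qed

lemma trig_partial_derivative:
  "((\<lambda>s. trig F f (\<xi>(j := s))) has_vector_derivative dtrig j F f \<xi>) (at (\<xi> j))"
proof -
  have "((\<lambda>s. \<Sum>x\<in>F. f x * (cis (real_of_int (x $ j) * (s - \<xi> j)) * ch x \<xi>)) has_vector_derivative
      (\<Sum>x\<in>F. f x * ((of_int (x $ j) * \<i>) * ch x \<xi>))) (at (\<xi> j))"
  proof (intro has_vector_derivative_sum has_vector_derivative_mult_right has_vector_derivative_mult_left)
    fix x
    show "((\<lambda>s. cis (real_of_int (x $ j) * (s - \<xi> j))) has_vector_derivative of_int (x $ j) * \<i>) (at (\<xi> j))"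
      unfolding has_vector_derivative_def
      by (auto intro!: derivative_eq_intros simp: scaleR_conv_of_real)
  qed
  then show ?thesis
    unfolding trig_def ch_update by (simp add: ac_simps)
qed

text \<open>The divergence theorem for the field with components
  \<open>a (\<xi> j) * (cmod (trig F f \<xi>))\<^sup>2 / D \<xi>\<close>. As \<open>D\<close> is a
  sum of functions of one coordinate each, its partial derivatives are \<open>p' (\<xi> j)\<close>.
  It serves twice: with \<open>D = bsym + \<eta>\<close> for the Hardy inequality, and with the
  regularised \<open>hsym - z\<close> for the commutator estimate.\<close>

lemma torus_ibp:
  fixes p p' :: "real \<Rightarrow> complex" and a a' :: "real \<Rightarrow> real" and f :: "int ^ 'n \<Rightarrow> complex"
  assumes p: "\<And>s. (p has_vector_derivative p' s) (at s)" "p (3 * pi / 2) = p (- (pi / 2))"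
    and a: "\<And>s. (a has_real_derivative a' s) (at s)" "a (3 * pi / 2) = a (- (pi / 2))"
    and bm: "\<And>j::'n. bounded_meas (\<lambda>\<xi>. p (\<xi> j))" "\<And>j::'n. bounded_meas (\<lambda>\<xi>. p' (\<xi> j))"
      "\<And>j::'n. bounded_meas (\<lambda>\<xi>. a (\<xi> j))" "\<And>j::'n. bounded_meas (\<lambda>\<xi>. a' (\<xi> j))"
    and D: "\<And>\<xi>. D \<xi> = c + (\<Sum>j\<in>UNIV. p (\<xi> j))" "\<And>\<xi>. \<delta> \<le> cmod (D \<xi>)" "\<delta> > 0"
  shows "(\<integral>\<xi>. (\<Sum>j\<in>UNIV. of_real (a' (\<xi> j) * (cmod (trig F f \<xi>))\<^sup>2) / D \<xi>
      + of_real (a (\<xi> j) * (2 * Re (dtrig j F f \<xi> * cnj (trig F f \<xi>)))) / D \<xi>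
      - of_real (a (\<xi> j) * (cmod (trig F f \<xi>))\<^sup>2) * p' (\<xi> j) / (D \<xi>)\<^sup>2) \<partial>torus) = 0"
    (is "(\<integral>\<xi>. (\<Sum>j\<in>UNIV. ?J j \<xi>) \<partial>torus) = 0")
proof -
  have D0: "D \<xi> \<noteq> 0" for \<xi> using D(2)[of \<xi>] D(3) by auto
  have bmD: "bounded_meas D" unfolding D(1)[abs_def] by (intro bounded_meas_intros bm)
  have bmD2: "bounded_meas (\<lambda>\<xi>. inverse (D \<xi>))"
    using bounded_meas_divide[OF bounded_meas_const[of 1] bmD D(2,3)] by (simp add: divide_inverse)
  have bmJ: "bounded_meas (?J j)" for j
    unfolding divide_inverse power_inverse[symmetric]
    by (intro bounded_meas_intros bounded_meas_trig bm bmD2)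
  have "(\<integral>\<xi>. ?J j \<xi> \<partial>torus) = 0" for j
  proof (rule torus_integral_partial_derivative[OF bmJ,
        where \<Phi> = "\<lambda>\<xi>. of_real (a (\<xi> j)) * ((trig F f \<xi> * cnj (trig F f \<xi>)) * inverse (D \<xi>))" and j = j])
    fix \<xi> :: "'n \<Rightarrow> real"
    let ?\<phi> = "\<lambda>s. trig F f (\<xi>(j := s))" and ?s = "\<xi> j"
    have upd: "D (\<xi>(j := s)) = c + (\<Sum>i\<in>UNIV - {j}. p (\<xi> i)) + p s" for s
      unfolding D(1) by (subst sum.remove[of _ j]) auto
    have dD: "((\<lambda>s. D (\<xi>(j := s))) has_vector_derivative p' ?s) (at ?s)"
      unfolding upd using p(1)[of ?s] by (auto intro!: derivative_eq_intros)
    have dI: "((\<lambda>s. inverse (D (\<xi>(j := s)))) has_vector_derivative p' ?s * - (inverse (D \<xi>) ^ 2)) (at ?s)"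
      using field_vector_diff_chain_at[OF dD, of inverse "- (inverse (D \<xi>) ^ Suc (Suc 0))"]
        DERIV_inverse[of "D (\<xi>(j := \<xi> j))"] D0[of \<xi>]
      by (simp add: o_def numeral_2_eq_2)
    have da: "((\<lambda>s. complex_of_real (a s)) has_vector_derivative of_real (a' ?s)) (at ?s)"
      using a(1)[of ?s] by (simp add: has_real_derivative_iff_has_vector_derivative has_vector_derivative_of_real)
    note d\<phi> = trig_partial_derivative[of F f \<xi> j]
    have d\<phi>': "((\<lambda>s. cnj (?\<phi> s)) has_vector_derivative cnj (dtrig j F f \<xi>)) (at ?s)"
      by (rule has_vector_derivative_cnj[OF d\<phi>])
    have "((\<lambda>s. of_real (a s) * ((?\<phi> s * cnj (?\<phi> s)) * inverse (D (\<xi>(j := s))))) has_vector_derivative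
       of_real (a ?s) * ((?\<phi> ?s * cnj (?\<phi> ?s)) * (p' ?s * - (inverse (D \<xi>) ^ 2))
         + (?\<phi> ?s * cnj (dtrig j F f \<xi>) + dtrig j F f \<xi> * cnj (?\<phi> ?s)) * inverse (D (\<xi>(j := ?s))))
       + of_real (a' ?s) * ((?\<phi> ?s * cnj (?\<phi> ?s)) * inverse (D (\<xi>(j := ?s))))) (at ?s)"
      by (intro has_vector_derivative_mult da d\<phi> d\<phi>' dI)
    moreover have "of_real (2 * Re (dtrig j F f \<xi> * cnj (trig F f \<xi>)))
       = trig F f \<xi> * cnj (dtrig j F f \<xi>) + dtrig j F f \<xi> * cnj (trig F f \<xi>)"
      by (simp add: complex_eq_iff)
    ultimately show "((\<lambda>s. of_real (a ((\<xi>(j := s)) j)) * ((?\<phi> s * cnj (?\<phi> s)) * inverse (D (\<xi>(j := s)))))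
        has_vector_derivative ?J j \<xi>) (at (\<xi> j))"
      unfolding of_real_mult[of "a _"] of_real_mult[of "a' _"] complex_norm_square
      by (simp add: divide_inverse algebra_simps power_inverse)
  next
    fix \<xi> :: "'n \<Rightarrow> real"
    have "trig F f (\<xi>(j := 3 * pi / 2)) = trig F f (\<xi>(j := - (pi / 2)))"
    proof -
      have "cis (real_of_int n * (3 * pi / 2 - t)) = cis (real_of_int n * (- (pi / 2) - t))" for n t
      proof -
        have "cis (real_of_int n * (3 * pi / 2 - t)) = cis (real_of_int n * (- (pi / 2) - t) + 2 * pi * n)"
          by (rule arg_cong[of _ _ cis]) (simp add: field_simps)
        then show ?thesis unfolding cis_mult[symmetric] by (simp add: cis_multiple_2pi)
      qed
      then show ?thesis unfolding trig_def ch_update by metis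
    qed
    moreover have "D (\<xi>(j := 3 * pi / 2)) = D (\<xi>(j := - (pi / 2)))"
      unfolding D(1) using p(2) by (intro arg_cong2[of _ _ _ _ plus] sum.cong) auto
    ultimately show "of_real (a ((\<xi>(j := 3 * pi / 2)) j)) * (trig F f (\<xi>(j := 3 * pi / 2)) * cnj (trig F f (\<xi>(j := 3 * pi / 2))) * inverse (D (\<xi>(j := 3 * pi / 2))))
       = of_real (a ((\<xi>(j := - (pi / 2))) j)) * (trig F f (\<xi>(j := - (pi / 2))) * cnj (trig F f (\<xi>(j := - (pi / 2)))) * inverse (D (\<xi>(j := - (pi / 2)))))"
      using a(2) by simp
  qed
  then have "(\<Sum>j\<in>UNIV. \<integral>\<xi>. ?J j \<xi> \<partial>torus) = 0" by (simp only: sum.neutral_const)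
  then show ?thesis
    by (subst Bochner_Integration.integral_sum[OF bounded_meas_integrable[OF bmJ]])
qed

subsection \<open>A Hardy inequality\<close>

definition bsym :: "('n::finite \<Rightarrow> real) \<Rightarrow> real" where
  "bsym \<xi> = (\<Sum>j\<in>UNIV. (sin (\<xi> j))\<^sup>2)"

text \<open>The squared first order Sobolev norm of \<open>trig F f\<close> on the torus, by
  \<open>wnorm_eq\<close>; on the lattice, the weight that matches inverse-square decay.\<close>

definition wnorm :: "(int ^ 'n) set \<Rightarrow> (int ^ 'n \<Rightarrow> complex) \<Rightarrow> real" where
  "wnorm F f = (\<Sum>x\<in>F. (1 + (lat_norm x)\<^sup>2) * (cmod (f x))\<^sup>2)"

lemma bsym_nonneg [simp]: "bsym \<xi> \<ge> 0"
  unfolding bsym_def by (intro sum_nonneg) auto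

lemma bounded_meas_sin: "bounded_meas (\<lambda>\<xi>. sin (\<xi> j))"
  and bounded_meas_cos: "bounded_meas (\<lambda>\<xi>. cos (\<xi> j))"
  by (intro bounded_meas_component[where B = 1]; auto intro!: continuous_intros)+

lemma bounded_meas_bsym: "bounded_meas bsym"
proof -
  have "bounded_meas (\<lambda>\<xi>. bsym \<xi>)"
    unfolding bsym_def by (intro bounded_meas_intros bounded_meas_sin)
  then show ?thesis by simp
qed

lemma lat_norm_sq: "(lat_norm x)\<^sup>2 = (\<Sum>j\<in>UNIV. (real_of_int (x $ j))\<^sup>2)"
  unfolding lat_norm_def by (simp add: sum_nonneg)

lemma wnorm_nonneg: "wnorm F f \<ge> 0"
  unfolding wnorm_def by (intro sum_nonneg) auto

lemma wnorm_eq: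
  assumes F: "finite F"
  shows "wnorm F f = (\<integral>\<xi>. (cmod (trig F f \<xi>))\<^sup>2 \<partial>torus) + (\<Sum>j\<in>UNIV. \<integral>\<xi>. (cmod (dtrig j F f \<xi>))\<^sup>2 \<partial>torus)"
proof -
  have "wnorm F f = (\<Sum>x\<in>F. (cmod (f x))\<^sup>2 + (\<Sum>j\<in>UNIV. (cmod (\<i> * of_int (x $ j) * f x))\<^sup>2))"
    unfolding wnorm_def lat_norm_sq
    by (intro sum.cong refl) (simp add: norm_mult power_mult_distrib algebra_simps sum_distrib_left)
  also have "\<dots> = (\<Sum>x\<in>F. (cmod (f x))\<^sup>2) + (\<Sum>j\<in>UNIV. \<Sum>x\<in>F. (cmod (\<i> * of_int (x $ j) * f x))\<^sup>2)"
    unfolding sum.distrib by (subst sum.swap) simp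
  finally show ?thesis by (simp only: trig_parseval_norm[OF F])
qed

text \<open>AM-GM for the term of an integration by parts in which the derivative falls on
  \<open>trig\<close>; \<open>\<kappa>\<close> distributes the cost between the two factors.\<close>

lemma abs_cross_term_le:
  fixes P p :: complex and s D \<kappa> :: real
  assumes "\<kappa> > 0"
  shows "\<bar>s\<bar> * \<bar>2 * Re (P * cnj p)\<bar> / D \<le> \<kappa> * (s\<^sup>2 * (cmod p)\<^sup>2 / D\<^sup>2) + (cmod P)\<^sup>2 / \<kappa>"
proof (cases "D > 0")
  case True
  have "\<bar>Re (P * cnj p)\<bar> \<le> cmod P * cmod p"
    using abs_Re_le_cmod[of "P * cnj p"] by (simp add: norm_mult)
  then have "\<bar>s\<bar> * \<bar>2 * Re (P * cnj p)\<bar> / D \<le> \<bar>s\<bar> * (2 * (cmod P * cmod p)) / D"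
    using True by (intro divide_right_mono mult_left_mono) auto
  also have "\<dots> = 2 * (\<bar>s\<bar> * cmod p / D) * cmod P" by simp
  also have "\<dots> \<le> \<kappa> * (\<bar>s\<bar> * cmod p / D)\<^sup>2 + (cmod P)\<^sup>2 / \<kappa>"
  proof -
    define u where "u = \<bar>s\<bar> * cmod p / D"
    have "0 \<le> (\<kappa> * u - cmod P)\<^sup>2" by simp
    then have "2 * u * cmod P * \<kappa> \<le> \<kappa>\<^sup>2 * u\<^sup>2 + (cmod P)\<^sup>2" by (simp add: power2_eq_square algebra_simps)
    then have "2 * u * cmod P \<le> (\<kappa>\<^sup>2 * u\<^sup>2 + (cmod P)\<^sup>2) / \<kappa>" using assms by (simp add: field_simps)
    also have "\<dots> = \<kappa> * u\<^sup>2 + (cmod P)\<^sup>2 / \<kappa>" using assms by (simp add: add_divide_distrib power2_eq_square)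
    finally show ?thesis unfolding u_def .
  qed
  finally show ?thesis by (simp add: power_mult_distrib power_divide)
next
  case False
  then have "\<bar>s\<bar> * \<bar>2 * Re (P * cnj p)\<bar> / D \<le> 0"
    by (intro divide_nonneg_nonpos) auto
  also have "0 \<le> \<kappa> * (s\<^sup>2 * (cmod p)\<^sup>2 / D\<^sup>2) + (cmod P)\<^sup>2 / \<kappa>"
    using assms by (intro add_nonneg_nonneg mult_nonneg_nonneg divide_nonneg_nonneg) auto
  finally show ?thesis .
qed

text \<open>The field \<open>sin (\<xi> j) * cos (\<xi> j)\<close> is half the gradient of
  \<open>bsym\<close>. Divided by \<open>bsym + \<eta>\<close> it has divergence about
  \<open>(d - 2) / bsym\<close> near the zeros of \<open>bsym\<close>; the cross term takes another
  \<open>1/2\<close>, and what is left, \<open>d - 5/2\<close>, is at least \<open>1/2\<close> in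
  dimension three and above. The corrections away from the zeros are bounded multiples of
  \<open>?W\<close>, hence the zeroth order part of \<open>wnorm\<close>.\<close>

lemma torus_hardy:
  fixes f :: "int ^ 'n \<Rightarrow> complex"
  assumes F: "finite F" and d: "CARD('n) \<ge> 3" and \<eta>: "\<eta> > 0"
  shows "(\<integral>\<xi>. (cmod (trig F f \<xi>))\<^sup>2 / (bsym \<xi> + \<eta>) \<partial>torus) \<le> 4 * wnorm F f"
proof -
  let ?W = "\<lambda>\<xi>. (cmod (trig F f \<xi>))\<^sup>2"
  let ?D = "\<lambda>\<xi>::'n \<Rightarrow> real. bsym \<xi> + \<eta>"
  have Dpos: "?D \<xi> > 0" for \<xi> using \<eta> bsym_nonneg[of \<xi>] by linarith
  define J where "J j \<xi> = ((cos (\<xi> j))\<^sup>2 - (sin (\<xi> j))\<^sup>2) * ?W \<xi> / ?D \<xi>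
      + sin (\<xi> j) * cos (\<xi> j) * (2 * Re (dtrig j F f \<xi> * cnj (trig F f \<xi>))) / ?D \<xi>
      - sin (\<xi> j) * cos (\<xi> j) * ?W \<xi> * (2 * sin (\<xi> j) * cos (\<xi> j)) / (?D \<xi>)\<^sup>2" for j \<xi>
  note I = bounded_meas_intros bounded_meas_sin bounded_meas_cos bounded_meas_trig bounded_meas_bsym
  have "(\<integral>\<xi>. (\<Sum>j\<in>UNIV. of_real (((cos (\<xi> j))\<^sup>2 - (sin (\<xi> j))\<^sup>2) * ?W \<xi>) / of_real (?D \<xi>)
      + of_real ((sin (\<xi> j) * cos (\<xi> j)) * (2 * Re (dtrig j F f \<xi> * cnj (trig F f \<xi>)))) / of_real (?D \<xi>)
      - of_real ((sin (\<xi> j) * cos (\<xi> j)) * ?W \<xi>) * of_real (2 * sin (\<xi> j) * cos (\<xi> j)) / (of_real (?D \<xi>))\<^sup>2) \<partial>torus) = (0::complex)"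
  proof (rule torus_ibp[where p = "\<lambda>s. complex_of_real ((sin s)\<^sup>2)" and p' = "\<lambda>s. complex_of_real (2 * sin s * cos s)"
        and a = "\<lambda>s. sin s * cos s" and a' = "\<lambda>s. (cos s)\<^sup>2 - (sin s)\<^sup>2" and \<delta> = \<eta> and c = "of_real \<eta>"])
    fix s
    have "((\<lambda>s. (sin s)\<^sup>2) has_real_derivative 2 * sin s * cos s) (at s)"
      by (auto intro!: derivative_eq_intros)
    then show "((\<lambda>s. complex_of_real ((sin s)\<^sup>2)) has_vector_derivative complex_of_real (2 * sin s * cos s)) (at s)"
      by (intro has_vector_derivative_of_real) (simp add: has_real_derivative_iff_has_vector_derivative)
    show "((\<lambda>s. sin s * cos s) has_real_derivative (cos s)\<^sup>2 - (sin s)\<^sup>2) (at s)"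
      by (auto intro!: derivative_eq_intros simp: power2_eq_square)
  next
    show "complex_of_real ((sin (3 * pi / 2))\<^sup>2) = complex_of_real ((sin (- (pi / 2)))\<^sup>2)"
      using sin_3over2_pi by simp
    show "sin (3 * pi / 2) * cos (3 * pi / 2) = sin (- (pi / 2)) * cos (- (pi / 2))"
      using cos_3over2_pi by simp
  next
    fix \<xi> :: "'n \<Rightarrow> real"
    show "complex_of_real (?D \<xi>) = of_real \<eta> + (\<Sum>j\<in>UNIV. complex_of_real ((sin (\<xi> j))\<^sup>2))"
      by (simp add: bsym_def)
    show "\<eta> \<le> cmod (complex_of_real (?D \<xi>))"
      unfolding norm_of_real using bsym_nonneg[of \<xi>] \<eta> by linarith
  qed (intro I \<eta>)+
  also have "(\<lambda>\<xi>. (\<Sum>j\<in>UNIV. of_real (((cos (\<xi> j))\<^sup>2 - (sin (\<xi> j))\<^sup>2) * ?W \<xi>) / of_real (?D \<xi>)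
      + of_real ((sin (\<xi> j) * cos (\<xi> j)) * (2 * Re (dtrig j F f \<xi> * cnj (trig F f \<xi>)))) / of_real (?D \<xi>)
      - of_real ((sin (\<xi> j) * cos (\<xi> j)) * ?W \<xi>) * of_real (2 * sin (\<xi> j) * cos (\<xi> j)) / (of_real (?D \<xi>))\<^sup>2))
      = (\<lambda>\<xi>. complex_of_real (\<Sum>j\<in>UNIV. J j \<xi>))"
    unfolding J_def by (simp only: of_real_sum of_real_add of_real_diff of_real_mult of_real_divide of_real_power)
  finally have "complex_of_real (\<integral>\<xi>. (\<Sum>j\<in>UNIV. J j \<xi>) \<partial>torus) = 0"
    by (simp only: integral_complex_of_real)
  then have J0: "(\<integral>\<xi>. (\<Sum>j\<in>UNIV. J j \<xi>) \<partial>torus) = 0" by (simp only: of_real_eq_0_iff)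
  have bmi: "bounded_meas (\<lambda>\<xi>. f \<xi> / ?D \<xi>)" if "bounded_meas f" for f :: "('n \<Rightarrow> real) \<Rightarrow> real"
    by (rule bounded_meas_divide[OF that _ _ \<eta>]) (auto intro!: I simp: \<eta> less_imp_le add_nonneg_nonneg)
  have bmi2: "bounded_meas (\<lambda>\<xi>. f \<xi> / (?D \<xi>)\<^sup>2)" if "bounded_meas f" for f :: "('n \<Rightarrow> real) \<Rightarrow> real"
    using bmi[OF bmi[OF that]] by (simp add: power2_eq_square)
  have lower: "(1/2) * (?W \<xi> / ?D \<xi>) - 2 * ?W \<xi> - 2 * (\<Sum>j\<in>UNIV. (cmod (dtrig j F f \<xi>))\<^sup>2) \<le> (\<Sum>j\<in>UNIV. J j \<xi>)" for \<xi>
  proof -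
    \<comment> \<open>Of the coefficient \<open>5/2\<close>, the derivative of the denominator
      causes \<open>2\<close> and the cross term, split with \<open>\<kappa> = 1/2\<close>, causes
      \<open>1/2\<close>.\<close>
    have Jj: "(1 - 2 * (sin (\<xi> j))\<^sup>2) * (?W \<xi> / ?D \<xi>) - 2 * (cmod (dtrig j F f \<xi>))\<^sup>2 - (5/2) * ((sin (\<xi> j))\<^sup>2 * (?W \<xi> / (?D \<xi>)\<^sup>2)) \<le> J j \<xi>" for j
    proof -
      let ?R = "2 * Re (dtrig j F f \<xi> * cnj (trig F f \<xi>))"
      have lin: "- X \<le> 1/2 * A + B / (1/2) \<Longrightarrow> - (1/2 * A + 2 * B) \<le> X" for X A B :: real by simp
      have 1: "((cos (\<xi> j))\<^sup>2 - (sin (\<xi> j))\<^sup>2) * ?W \<xi> / ?D \<xi> = (1 - 2 * (sin (\<xi> j))\<^sup>2) * (?W \<xi> / ?D \<xi>)"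
        by (simp add: cos_squared_eq)
      have "\<bar>sin (\<xi> j) * cos (\<xi> j) * ?R / ?D \<xi>\<bar> = \<bar>cos (\<xi> j)\<bar> * (\<bar>sin (\<xi> j)\<bar> * \<bar>?R\<bar> / ?D \<xi>)"
        using Dpos[of \<xi>] by (simp add: abs_mult)
      also have "\<dots> \<le> 1 * (\<bar>sin (\<xi> j)\<bar> * \<bar>?R\<bar> / ?D \<xi>)"
        using Dpos[of \<xi>] by (intro mult_right_mono) auto
      also have "\<dots> \<le> (1/2) * ((sin (\<xi> j))\<^sup>2 * ?W \<xi> / (?D \<xi>)\<^sup>2) + (cmod (dtrig j F f \<xi>))\<^sup>2 / (1/2)"
        unfolding mult_1 by (rule abs_cross_term_le) simp
      finally have "- (sin (\<xi> j) * cos (\<xi> j) * ?R / ?D \<xi>)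
          \<le> (1/2) * ((sin (\<xi> j))\<^sup>2 * ?W \<xi> / (?D \<xi>)\<^sup>2) + (cmod (dtrig j F f \<xi>))\<^sup>2 / (1/2)"
        by (rule abs_le_D2)
      then have 2: "- ((1/2) * ((sin (\<xi> j))\<^sup>2 * (?W \<xi> / (?D \<xi>)\<^sup>2)) + 2 * (cmod (dtrig j F f \<xi>))\<^sup>2) \<le> sin (\<xi> j) * cos (\<xi> j) * ?R / ?D \<xi>"
        unfolding times_divide_eq_right[of "(sin (\<xi> j))\<^sup>2"] by (rule lin)
      have "sin (\<xi> j) * cos (\<xi> j) * ?W \<xi> * (2 * sin (\<xi> j) * cos (\<xi> j)) / (?D \<xi>)\<^sup>2
          = (cos (\<xi> j))\<^sup>2 * (2 * ((sin (\<xi> j))\<^sup>2 * (?W \<xi> / (?D \<xi>)\<^sup>2)))"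
        by (simp add: power2_eq_square)
      also have "\<dots> \<le> 1 * (2 * ((sin (\<xi> j))\<^sup>2 * (?W \<xi> / (?D \<xi>)\<^sup>2)))"
        by (intro mult_right_mono) (auto simp: cos_squared_eq)
      finally have 3: "sin (\<xi> j) * cos (\<xi> j) * ?W \<xi> * (2 * sin (\<xi> j) * cos (\<xi> j)) / (?D \<xi>)\<^sup>2
           \<le> 2 * ((sin (\<xi> j))\<^sup>2 * (?W \<xi> / (?D \<xi>)\<^sup>2))" by simp
      show ?thesis unfolding J_def 1 using 2 3 by linarith
    qed
    have "(\<Sum>j\<in>UNIV. (1 - 2 * (sin (\<xi> j))\<^sup>2) * (?W \<xi> / ?D \<xi>) - 2 * (cmod (dtrig j F f \<xi>))\<^sup>2 - (5/2) * ((sin (\<xi> j))\<^sup>2 * (?W \<xi> / (?D \<xi>)\<^sup>2)))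
       = (real CARD('n) - 2 * bsym \<xi>) * (?W \<xi> / ?D \<xi>) - 2 * (\<Sum>j\<in>UNIV. (cmod (dtrig j F f \<xi>))\<^sup>2) - (5/2) * (bsym \<xi> * (?W \<xi> / (?D \<xi>)\<^sup>2))"
      unfolding sum_subtractf sum_distrib_right[symmetric] sum_distrib_left[symmetric] bsym_def by simp
    moreover have "(\<Sum>j\<in>UNIV. (1 - 2 * (sin (\<xi> j))\<^sup>2) * (?W \<xi> / ?D \<xi>) - 2 * (cmod (dtrig j F f \<xi>))\<^sup>2 - (5/2) * ((sin (\<xi> j))\<^sup>2 * (?W \<xi> / (?D \<xi>)\<^sup>2)))
       \<le> (\<Sum>j\<in>UNIV. J j \<xi>)" by (intro sum_mono Jj)
    moreover have "3 * (?W \<xi> / ?D \<xi>) \<le> real CARD('n) * (?W \<xi> / ?D \<xi>)"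
      using d Dpos[of \<xi>] by (intro mult_right_mono divide_nonneg_pos) auto
    moreover have bW: "bsym \<xi> * (?W \<xi> / ?D \<xi>) \<le> ?W \<xi>"
      using Dpos[of \<xi>] \<eta> by (simp add: field_simps)
    moreover have "bsym \<xi> * (?W \<xi> / (?D \<xi>)\<^sup>2) \<le> ?W \<xi> / ?D \<xi>"
      using divide_right_mono[OF bW, of "?D \<xi>"] Dpos[of \<xi>] by (simp add: power2_eq_square)
    ultimately show ?thesis by (simp only: left_diff_distrib mult.assoc)
  qed
  have "(\<integral>\<xi>. (1/2) * (?W \<xi> / ?D \<xi>) - 2 * ?W \<xi> - 2 * (\<Sum>j\<in>UNIV. (cmod (dtrig j F f \<xi>))\<^sup>2) \<partial>torus) \<le> 0"
    unfolding J0[symmetric]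
    by (intro integral_mono lower bounded_meas_integrable; (unfold J_def)?; intro I bmi bmi2)
  also have "(\<integral>\<xi>. (1/2) * (?W \<xi> / ?D \<xi>) - 2 * ?W \<xi> - 2 * (\<Sum>j\<in>UNIV. (cmod (dtrig j F f \<xi>))\<^sup>2) \<partial>torus)
     = (1/2) * (\<integral>\<xi>. ?W \<xi> / ?D \<xi> \<partial>torus) - 2 * (\<integral>\<xi>. ?W \<xi> \<partial>torus) - 2 * (\<Sum>j\<in>UNIV. \<integral>\<xi>. (cmod (dtrig j F f \<xi>))\<^sup>2 \<partial>torus)"
    by (subst Bochner_Integration.integral_diff Bochner_Integration.integral_sum Bochner_Integration.integral_mult_right_zero;
       (intro bounded_meas_integrable I bmi)?)+ simp
  finally have "(1/2) * (\<integral>\<xi>. ?W \<xi> / ?D \<xi> \<partial>torus) - 2 * (\<integral>\<xi>. ?W \<xi> \<partial>torus)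
     - 2 * (\<Sum>j\<in>UNIV. \<integral>\<xi>. (cmod (dtrig j F f \<xi>))\<^sup>2 \<partial>torus) \<le> 0" .
  moreover have "A \<le> 4 * (B + C)" if "1/2 * A - 2 * B - 2 * C \<le> 0" for A B C :: real
    using that by simp
  ultimately show ?thesis unfolding wnorm_eq[OF F] by blast
qed

subsection \<open>Positive commutator estimate\<close>

context
  fixes z :: complex and F :: "(int ^ 'n) set" and f :: "int ^ 'n \<Rightarrow> complex"
  assumes z: "Im z > 0" and F: "finite F" and d3: "CARD('n) \<ge> 3"
begin

text \<open>The regularisation strength is written as \<open>s\<^sup>2\<close>: the derivative in
  the strength may be as large as its inverse square root, and the factor \<open>2 * s\<close> of
  the chain rule makes this bounded. The added term has the sign of \<open>- Im z\<close>, so it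
  only pushes the denominator further from zero.\<close>

definition mden :: "real \<Rightarrow> ('n \<Rightarrow> real) \<Rightarrow> complex" where
  "mden s \<xi> = of_real (hsym \<xi>) - z - \<i> * of_real (s\<^sup>2 * bsym \<xi>)"

definition mform :: "real \<Rightarrow> complex" where
  "mform s = (\<integral>\<xi>. of_real ((cmod (trig F f \<xi>))\<^sup>2) / mden s \<xi> \<partial>torus)"

definition mquad :: "real \<Rightarrow> real" where
  "mquad s = (\<integral>\<xi>. bsym \<xi> * ((cmod (trig F f \<xi>))\<^sup>2 / (cmod (mden s \<xi>))\<^sup>2) \<partial>torus)"

lemma Im_mden: "Im (mden s \<xi>) = - (Im z + s\<^sup>2 * bsym \<xi>)"
  by (simp add: mden_def)

lemma mden_ge: "Im z \<le> cmod (mden s \<xi>)"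
proof -
  have "Im z \<le> Im z + s\<^sup>2 * bsym \<xi>" by simp
  also have "\<dots> \<le> \<bar>Im (mden s \<xi>)\<bar>" unfolding Im_mden by linarith
  also have "\<dots> \<le> cmod (mden s \<xi>)" by (rule abs_Im_le_cmod)
  finally show ?thesis .
qed

lemma mden_pos: "cmod (mden s \<xi>) > 0"
  using mden_ge[of s \<xi>] z by linarith

lemma bounded_meas_mden: "bounded_meas (mden s)"
proof -
  have "bounded_meas (\<lambda>\<xi>. mden s \<xi>)"
    unfolding mden_def by (intro bounded_meas_intros bounded_meas_hsym bounded_meas_bsym)
  then show ?thesis by simp
qed

lemma bounded_meas_div_mden:
  "bounded_meas g \<Longrightarrow> bounded_meas (\<lambda>\<xi>. g \<xi> / mden s \<xi>)"
  "bounded_meas g \<Longrightarrow> bounded_meas (\<lambda>\<xi>. g \<xi> / (mden s \<xi>)\<^sup>2)"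
proof -
  have *: "bounded_meas (\<lambda>\<xi>. g \<xi> / mden s \<xi>)" if "bounded_meas g" for g
    by (rule bounded_meas_divide[OF that bounded_meas_mden mden_ge z])
  show "bounded_meas g \<Longrightarrow> bounded_meas (\<lambda>\<xi>. g \<xi> / mden s \<xi>)" by (rule *)
  show "bounded_meas (\<lambda>\<xi>. g \<xi> / (mden s \<xi>)\<^sup>2)" if "bounded_meas g"
    using *[OF *[OF that]] by (simp add: power2_eq_square)
qed

lemma bounded_meas_div_norm_mden:
  "bounded_meas g \<Longrightarrow> bounded_meas (\<lambda>\<xi>. g \<xi> / cmod (mden s \<xi>))"
  "bounded_meas g \<Longrightarrow> bounded_meas (\<lambda>\<xi>. g \<xi> / (cmod (mden s \<xi>))\<^sup>2)"
proof -
  have *: "bounded_meas (\<lambda>\<xi>. g \<xi> / cmod (mden s \<xi>))" if "bounded_meas g" for g :: "('n \<Rightarrow> real) \<Rightarrow> real"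
    by (rule bounded_meas_divide[OF that bounded_meas_norm[OF bounded_meas_mden] _ z]) (simp add: mden_ge)
  show "bounded_meas g \<Longrightarrow> bounded_meas (\<lambda>\<xi>. g \<xi> / cmod (mden s \<xi>))" by (rule *)
  show "bounded_meas (\<lambda>\<xi>. g \<xi> / (cmod (mden s \<xi>))\<^sup>2)" if "bounded_meas g"
    using *[OF *[OF that]] by (simp add: power2_eq_square)
qed

lemmas mI = bounded_meas_intros bounded_meas_div_mden bounded_meas_div_norm_mden bounded_meas_trig
  bounded_meas_bsym bounded_meas_hsym bounded_meas_sin bounded_meas_cos

lemma mquad_nonneg: "mquad s \<ge> 0"
  unfolding mquad_def by (intro Bochner_Integration.integral_nonneg mult_nonneg_nonneg) auto

text \<open>The imaginary part of \<open>1 / mden s \<xi>\<close> is \<open>(Im z + s\<^sup>2 * bsym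
  \<xi>) / (cmod (mden s \<xi>))\<^sup>2\<close>. So the form controls its own weighted square
  function, at the price of the factor \<open>s\<^sup>2\<close>.\<close>

lemma mquad_le_mform: "s\<^sup>2 * mquad s \<le> cmod (mform s)"
proof -
  have "s\<^sup>2 * mquad s = (\<integral>\<xi>. s\<^sup>2 * (bsym \<xi> * ((cmod (trig F f \<xi>))\<^sup>2 / (cmod (mden s \<xi>))\<^sup>2)) \<partial>torus)"
    unfolding mquad_def by (rule Bochner_Integration.integral_mult_right_zero[symmetric])
  also have "\<dots> \<le> (\<integral>\<xi>. Im (of_real ((cmod (trig F f \<xi>))\<^sup>2) / mden s \<xi>) \<partial>torus)"
  proof (rule integral_mono)
    fix \<xi> :: "'n \<Rightarrow> real"
    have "Im (of_real ((cmod (trig F f \<xi>))\<^sup>2) / mden s \<xi>) = (cmod (trig F f \<xi>))\<^sup>2 * (Im z + s\<^sup>2 * bsym \<xi>) / (cmod (mden s \<xi>))\<^sup>2"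
    proof -
      have "Im (of_real w / D) = w * (- Im D) / (cmod D)\<^sup>2" for w and D :: complex
        by (simp add: Im_divide cmod_power2)
      then show ?thesis by (simp only: Im_mden minus_minus)
    qed
    moreover have "s\<^sup>2 * bsym \<xi> * ((cmod (trig F f \<xi>))\<^sup>2 / (cmod (mden s \<xi>))\<^sup>2) \<le> (Im z + s\<^sup>2 * bsym \<xi>) * ((cmod (trig F f \<xi>))\<^sup>2 / (cmod (mden s \<xi>))\<^sup>2)"
      using z by (intro mult_right_mono) auto
    ultimately show "s\<^sup>2 * (bsym \<xi> * ((cmod (trig F f \<xi>))\<^sup>2 / (cmod (mden s \<xi>))\<^sup>2)) \<le> Im (of_real ((cmod (trig F f \<xi>))\<^sup>2) / mden s \<xi>)"
      by (simp add: ac_simps)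
  next
    show "integrable torus (\<lambda>\<xi>. Im (complex_of_real ((cmod (trig F f \<xi>))\<^sup>2) / mden s \<xi>))"
      by (intro integrable_Im bounded_meas_integrable mI)
  qed (intro bounded_meas_integrable mI)
  also have "\<dots> = Im (mform s)"
    unfolding mform_def by (intro integral_Im bounded_meas_integrable mI)
  also have "\<dots> \<le> cmod (mform s)" using abs_Im_le_cmod[of "mform s"] by linarith
  finally show ?thesis .
qed

text \<open>With \<open>B = bsym \<xi> + \<eta>\<close> and \<open>D\<close> the modulus of the
  denominator, AM-GM bounds \<open>1 / D\<close> by multiples of \<open>B / D\<^sup>2\<close> and
  \<open>1 / B\<close>; the second goes to the Hardy inequality. Finally \<open>\<eta>\<close> tends
  to zero with everything else fixed, \<open>K\<close> included.\<close>

lemma mform_abs_le: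
  assumes k: "\<kappa> > 0"
  shows "(\<integral>\<xi>. (cmod (trig F f \<xi>))\<^sup>2 / cmod (mden s \<xi>) \<partial>torus) \<le> \<kappa> / 2 * mquad s + 2 / \<kappa> * wnorm F f"
proof -
  let ?W = "\<lambda>\<xi>. (cmod (trig F f \<xi>))\<^sup>2"
  let ?L = "\<integral>\<xi>. ?W \<xi> / cmod (mden s \<xi>) \<partial>torus"
  define K where "K = \<kappa> / 2 * (\<integral>\<xi>. ?W \<xi> / (cmod (mden s \<xi>))\<^sup>2 \<partial>torus)"
  have K: "K \<ge> 0" unfolding K_def using k by (intro mult_nonneg_nonneg Bochner_Integration.integral_nonneg) auto
  have eta: "?L \<le> (\<kappa> / 2 * mquad s + 2 / \<kappa> * wnorm F f) + \<eta> * K" if \<eta>: "\<eta> > 0" for \<eta>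
  proof -
    let ?B = "\<lambda>\<xi>::'n \<Rightarrow> real. bsym \<xi> + \<eta>"
    have Bpos: "?B \<xi> > 0" for \<xi> using \<eta> bsym_nonneg[of \<xi>] by linarith
    have bmi: "bounded_meas (\<lambda>\<xi>. g \<xi> / ?B \<xi>)" if "bounded_meas g" for g :: "('n \<Rightarrow> real) \<Rightarrow> real"
      by (rule bounded_meas_divide[OF that _ _ \<eta>]) (auto intro!: mI simp: \<eta> less_imp_le add_nonneg_nonneg)
    have "?L \<le> (\<integral>\<xi>. (\<kappa> / 2 * (bsym \<xi> * (?W \<xi> / (cmod (mden s \<xi>))\<^sup>2)) + \<eta> * (\<kappa> / 2 * (?W \<xi> / (cmod (mden s \<xi>))\<^sup>2)))
         + 1 / (2 * \<kappa>) * (?W \<xi> / ?B \<xi>) \<partial>torus)"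
    proof (rule integral_mono)
      fix \<xi> :: "'n \<Rightarrow> real"
      have amgm: "w / D \<le> (\<kappa> / 2 * (b * (w / D\<^sup>2)) + \<eta> * (\<kappa> / 2 * (w / D\<^sup>2))) + 1 / (2 * \<kappa>) * (w / (b + \<eta>))"
        if "w \<ge> 0" "D > 0" "b + \<eta> > 0" for w D b :: real
      proof -
        define B where "B = b + \<eta>"
        have "0 \<le> (\<kappa> * B - D)\<^sup>2" by simp
        then have "2 * (\<kappa> * B * D) \<le> \<kappa>\<^sup>2 * B\<^sup>2 + D\<^sup>2" by (simp add: power2_eq_square algebra_simps)
        then have "2 * (\<kappa> * B * D) / (2 * \<kappa> * B * D\<^sup>2) \<le> (\<kappa>\<^sup>2 * B\<^sup>2 + D\<^sup>2) / (2 * \<kappa> * B * D\<^sup>2)"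
          using that k by (intro divide_right_mono) (auto simp: B_def)
        then have "1 / D \<le> \<kappa> / 2 * B / D\<^sup>2 + 1 / (2 * \<kappa> * B)"
          using that k by (simp add: B_def[symmetric] power2_eq_square add_divide_distrib)
        then have "w * (1 / D) \<le> w * (\<kappa> / 2 * B / D\<^sup>2 + 1 / (2 * \<kappa> * B))"
          using that by (intro mult_left_mono)
        then show ?thesis unfolding B_def by (simp add: algebra_simps add_divide_distrib)
      qed
      show "?W \<xi> / cmod (mden s \<xi>) \<le> (\<kappa> / 2 * (bsym \<xi> * (?W \<xi> / (cmod (mden s \<xi>))\<^sup>2)) + \<eta> * (\<kappa> / 2 * (?W \<xi> / (cmod (mden s \<xi>))\<^sup>2)))
         + 1 / (2 * \<kappa>) * (?W \<xi> / ?B \<xi>)"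
        by (rule amgm) (use mden_pos Bpos in auto)
    qed (intro bounded_meas_integrable mI bmi)+
    also have "\<dots> = \<kappa> / 2 * mquad s + \<eta> * K + 1 / (2 * \<kappa>) * (\<integral>\<xi>. ?W \<xi> / ?B \<xi> \<partial>torus)"
      unfolding mquad_def K_def
      by (subst Bochner_Integration.integral_add Bochner_Integration.integral_mult_right_zero;
        (intro bounded_meas_integrable mI bmi)?)+ (rule refl)
    also have "\<dots> \<le> \<kappa> / 2 * mquad s + \<eta> * K + 1 / (2 * \<kappa>) * (4 * wnorm F f)"
      using k by (intro add_left_mono mult_left_mono torus_hardy F d3 \<eta>) auto
    also have "1 / (2 * \<kappa>) * (4 * wnorm F f) = 2 / \<kappa> * wnorm F f" by simp
    finally show ?thesis by linarith
  qed
  show ?thesis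
  proof (rule field_le_epsilon)
    fix e :: real assume e: "e > 0"
    have "?L \<le> (\<kappa> / 2 * mquad s + 2 / \<kappa> * wnorm F f) + e / (K + 1) * K"
      using e K by (intro eta) auto
    moreover have "e / (K + 1) * K \<le> e" using e K by (simp add: field_simps)
    ultimately show "?L \<le> (\<kappa> / 2 * mquad s + 2 / \<kappa> * wnorm F f) + e" by linarith
  qed
qed

text \<open>Up to the factor \<open>\<i>\<close>, the derivative of \<open>mform\<close> in the
  variable \<open>s\<^sup>2\<close>.\<close>

definition mder :: "real \<Rightarrow> complex" where
  "mder s = (\<integral>\<xi>. of_real (bsym \<xi> * (cmod (trig F f \<xi>))\<^sup>2) / (mden s \<xi>)\<^sup>2 \<partial>torus)"

text \<open>The weight \<open>bsym\<close> is what permits integration by parts: the field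
  \<open>sin (\<xi> j)\<close> is half the gradient of \<open>hsym\<close>, so
  \<open>2 * bsym / mden\<^sup>2\<close> is, up to sign and the regulariser, the derivative of
  \<open>1 / mden\<close> along it. What remains has either a single power of \<open>mden\<close> or
  a factor \<open>s\<^sup>2\<close>.\<close>

lemma mder_le:
  assumes k: "\<kappa> > 0"
  shows "cmod (mder s) \<le> s\<^sup>2 * mquad s + \<kappa> * ((real CARD('n) / 4 + 1 / 2) * mquad s)
    + (real CARD('n) + 1 / 2) * wnorm F f / \<kappa>"
proof -
  let ?W = "\<lambda>\<xi>. (cmod (trig F f \<xi>))\<^sup>2"
  let ?R = "\<lambda>j \<xi>. 2 * Re (dtrig j F f \<xi> * cnj (trig F f \<xi>))"
  \<comment> \<open>\<open>?T1\<close> is the divergence of the field, \<open>?T2\<close> has the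
    derivative on \<open>trig\<close>, and \<open>?T3\<close> comes from differentiating the
    regulariser.\<close>
  let ?T1 = "\<lambda>\<xi>. \<Sum>j\<in>UNIV. of_real (cos (\<xi> j) * ?W \<xi>) / mden s \<xi>"
  let ?T2 = "\<lambda>\<xi>. \<Sum>j\<in>UNIV. of_real (sin (\<xi> j) * ?R j \<xi>) / mden s \<xi>"
  let ?T3 = "\<lambda>\<xi>. \<Sum>j\<in>UNIV. of_real (sin (\<xi> j) * ?W \<xi>) * (\<i> * of_real (2 * s\<^sup>2 * sin (\<xi> j) * cos (\<xi> j))) / (mden s \<xi>)\<^sup>2"
  have ibp: "(\<integral>\<xi>. (\<Sum>j\<in>UNIV. of_real (cos (\<xi> j) * ?W \<xi>) / mden s \<xi> + of_real (sin (\<xi> j) * ?R j \<xi>) / mden s \<xi>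
      - of_real (sin (\<xi> j) * ?W \<xi>) * (of_real (2 * sin (\<xi> j)) - \<i> * of_real (2 * s\<^sup>2 * sin (\<xi> j) * cos (\<xi> j))) / (mden s \<xi>)\<^sup>2) \<partial>torus) = 0"
  proof (rule torus_ibp[where p = "\<lambda>t. of_real (2 - 2 * cos t) - \<i> * of_real (s\<^sup>2 * (sin t)\<^sup>2)"
        and a = sin and \<delta> = "Im z" and c = "- z"])
    fix t
    have "((\<lambda>t. 2 - 2 * cos t) has_real_derivative 2 * sin t) (at t)"
         "((\<lambda>t. s\<^sup>2 * (sin t)\<^sup>2) has_real_derivative 2 * s\<^sup>2 * sin t * cos t) (at t)"
      by (auto intro!: derivative_eq_intros)
    then show "((\<lambda>t. of_real (2 - 2 * cos t) - \<i> * of_real (s\<^sup>2 * (sin t)\<^sup>2)) has_vector_derivative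
        of_real (2 * sin t) - \<i> * of_real (2 * s\<^sup>2 * sin t * cos t)) (at t)"
      by (intro has_vector_derivative_diff has_vector_derivative_mult_right has_vector_derivative_of_real)
        (simp_all add: has_real_derivative_iff_has_vector_derivative)
    show "(sin has_real_derivative cos t) (at t)" by (rule DERIV_sin)
  next
    show "sin (3 * pi / 2) = sin (- (pi / 2))" using sin_3over2_pi by simp
    then show "complex_of_real (2 - 2 * cos (3 * pi / 2)) - \<i> * of_real (s\<^sup>2 * (sin (3 * pi / 2))\<^sup>2) =
        of_real (2 - 2 * cos (- (pi / 2))) - \<i> * of_real (s\<^sup>2 * (sin (- (pi / 2)))\<^sup>2)"
      using cos_3over2_pi by simp
  next
    fix \<xi> :: "'n \<Rightarrow> real"
    show "mden s \<xi> = - z + (\<Sum>j\<in>UNIV. of_real (2 - 2 * cos (\<xi> j)) - \<i> * of_real (s\<^sup>2 * (sin (\<xi> j))\<^sup>2))"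
      unfolding mden_def hsym_def bsym_def
      by (simp add: sum_subtractf sum_distrib_left)
  qed (intro mI mden_ge z)+
  have bm1: "bounded_meas ?T1" "bounded_meas ?T2" "bounded_meas ?T3"
    by (intro mI)+
  have "(\<lambda>\<xi>. (\<Sum>j\<in>UNIV. of_real (cos (\<xi> j) * ?W \<xi>) / mden s \<xi> + of_real (sin (\<xi> j) * ?R j \<xi>) / mden s \<xi>
      - of_real (sin (\<xi> j) * ?W \<xi>) * (of_real (2 * sin (\<xi> j)) - \<i> * of_real (2 * s\<^sup>2 * sin (\<xi> j) * cos (\<xi> j))) / (mden s \<xi>)\<^sup>2))
      = (\<lambda>\<xi>. (?T1 \<xi> + ?T2 \<xi> + ?T3 \<xi>) - 2 * (of_real (bsym \<xi> * ?W \<xi>) / (mden s \<xi>)\<^sup>2))"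
  proof
    fix \<xi> :: "'n \<Rightarrow> real"
    have "(\<Sum>j\<in>UNIV. of_real (sin (\<xi> j) * ?W \<xi>) * of_real (2 * sin (\<xi> j)) / (mden s \<xi>)\<^sup>2)
       = 2 * (of_real (bsym \<xi> * ?W \<xi>) / (mden s \<xi>)\<^sup>2)"
      unfolding bsym_def
      by (simp add: sum_distrib_right sum_distrib_left sum_divide_distrib power2_eq_square ac_simps)
    then show "(\<Sum>j\<in>UNIV. of_real (cos (\<xi> j) * ?W \<xi>) / mden s \<xi> + of_real (sin (\<xi> j) * ?R j \<xi>) / mden s \<xi>
      - of_real (sin (\<xi> j) * ?W \<xi>) * (of_real (2 * sin (\<xi> j)) - \<i> * of_real (2 * s\<^sup>2 * sin (\<xi> j) * cos (\<xi> j))) / (mden s \<xi>)\<^sup>2)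
      = (?T1 \<xi> + ?T2 \<xi> + ?T3 \<xi>) - 2 * (of_real (bsym \<xi> * ?W \<xi>) / (mden s \<xi>)\<^sup>2)"
      by (simp only: right_diff_distrib diff_divide_distrib sum.distrib sum_subtractf diff_diff_eq2)
  qed
  note ibp' = ibp[unfolded this]
  have i1: "integrable torus (\<lambda>\<xi>. ?T1 \<xi> + ?T2 \<xi> + ?T3 \<xi>)"
    by (intro bounded_meas_integrable bounded_meas_add bm1)
  have i2: "integrable torus (\<lambda>\<xi>. 2 * (of_real (bsym \<xi> * ?W \<xi>) / (mden s \<xi>)\<^sup>2))"
    by (intro bounded_meas_integrable mI)
  have "(\<integral>\<xi>. ?T1 \<xi> + ?T2 \<xi> + ?T3 \<xi> \<partial>torus) - 2 * mder s = 0"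
    using ibp' unfolding mder_def Bochner_Integration.integral_diff[OF i1 i2]
      Bochner_Integration.integral_mult_right_zero .
  then have "2 * mder s = (\<integral>\<xi>. ?T1 \<xi> + ?T2 \<xi> + ?T3 \<xi> \<partial>torus)" by simp
  then have "2 * cmod (mder s) = cmod (\<integral>\<xi>. ?T1 \<xi> + ?T2 \<xi> + ?T3 \<xi> \<partial>torus)"
    by (metis norm_mult norm_numeral)
  also have "\<dots> \<le> (\<integral>\<xi>. cmod (?T1 \<xi> + ?T2 \<xi> + ?T3 \<xi>) \<partial>torus)"
    by (rule integral_norm_bound)
  also have "\<dots> \<le> (\<integral>\<xi>. real CARD('n) * (?W \<xi> / cmod (mden s \<xi>))
      + (\<kappa> * (bsym \<xi> * (?W \<xi> / (cmod (mden s \<xi>))\<^sup>2)) + (\<Sum>j\<in>UNIV. (cmod (dtrig j F f \<xi>))\<^sup>2) / \<kappa>)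
      + 2 * s\<^sup>2 * (bsym \<xi> * (?W \<xi> / (cmod (mden s \<xi>))\<^sup>2)) \<partial>torus)"
  proof (rule integral_mono)
    fix \<xi> :: "'n \<Rightarrow> real"
    let ?D = "cmod (mden s \<xi>)"
    have D: "?D > 0" by (rule mden_pos)
    have "cmod (?T1 \<xi>) \<le> (\<Sum>j\<in>(UNIV::'n set). ?W \<xi> / ?D)"
    proof (rule sum_norm_le)
      fix j
      have "\<bar>cos (\<xi> j)\<bar> * (?W \<xi> / ?D) \<le> 1 * (?W \<xi> / ?D)"
        by (intro mult_right_mono) auto
      then show "cmod (of_real (cos (\<xi> j) * ?W \<xi>) / mden s \<xi>) \<le> ?W \<xi> / ?D"
        by (simp add: norm_divide norm_mult norm_power)
    qed
    then have 1: "cmod (?T1 \<xi>) \<le> real CARD('n) * (?W \<xi> / ?D)" by simp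
    have "cmod (?T2 \<xi>) \<le> (\<Sum>j\<in>UNIV. \<kappa> * ((sin (\<xi> j))\<^sup>2 * ?W \<xi> / ?D\<^sup>2) + (cmod (dtrig j F f \<xi>))\<^sup>2 / \<kappa>)"
    proof (rule sum_norm_le)
      fix j
      have "cmod (of_real (sin (\<xi> j) * ?R j \<xi>) / mden s \<xi>) = \<bar>sin (\<xi> j)\<bar> * \<bar>?R j \<xi>\<bar> / ?D"
        by (simp only: norm_divide norm_of_real abs_mult)
      also have "\<dots> \<le> \<kappa> * ((sin (\<xi> j))\<^sup>2 * ?W \<xi> / ?D\<^sup>2) + (cmod (dtrig j F f \<xi>))\<^sup>2 / \<kappa>"
        by (rule abs_cross_term_le[OF k])
      finally show "cmod (of_real (sin (\<xi> j) * ?R j \<xi>) / mden s \<xi>) \<le> \<kappa> * ((sin (\<xi> j))\<^sup>2 * ?W \<xi> / ?D\<^sup>2) + (cmod (dtrig j F f \<xi>))\<^sup>2 / \<kappa>" .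
    qed
    also have "\<dots> = \<kappa> * (bsym \<xi> * (?W \<xi> / ?D\<^sup>2)) + (\<Sum>j\<in>UNIV. (cmod (dtrig j F f \<xi>))\<^sup>2) / \<kappa>"
      unfolding bsym_def sum.distrib by (simp add: sum_distrib_left sum_distrib_right sum_divide_distrib)
    finally have 2: "cmod (?T2 \<xi>) \<le> \<kappa> * (bsym \<xi> * (?W \<xi> / ?D\<^sup>2)) + (\<Sum>j\<in>UNIV. (cmod (dtrig j F f \<xi>))\<^sup>2) / \<kappa>" .
    have "cmod (?T3 \<xi>) \<le> (\<Sum>j\<in>UNIV. 2 * s\<^sup>2 * ((sin (\<xi> j))\<^sup>2 * (?W \<xi> / ?D\<^sup>2)))"
    proof (rule sum_norm_le)
      fix j
      have "cmod (of_real (sin (\<xi> j) * ?W \<xi>) * (\<i> * of_real (2 * s\<^sup>2 * sin (\<xi> j) * cos (\<xi> j))) / (mden s \<xi>)\<^sup>2)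
          = \<bar>cos (\<xi> j)\<bar> * (2 * s\<^sup>2 * ((sin (\<xi> j))\<^sup>2 * (?W \<xi> / ?D\<^sup>2)))"
        by (simp only: norm_divide norm_mult norm_of_real norm_power abs_mult norm_ii)
          (simp add: power2_eq_square ac_simps abs_mult)
      also have "\<dots> \<le> 1 * (2 * s\<^sup>2 * ((sin (\<xi> j))\<^sup>2 * (?W \<xi> / ?D\<^sup>2)))"
        by (intro mult_right_mono) auto
      finally show "cmod (of_real (sin (\<xi> j) * ?W \<xi>) * (\<i> * of_real (2 * s\<^sup>2 * sin (\<xi> j) * cos (\<xi> j))) / (mden s \<xi>)\<^sup>2)
         \<le> 2 * s\<^sup>2 * ((sin (\<xi> j))\<^sup>2 * (?W \<xi> / ?D\<^sup>2))" by (simp only: mult_1)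
    qed
    also have "\<dots> = 2 * s\<^sup>2 * (bsym \<xi> * (?W \<xi> / ?D\<^sup>2))"
      unfolding bsym_def by (simp only: sum_distrib_left sum_distrib_right)
    finally have 3: "cmod (?T3 \<xi>) \<le> 2 * s\<^sup>2 * (bsym \<xi> * (?W \<xi> / ?D\<^sup>2))" .
    have "cmod (?T1 \<xi> + ?T2 \<xi> + ?T3 \<xi>) \<le> cmod (?T1 \<xi>) + cmod (?T2 \<xi>) + cmod (?T3 \<xi>)"
      by (meson add_mono norm_triangle_ineq order_trans order_refl)
    also have "\<dots> \<le> real CARD('n) * (?W \<xi> / ?D) + (\<kappa> * (bsym \<xi> * (?W \<xi> / ?D\<^sup>2)) + (\<Sum>j\<in>UNIV. (cmod (dtrig j F f \<xi>))\<^sup>2) / \<kappa>) + 2 * s\<^sup>2 * (bsym \<xi> * (?W \<xi> / ?D\<^sup>2))"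
      by (intro add_mono 1 2 3)
    finally show "cmod (?T1 \<xi> + ?T2 \<xi> + ?T3 \<xi>) \<le> real CARD('n) * (?W \<xi> / ?D)
      + (\<kappa> * (bsym \<xi> * (?W \<xi> / ?D\<^sup>2)) + (\<Sum>j\<in>UNIV. (cmod (dtrig j F f \<xi>))\<^sup>2) / \<kappa>)
      + 2 * s\<^sup>2 * (bsym \<xi> * (?W \<xi> / ?D\<^sup>2))" .
  next
    show "integrable torus (\<lambda>\<xi>. cmod (?T1 \<xi> + ?T2 \<xi> + ?T3 \<xi>))"
      by (intro bounded_meas_integrable bounded_meas_norm bounded_meas_add bm1)
    show "integrable torus (\<lambda>\<xi>. real CARD('n) * (?W \<xi> / cmod (mden s \<xi>))
      + (\<kappa> * (bsym \<xi> * (?W \<xi> / (cmod (mden s \<xi>))\<^sup>2)) + (\<Sum>j\<in>UNIV. (cmod (dtrig j F f \<xi>))\<^sup>2) / \<kappa>)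
      + 2 * s\<^sup>2 * (bsym \<xi> * (?W \<xi> / (cmod (mden s \<xi>))\<^sup>2)))"
      unfolding divide_inverse[of _ \<kappa>] by (intro bounded_meas_integrable mI)
  qed
  also have "\<dots> = real CARD('n) * (\<integral>\<xi>. ?W \<xi> / cmod (mden s \<xi>) \<partial>torus)
      + (\<kappa> * mquad s + (\<Sum>j\<in>UNIV. \<integral>\<xi>. (cmod (dtrig j F f \<xi>))\<^sup>2 \<partial>torus) * inverse \<kappa>) + 2 * s\<^sup>2 * mquad s"
    unfolding mquad_def divide_inverse[of _ \<kappa>]
    by (subst Bochner_Integration.integral_add Bochner_Integration.integral_mult_right_zero
          Bochner_Integration.integral_mult_left_zero Bochner_Integration.integral_sum;
        (intro bounded_meas_integrable mI)?)+ (rule refl)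
  also have "\<dots> \<le> real CARD('n) * (\<kappa> / 2 * mquad s + 2 / \<kappa> * wnorm F f)
      + (\<kappa> * mquad s + wnorm F f * inverse \<kappa>) + 2 * s\<^sup>2 * mquad s"
  proof -
    have "(\<Sum>j\<in>UNIV. \<integral>\<xi>. (cmod (dtrig j F f \<xi>))\<^sup>2 \<partial>torus) \<le> wnorm F f"
      unfolding wnorm_eq[OF F] by (simp add: Bochner_Integration.integral_nonneg)
    then show ?thesis using k
      by (intro add_mono mult_left_mono mult_right_mono mform_abs_le order_refl) auto
  qed
  also have "\<dots> = 2 * (s\<^sup>2 * mquad s + \<kappa> * ((real CARD('n) / 4 + 1 / 2) * mquad s)
    + (real CARD('n) + 1 / 2) * wnorm F f / \<kappa>)"
    using k by (simp add: field_simps)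
  finally show ?thesis by (rule mult_left_le_imp_le) simp
qed

text \<open>In the variable \<open>t\<^sup>2\<close> the first order remainder is explicit and at
  most \<open>K\<close> times the squared increment, where \<open>K\<close> is finite thanks to
  \<open>Im z > 0\<close>. The chain rule then gives the factor \<open>2 * s\<close>.\<close>

lemma mform_derivative: "(mform has_vector_derivative 2 * \<i> * of_real s * mder s) (at s)"
proof -
  let ?W = "\<lambda>\<xi>. (cmod (trig F f \<xi>))\<^sup>2"
  let ?e = "\<lambda>t. t\<^sup>2 - s\<^sup>2"
  define K where "K = (\<integral>\<xi>. (bsym \<xi>)\<^sup>2 * ?W \<xi> / (Im z) ^ 3 \<partial>torus)"
  have K: "K \<ge> 0" unfolding K_def using z by (intro Bochner_Integration.integral_nonneg) auto
  have quad: "cmod (mform t - mform s - \<i> * of_real (?e t) * mder s) \<le> K * (?e t)\<^sup>2" for t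
  proof -
    let ?G = "\<lambda>\<xi>. - (of_real ((?e t)\<^sup>2 * ((bsym \<xi>)\<^sup>2 * ?W \<xi>)) / (mden s \<xi>)\<^sup>2 / mden t \<xi>)"
    have "mform t - mform s - \<i> * of_real (?e t) * mder s
        = (\<integral>\<xi>. of_real (?W \<xi>) / mden t \<xi> - of_real (?W \<xi>) / mden s \<xi>
          - \<i> * of_real (?e t) * (of_real (bsym \<xi> * ?W \<xi>) / (mden s \<xi>)\<^sup>2) \<partial>torus)"
      unfolding mform_def mder_def
      by (subst Bochner_Integration.integral_diff Bochner_Integration.integral_mult_right_zero;
        (intro bounded_meas_integrable mI)?)+ (rule refl)
    also have "\<dots> = (\<integral>\<xi>. ?G \<xi> \<partial>torus)"
    proof (intro Bochner_Integration.integral_cong refl)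
      fix \<xi> :: "'n \<Rightarrow> real"
      have ne: "mden s \<xi> \<noteq> 0" "mden t \<xi> \<noteq> 0" using mden_pos[of s \<xi>] mden_pos[of t \<xi>] by auto
      have rel: "mden s \<xi> = mden t \<xi> + \<i> * of_real (?e t * bsym \<xi>)"
        by (simp add: mden_def algebra_simps)
      have alg: "w / B - w / A - \<i> * e * (b * w / A\<^sup>2) = - (e\<^sup>2 * (b\<^sup>2 * w) / A\<^sup>2 / B)"
        if "A \<noteq> 0" "B \<noteq> 0" "A = B + \<i> * (e * b)" for A B w e b :: complex
      proof -
        have "w / B - w / A = w * (A - B) / (A * B)" using that by (simp add: field_simps)
        also have "A - B = \<i> * (e * b)" using that by simp
        finally have "w / B - w / A - \<i> * e * (b * w / A\<^sup>2) = \<i> * e * b * w * (A - B) / (A\<^sup>2 * B)"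
          using that(1,2) by (simp add: field_simps power2_eq_square)
        also have "A - B = \<i> * (e * b)" using that by simp
        also have "\<i> * e * b * w * (\<i> * (e * b)) = - (e\<^sup>2 * (b\<^sup>2 * w))"
          by (simp add: power2_eq_square algebra_simps)
        finally show ?thesis by simp
      qed
      show "of_real (?W \<xi>) / mden t \<xi> - of_real (?W \<xi>) / mden s \<xi>
          - \<i> * of_real (?e t) * (of_real (bsym \<xi> * ?W \<xi>) / (mden s \<xi>)\<^sup>2) = ?G \<xi>"
        using alg[OF ne, of "of_real (?e t)" "of_real (bsym \<xi>)" "of_real (?W \<xi>)"] rel
        by (simp only: of_real_mult of_real_power)
    qed
    finally have "cmod (mform t - mform s - \<i> * of_real (?e t) * mder s) \<le> (\<integral>\<xi>. cmod (?G \<xi>) \<partial>torus)"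
      by (simp only: integral_norm_bound)
    also have "\<dots> \<le> (\<integral>\<xi>. (?e t)\<^sup>2 * ((bsym \<xi>)\<^sup>2 * ?W \<xi> / (Im z) ^ 3) \<partial>torus)"
    proof (rule integral_mono)
      fix \<xi> :: "'n \<Rightarrow> real"
      have "(Im z) ^ 3 = (Im z)\<^sup>2 * Im z" by (simp add: power2_eq_square power3_eq_cube)
      also have "\<dots> \<le> (cmod (mden s \<xi>))\<^sup>2 * cmod (mden t \<xi>)"
        using z mden_ge[of s \<xi>] mden_ge[of t \<xi>] by (intro mult_mono power_mono) auto
      finally have le: "(Im z) ^ 3 \<le> (cmod (mden s \<xi>))\<^sup>2 * cmod (mden t \<xi>)" .
      have "cmod (?G \<xi>) = (?e t)\<^sup>2 * ((bsym \<xi>)\<^sup>2 * ?W \<xi>) / ((cmod (mden s \<xi>))\<^sup>2 * cmod (mden t \<xi>))"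
        by (simp only: norm_minus_cancel norm_divide norm_of_real norm_power) simp
      also have "\<dots> \<le> (?e t)\<^sup>2 * ((bsym \<xi>)\<^sup>2 * ?W \<xi>) / (Im z) ^ 3"
        using z le mden_pos[of s \<xi>] mden_pos[of t \<xi>] by (intro divide_left_mono mult_pos_pos) auto
      finally show "cmod (?G \<xi>) \<le> (?e t)\<^sup>2 * ((bsym \<xi>)\<^sup>2 * ?W \<xi> / (Im z) ^ 3)" by simp
    next
      show "integrable torus (\<lambda>\<xi>. cmod (?G \<xi>))" by (intro bounded_meas_integrable mI)
      show "integrable torus (\<lambda>\<xi>. (?e t)\<^sup>2 * ((bsym \<xi>)\<^sup>2 * ?W \<xi> / (Im z) ^ 3))"
        unfolding divide_inverse by (intro bounded_meas_integrable mI)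
    qed
    also have "\<dots> = K * (?e t)\<^sup>2" unfolding K_def by simp
    finally show ?thesis .
  qed
  have e: "(?e has_real_derivative 2 * s) (at s)" by (auto intro!: derivative_eq_intros)
  define r where "r t = mform t - mform s - \<i> * of_real (?e t) * mder s" for t
  have "(r has_vector_derivative 0) (at s)"
    unfolding has_vector_derivative_def has_derivative_at
  proof (intro conjI)
    show "bounded_linear (\<lambda>x. x *\<^sub>R (0::complex))" by simp
    have "(\<lambda>h. K * (?e (s + h) / h)\<^sup>2 * \<bar>h\<bar>) \<midarrow>0\<rightarrow> K * (2 * s)\<^sup>2 * \<bar>0\<bar>"
      using e unfolding DERIV_def by (intro tendsto_intros) simp
    then have lim: "(\<lambda>h. K * (?e (s + h) / h)\<^sup>2 * \<bar>h\<bar>) \<midarrow>0\<rightarrow> 0" by simp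
    show "(\<lambda>h. norm (r (s + h) - r s - h *\<^sub>R 0) / norm h) \<midarrow>0\<rightarrow> 0"
    proof (rule Lim_null_comparison[OF _ lim])
      have "norm (norm (r (s + h) - r s - h *\<^sub>R 0) / norm h) \<le> K * (?e (s + h) / h)\<^sup>2 * \<bar>h\<bar>" if "h \<noteq> 0" for h
      proof -
        have "norm (r (s + h) - r s - h *\<^sub>R 0) / \<bar>h\<bar> \<le> K * (?e (s + h))\<^sup>2 / \<bar>h\<bar>"
          using quad[of "s + h"] by (intro divide_right_mono) (auto simp: r_def)
        also have "\<dots> = K * (?e (s + h) / h)\<^sup>2 * \<bar>h\<bar>"
          using that by (simp add: power_divide power2_eq_square[of h] field_simps abs_if)
        finally show ?thesis by simp
      qed
      then show "\<forall>\<^sub>F h in at 0. norm (norm (r (s + h) - r s - h *\<^sub>R 0) / norm h) \<le> K * (?e (s + h) / h)\<^sup>2 * \<bar>h\<bar>"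
        by (auto simp: eventually_at_filter)
    qed
  qed
  moreover have "((\<lambda>t. mform s + \<i> * of_real (?e t) * mder s) has_vector_derivative 0 + \<i> * of_real (2 * s) * mder s) (at s)"
    using e by (intro has_vector_derivative_add has_vector_derivative_const has_vector_derivative_mult_left
        has_vector_derivative_mult_right has_vector_derivative_of_real)
       (simp add: has_real_derivative_iff_has_vector_derivative)
  ultimately have "((\<lambda>t. r t + (mform s + \<i> * of_real (?e t) * mder s)) has_vector_derivative 0 + (0 + \<i> * of_real (2 * s) * mder s)) (at s)"
    by (rule has_vector_derivative_add)
  then show ?thesis by (simp add: r_def ac_simps)
qed

text \<open>Let \<open>M\<close> be the supremum of the form over \<open>{0..1/2}\<close>. At
  \<open>s = 1/2\<close> the form is bounded directly, and the derivative is at most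
  \<open>3/2 * M\<close> plus a multiple of \<open>N\<close>, so the way down to
  \<open>s = 0\<close> costs \<open>3/4 * M\<close>, which is absorbed. Absorption needs
  \<open>M\<close> finite; the a priori bound for that degenerates as \<open>Im z\<close> tends to
  zero, the resulting one does not.\<close>

lemma mform_bound: "cmod (mform 0) \<le> (64 + 16 * ((real CARD('n) / 4 + 1 / 2) * (real CARD('n) + 1 / 2))) * wnorm F f"
proof -
  define C1 where "C1 = real CARD('n) / 4 + 1 / 2"
  define C2 where "C2 = real CARD('n) + 1 / 2"
  define N where "N = wnorm F f"
  have C: "C1 > 0" "C2 > 0" "N \<ge> 0" unfolding C1_def C2_def N_def by (auto simp: wnorm_nonneg add_nonneg_pos)
  have abs: "cmod (mform s) \<le> (\<integral>\<xi>. (cmod (trig F f \<xi>))\<^sup>2 / cmod (mden s \<xi>) \<partial>torus)" for s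
    unfolding mform_def by (rule order_trans[OF integral_norm_bound]) (simp add: norm_divide norm_power)
  define S where "S = (\<lambda>s. cmod (mform s)) ` {0..1/2}"
  define M where "M = Sup S"
  have "bdd_above S"
  proof -
    have "cmod (mform s) \<le> (\<integral>\<xi>. (cmod (trig F f \<xi>))\<^sup>2 / Im z \<partial>torus)" for s
    proof (rule order_trans[OF abs], rule integral_mono)
      show "integrable torus (\<lambda>\<xi>. (cmod (trig F f \<xi>))\<^sup>2 / Im z)"
        unfolding divide_inverse by (intro bounded_meas_integrable mI)
      show "(cmod (trig F f \<xi>))\<^sup>2 / cmod (mden s \<xi>) \<le> (cmod (trig F f \<xi>))\<^sup>2 / Im z" for \<xi>
        using mden_ge[of s \<xi>] z mden_pos[of s \<xi>] by (intro divide_left_mono) auto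
    qed (intro bounded_meas_integrable mI)
    then show ?thesis unfolding S_def by (auto intro!: bdd_aboveI)
  qed
  then have M: "cmod (mform s) \<le> M" if "s \<in> {0..1/2}" for s
    unfolding M_def S_def using that by (intro cSup_upper) (auto simp: S_def)
  have M0: "M \<ge> 0" using order_trans[OF norm_ge_zero M[of 0]] by simp
  \<comment> \<open>With \<open>\<kappa> = 1/4\<close> the term \<open>mquad (1/2) / 8\<close> is at
    most half of \<open>cmod (mform (1/2))\<close> and is absorbed, which doubles the constant
    8.\<close>
  have half: "cmod (mform (1/2)) \<le> 16 * N"
    using abs[of "1/2"] mform_abs_le[of "1/4" "1/2"] mquad_le_mform[of "1/2"]
    unfolding N_def by (simp add: power2_eq_square)
  have der: "cmod (2 * \<i> * of_real s * mder s) \<le> 3 / 2 * M + 8 * (C1 * C2) * N" if s: "s \<in> {0..1/2}" for s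
  proof (cases "s = 0")
    case True
    then show ?thesis using C M0 by simp
  next
    case False
    then have s0: "s > 0" "s \<le> 1/2" using s by auto
    \<comment> \<open>Proportional to \<open>s\<close>: after multiplication by
      \<open>2 * s\<close>, the \<open>mquad\<close> term becomes
      \<open>s\<^sup>2 * mquad s / 2\<close>, and the term with \<open>1 / \<kappa>\<close> becomes
      a constant.\<close>
    define \<kappa> where "\<kappa> = s / (4 * C1)"
    have k: "\<kappa> > 0" using s0 C by (simp add: \<kappa>_def)
    have q: "s\<^sup>2 * mquad s \<le> M" using mquad_le_mform[of s] M[OF s] by linarith
    have "cmod (2 * \<i> * of_real s * mder s) = 2 * s * cmod (mder s)"
      using s0 by (simp add: norm_mult)
    also have "\<dots> \<le> 2 * s * (s\<^sup>2 * mquad s + \<kappa> * (C1 * mquad s) + C2 * N / \<kappa>)"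
      using s0 mder_le[OF k, of s] unfolding C1_def C2_def N_def by (intro mult_left_mono) auto
    also have "\<dots> = 2 * s * (s\<^sup>2 * mquad s) + (s\<^sup>2 * mquad s) / 2 + 8 * (C1 * C2) * N"
      using s0 C by (simp add: \<kappa>_def power2_eq_square field_simps)
    also have "\<dots> \<le> 1 * (s\<^sup>2 * mquad s) + (s\<^sup>2 * mquad s) / 2 + 8 * (C1 * C2) * N"
      using s0 mquad_nonneg[of s] by (intro add_right_mono mult_right_mono) auto
    also have "\<dots> \<le> 3 / 2 * M + 8 * (C1 * C2) * N" using q by linarith
    finally show ?thesis .
  qed
  have "cmod (mform s) \<le> 16 * N + (3 / 4 * M + 4 * (C1 * C2) * N)" if s: "s \<in> {0..1/2}" for s
  proof -
    have "cmod (mform s - mform (1/2)) \<le> (3 / 2 * M + 8 * (C1 * C2) * N) * norm (s - 1/2)"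
    proof (rule differentiable_bound[where S = "{0..1/2}" and f' = "\<lambda>s h. h *\<^sub>R (2 * \<i> * of_real s * mder s)"])
      show "(mform has_derivative (\<lambda>h. h *\<^sub>R (2 * \<i> * of_real t * mder t))) (at t within {0..1/2})" for t
        using mform_derivative[of t] has_derivative_at_withinI unfolding has_vector_derivative_def by blast
      show "onorm (\<lambda>h. h *\<^sub>R (2 * \<i> * of_real t * mder t)) \<le> 3 / 2 * M + 8 * (C1 * C2) * N" if "t \<in> {0..1/2}" for t
      proof (rule onorm_le)
        fix h :: real
        show "norm (h *\<^sub>R (2 * \<i> * of_real t * mder t)) \<le> (3 / 2 * M + 8 * (C1 * C2) * N) * norm h"
          using mult_left_mono[OF der[OF that], of "\<bar>h\<bar>"] by (simp add: mult.commute)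
      qed
    qed (use s in auto)
    also have "\<dots> \<le> (3 / 2 * M + 8 * (C1 * C2) * N) * (1/2)"
      using s C M0 by (intro mult_left_mono) auto
    finally have "cmod (mform s - mform (1/2)) \<le> 3 / 4 * M + 4 * (C1 * C2) * N" by simp
    moreover have "cmod (mform s) \<le> cmod (mform s - mform (1/2)) + cmod (mform (1/2))"
      using norm_triangle_ineq[of "mform s - mform (1/2)" "mform (1/2)"] by simp
    ultimately show ?thesis using half by linarith
  qed
  then have "M \<le> 16 * N + (3 / 4 * M + 4 * (C1 * C2) * N)"
    unfolding M_def by (intro cSup_least) (auto simp: S_def)
  then have "M \<le> 64 * N + 16 * (C1 * C2) * N" by linarith
  moreover have "cmod (mform 0) \<le> M" by (rule M) simp
  ultimately have "cmod (mform 0) \<le> (64 + 16 * (C1 * C2)) * N" by (simp add: distrib_right)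
  then show ?thesis unfolding C1_def C2_def N_def .
qed

end

section \<open>Polarisation and the case of inverse-square decay\<close>

lemma trig_add: "trig F (\<lambda>x. f x + c * g x) \<xi> = trig F f \<xi> + c * trig F g \<xi>"
  unfolding trig_def by (simp add: distrib_right sum.distrib sum_distrib_left mult.assoc)

text \<open>At \<open>s = 0\<close> the regularisation is gone and \<open>mform_bound\<close>
  controls the diagonal of the form. Polarisation over the fourth roots of unity \<open>c\<close>
  recovers pairs, since \<open>wnorm\<close> of \<open>f + c * g\<close> is at most twice the sum of
  the two norms.\<close>

lemma rform_weighted_bound:
  fixes f g :: "int ^ 'n \<Rightarrow> complex"
  assumes z: "Im z > 0" and F: "finite F" and d: "CARD('n) \<ge> 3"
  defines "C \<equiv> 64 + 16 * ((real CARD('n) / 4 + 1 / 2) * (real CARD('n) + 1 / 2))"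
  shows "cmod (rform z F f g) \<le> 2 * C * (wnorm F f + wnorm F g)"
proof -
  have C: "C \<ge> 0" unfolding C_def by (intro add_nonneg_nonneg mult_nonneg_nonneg) auto
  have diag: "cmod (rform z F u u) \<le> C * wnorm F u" for u :: "int ^ 'n \<Rightarrow> complex"
    using mform_bound[OF z F d, of u]
    unfolding C_def rform_def mform_def[OF z F d] mden_def[OF z F d] complex_norm_square by simp
  define q where "q c = rform z F (\<lambda>x. f x + c * g x) (\<lambda>x. f x + c * g x)" for c
  have q: "cmod (q c) \<le> C * (2 * (wnorm F f + wnorm F g))" if "cmod c = 1" for c
  proof -
    have "wnorm F (\<lambda>x. f x + c * g x) \<le> (\<Sum>x\<in>F. (1 + (lat_norm x)\<^sup>2) * (2 * ((cmod (f x))\<^sup>2 + (cmod (g x))\<^sup>2)))"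
      unfolding wnorm_def
    proof (intro sum_mono mult_left_mono)
      fix x
      have "(cmod (f x + c * g x))\<^sup>2 \<le> (cmod (f x) + cmod (g x))\<^sup>2"
        using norm_triangle_ineq[of "f x" "c * g x"] that by (intro power_mono) (auto simp: norm_mult)
      also have "\<dots> \<le> 2 * ((cmod (f x))\<^sup>2 + (cmod (g x))\<^sup>2)"
        using zero_le_power2[of "cmod (f x) - cmod (g x)"] by (simp add: power2_eq_square algebra_simps)
      finally show "(cmod (f x + c * g x))\<^sup>2 \<le> 2 * ((cmod (f x))\<^sup>2 + (cmod (g x))\<^sup>2)" .
    qed auto
    also have "\<dots> = 2 * (wnorm F f + wnorm F g)"
      unfolding wnorm_def by (simp add: sum_distrib_left distrib_left sum.distrib ac_simps)
    finally show ?thesis unfolding q_def using diag[of "\<lambda>x. f x + c * g x"] C by (meson mult_left_mono order_trans)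
  qed
  have I: "integrable torus (\<lambda>\<xi>. trig F u \<xi> * cnj (trig F v \<xi>) / (of_real (hsym \<xi>) - z))" for u v :: "int ^ 'n \<Rightarrow> complex"
    using z by (intro bounded_meas_integrable bounded_meas_div_hsym bounded_meas_intros bounded_meas_trig) auto
  have "4 * rform z F f g = q 1 - q (-1) + \<i> * q \<i> - \<i> * q (- \<i>)"
  proof -
    let ?t = "\<lambda>c \<xi>. (trig F (\<lambda>x. f x + c * g x) \<xi> * cnj (trig F (\<lambda>x. f x + c * g x) \<xi>) / (of_real (hsym \<xi>) - z))"
    have "q 1 - q (-1) + \<i> * q \<i> - \<i> * q (- \<i>) = (\<integral>\<xi>. ?t 1 \<xi> - ?t (-1) \<xi> + \<i> * ?t \<i> \<xi> - \<i> * ?t (- \<i>) \<xi> \<partial>torus)"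
      unfolding q_def rform_def
      by (subst Bochner_Integration.integral_diff Bochner_Integration.integral_add Bochner_Integration.integral_mult_right_zero;
        (intro I Bochner_Integration.integrable_diff Bochner_Integration.integrable_add integrable_mult_right)?)+ (rule refl)
    also have "\<dots> = (\<integral>\<xi>. 4 * (trig F f \<xi> * cnj (trig F g \<xi>) / (of_real (hsym \<xi>) - z)) \<partial>torus)"
    proof (intro Bochner_Integration.integral_cong refl)
      fix \<xi> :: "'n \<Rightarrow> real"
      have "(a + 1 * b) * cnj (a + 1 * b) / D - (a + - 1 * b) * cnj (a + - 1 * b) / D + \<i> * ((a + \<i> * b) * cnj (a + \<i> * b) / D)
          - \<i> * ((a + - \<i> * b) * cnj (a + - \<i> * b) / D) = 4 * (a * cnj b / D)" for a b D :: complex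
      proof -
        have "(a + 1 * b) * cnj (a + 1 * b) - (a + - 1 * b) * cnj (a + - 1 * b) + \<i> * ((a + \<i> * b) * cnj (a + \<i> * b))
          - \<i> * ((a + - \<i> * b) * cnj (a + - \<i> * b)) = 4 * (a * cnj b)"
          by (simp add: algebra_simps)
        then show ?thesis by (metis (no_types, lifting) add_divide_distrib diff_divide_distrib times_divide_eq_right)
      qed
      then show "?t 1 \<xi> - ?t (-1) \<xi> + \<i> * ?t \<i> \<xi> - \<i> * ?t (- \<i>) \<xi> = 4 * (trig F f \<xi> * cnj (trig F g \<xi>) / (of_real (hsym \<xi>) - z))"
        unfolding trig_add by blast
    qed
    also have "\<dots> = 4 * rform z F f g" unfolding rform_def by (rule Bochner_Integration.integral_mult_right_zero)
    finally show ?thesis ..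
  qed
  then have "4 * cmod (rform z F f g) = cmod (q 1 - q (-1) + \<i> * q \<i> - \<i> * q (- \<i>))"
    by (metis norm_mult norm_numeral)
  also have "\<dots> \<le> cmod (q 1) + cmod (q (-1)) + cmod (\<i> * q \<i>) + cmod (\<i> * q (- \<i>))"
    by (meson add_mono norm_triangle_ineq norm_triangle_ineq4 order_refl order_trans)
  also have "\<dots> \<le> 4 * (C * (2 * (wnorm F f + wnorm F g)))"
    using q[of 1] q[of "-1"] q[of \<i>] q[of "-\<i>"] by (simp add: norm_mult)
  finally show ?thesis by linarith
qed

text \<open>The decay of \<open>V\<close> compensates the weight
  \<open>1 + (lat_norm x)\<^sup>2\<close> in \<open>wnorm\<close>, so that only plain square sums
  remain.\<close>

theorem inverse_square_uniform_bound:
  fixes V :: "int ^ 'n \<Rightarrow> real"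
  assumes d: "CARD('n) \<ge> 3" and C: "C > 0" and V: "\<And>x. \<bar>V x\<bar> \<le> C * (1 + lat_norm x) powr (-2)"
  shows "uniform_resolvent_bound V"
proof -
  define K where "K = 64 + 16 * ((real CARD('n) / 4 + 1 / 2) * (real CARD('n) + 1 / 2))"
  have K: "K > 0" unfolding K_def by (intro add_pos_nonneg mult_nonneg_nonneg) auto
  have ln: "lat_norm x \<ge> 0" for x :: "int ^ 'n" unfolding lat_norm_def by (simp add: sum_nonneg)
  have V2: "(1 + (lat_norm x)\<^sup>2) * \<bar>V x\<bar> \<le> C" for x
  proof -
    have "(1 + lat_norm x) powr (-2) = 1 / (1 + lat_norm x)\<^sup>2"
      using ln[of x] by (simp add: powr_minus_divide powr_numeral)
    then have "(1 + (lat_norm x)\<^sup>2) * \<bar>V x\<bar> \<le> (1 + (lat_norm x)\<^sup>2) * (C * (1 / (1 + lat_norm x)\<^sup>2))"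
      using V[of x] by (intro mult_left_mono) auto
    also have "\<dots> = C * ((1 + (lat_norm x)\<^sup>2) / (1 + lat_norm x)\<^sup>2)" by simp
    also have "\<dots> \<le> C * 1"
    proof (intro mult_left_mono)
      have "1 + (lat_norm x)\<^sup>2 \<le> (1 + lat_norm x)\<^sup>2" "0 < (1 + lat_norm x)\<^sup>2"
        using ln[of x] by (simp add: power2_sum, intro zero_less_power, linarith)
      then show "(1 + (lat_norm x)\<^sup>2) / (1 + lat_norm x)\<^sup>2 \<le> 1" by simp
    qed (use C in auto)
    finally show ?thesis by simp
  qed
  show ?thesis
  proof (rule uniform_resolvent_boundI[where K = C and M = "2 * K * C"])
    show "\<bar>V x\<bar> \<le> C" for x
      using V2[of x] mult_right_mono[of 1 "1 + (lat_norm x)\<^sup>2" "\<bar>V x\<bar>"] by simp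
    show "2 * K * C > 0" using K C by simp
    fix z and F :: "(int ^ 'n) set" and u v :: "int ^ 'n \<Rightarrow> complex" assume z: "Im z > 0" and F: "finite F"
    have w: "wnorm F (\<lambda>x. of_real (sqrt \<bar>V x\<bar>) * u x) \<le> C * (\<Sum>x\<in>F. (cmod (u x))\<^sup>2)" for u
    proof -
      have "wnorm F (\<lambda>x. of_real (sqrt \<bar>V x\<bar>) * u x) = (\<Sum>x\<in>F. (1 + (lat_norm x)\<^sup>2) * \<bar>V x\<bar> * (cmod (u x))\<^sup>2)"
        unfolding wnorm_def by (simp add: norm_mult power_mult_distrib mult.assoc)
      also have "\<dots> \<le> (\<Sum>x\<in>F. C * (cmod (u x))\<^sup>2)"
        by (intro sum_mono mult_right_mono V2) auto
      finally show ?thesis by (simp add: sum_distrib_left)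
    qed
    have "cmod (rform z F (\<lambda>x. of_real (sqrt \<bar>V x\<bar>) * u x) (\<lambda>x. of_real (sqrt \<bar>V x\<bar>) * v x))
        \<le> 2 * K * (C * (\<Sum>x\<in>F. (cmod (u x))\<^sup>2) + C * (\<Sum>x\<in>F. (cmod (v x))\<^sup>2))"
      unfolding K_def
      by (rule order_trans[OF rform_weighted_bound[OF z F d]])
        (use w[of u] w[of v] K in \<open>auto intro!: mult_left_mono add_mono simp: K_def\<close>)
    then show "cmod (rform z F (\<lambda>x. of_real (sqrt \<bar>V x\<bar>) * u x) (\<lambda>x. of_real (sqrt \<bar>V x\<bar>) * v x))
        \<le> 2 * K * C * ((\<Sum>x\<in>F. (cmod (u x))\<^sup>2) + (\<Sum>x\<in>F. (cmod (v x))\<^sup>2))"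
      by (simp add: algebra_simps)
  qed
qed

subsection \<open>An oscillatory integral\<close>

text \<open>Integrating by parts against \<open>\<phi>' / (\<phi>'\<^sup>2 + \<mu>\<^sup>2)\<close> instead of \<open>1 / \<phi>'\<close> avoids splitting off the
  neighbourhood of a stationary point.\<close>

lemma van_der_corput_second:
  fixes \<phi> \<phi>' \<phi>'' :: "real \<Rightarrow> real"
  assumes ab: "a \<le> b" and mu: "\<mu> > 0" and lam: "\<kappa> > 0"
    and d1: "\<And>x. (\<phi> has_real_derivative \<phi>' x) (at x)"
    and d2: "\<And>x. (\<phi>' has_real_derivative \<phi>'' x) (at x)"
    and s: "\<bar>\<sigma>\<bar> = 1" and low: "\<And>x. x \<in> {a..b} \<Longrightarrow> \<sigma> * \<phi>'' x \<ge> \<kappa>"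
  shows "cmod (integral {a..b} (\<lambda>x. cis (\<phi> x))) \<le> 1 / \<mu> + (1 + \<mu>\<^sup>2 / \<kappa>) * (pi / \<mu>)"
proof -
  define q where "q x = (\<phi>' x)\<^sup>2 + \<mu>\<^sup>2" for x
  have q: "q x > 0" for x unfolding q_def using mu by (simp add: add_nonneg_pos)
  define A where "A x = \<phi>' x / q x" for x
  define A' where "A' x = \<phi>'' x * (\<mu>\<^sup>2 - (\<phi>' x)\<^sup>2) / (q x)\<^sup>2" for x
  have dA: "(A has_real_derivative A' x) (at x)" for x
  proof -
    have "(q has_real_derivative 2 * \<phi>' x * \<phi>'' x) (at x)"
      unfolding q_def[abs_def] using d2[of x] by (auto intro!: derivative_eq_intros)
    from DERIV_divide[OF d2[of x] this] q[of x]
    have "(A has_real_derivative (\<phi>'' x * q x - \<phi>' x * (2 * \<phi>' x * \<phi>'' x)) / (q x * q x)) (at x)"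
      unfolding A_def[abs_def] by simp
    moreover have "(\<phi>'' x * q x - \<phi>' x * (2 * \<phi>' x * \<phi>'' x)) / (q x * q x) = A' x"
      unfolding A'_def by (simp add: q_def power2_eq_square algebra_simps)
    ultimately show ?thesis by simp
  qed
  \<comment> \<open>What the derivative of \<open>cis (\<phi> x) * A x\<close> contains besides
    \<open>\<i> * cis (\<phi> x)\<close>, because \<open>\<phi>' x * A x\<close> is \<open>1\<close>
    only up to \<open>\<mu>\<^sup>2 / q x\<close>.\<close>
  define g where "g x = cis (\<phi> x) * of_real (A' x) - \<i> * cis (\<phi> x) * of_real (\<mu>\<^sup>2 / q x)" for x
  have cont: "continuous_on S (\<lambda>x. cis (\<phi> x))" for S
    using d1 by (intro continuous_intros) (meson DERIV_continuous_on has_field_derivative_at_within)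
  have h1: "((\<lambda>x. \<i> * cis (\<phi> x) + g x) has_integral cis (\<phi> b) * of_real (A b) - cis (\<phi> a) * of_real (A a)) {a..b}"
  proof (rule fundamental_theorem_of_calculus[OF ab])
    fix x
    have "((\<lambda>x. cis (\<phi> x)) has_vector_derivative \<phi>' x *\<^sub>R (\<i> * cis (\<phi> x))) (at x within {a..b})"
      using has_field_derivative_at_within[OF d1[of x], of "{a..b}"] unfolding has_vector_derivative_def
      by (auto intro!: derivative_eq_intros simp: has_field_derivative_def mult.commute)
    moreover have "((\<lambda>x. complex_of_real (A x)) has_vector_derivative of_real (A' x)) (at x within {a..b})"
      using has_field_derivative_at_within[OF dA[of x], of "{a..b}"]
      by (intro has_vector_derivative_of_real) (simp add: has_real_derivative_iff_has_vector_derivative)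
    ultimately have "((\<lambda>x. cis (\<phi> x) * of_real (A x)) has_vector_derivative
        cis (\<phi> x) * of_real (A' x) + (\<phi>' x *\<^sub>R (\<i> * cis (\<phi> x))) * of_real (A x)) (at x within {a..b})"
      by (rule has_vector_derivative_mult)
    moreover have "(\<phi>' x *\<^sub>R (\<i> * cis (\<phi> x))) * of_real (A x) = \<i> * cis (\<phi> x) - \<i> * cis (\<phi> x) * of_real (\<mu>\<^sup>2 / q x)"
    proof -
      have "\<phi>' x * A x = (q x - \<mu>\<^sup>2) / q x"
        unfolding A_def by (simp add: q_def power2_eq_square)
      also have "\<dots> = 1 - \<mu>\<^sup>2 / q x"
        using q[of x] by (simp add: diff_divide_distrib)
      finally have "\<phi>' x * A x = 1 - \<mu>\<^sup>2 / q x" .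
      then have "complex_of_real (\<phi>' x) * of_real (A x) = 1 - of_real (\<mu>\<^sup>2 / q x)"
        by (metis of_real_1 of_real_diff of_real_mult)
      moreover have "(\<phi>' x *\<^sub>R (\<i> * cis (\<phi> x))) * of_real (A x) = \<i> * cis (\<phi> x) * (complex_of_real (\<phi>' x) * of_real (A x))"
        by (simp add: scaleR_conv_of_real)
      ultimately show ?thesis by (simp add: right_diff_distrib)
    qed
    ultimately show "((\<lambda>x. cis (\<phi> x) * of_real (A x)) has_vector_derivative \<i> * cis (\<phi> x) + g x) (at x within {a..b})"
      by (simp only: g_def add_diff_eq add.commute)
  qed
  have h2: "((\<lambda>x. \<i> * cis (\<phi> x)) has_integral \<i> * integral {a..b} (\<lambda>x. cis (\<phi> x))) {a..b}"
    by (intro has_integral_mult_right integrable_integral integrable_continuous_interval cont)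
  have h3: "(g has_integral (cis (\<phi> b) * of_real (A b) - cis (\<phi> a) * of_real (A a) - \<i> * integral {a..b} (\<lambda>x. cis (\<phi> x)))) {a..b}"
    using has_integral_diff[OF h1 h2] by simp
  \<comment> \<open>A majorant of \<open>g\<close> that is an exact derivative, of a multiple of
    \<open>arctan (\<phi>' x / \<mu>) / \<mu>\<close>. As \<open>arctan\<close> is bounded, its
    integral is bounded whatever the length of the interval. The lower bound on
    \<open>\<sigma> * \<phi>''\<close> is used to bring \<open>\<mu>\<^sup>2 / q x\<close> into this
    form.\<close>
  define G where "G x = (1 + \<mu>\<^sup>2 / \<kappa>) * (\<sigma> * \<phi>'' x / q x)" for x
  have h4: "(G has_integral (1 + \<mu>\<^sup>2 / \<kappa>) * (\<sigma> * (arctan (\<phi>' b / \<mu>) / \<mu>) - \<sigma> * (arctan (\<phi>' a / \<mu>) / \<mu>))) {a..b}"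
    unfolding G_def
  proof (intro has_integral_mult_right fundamental_theorem_of_calculus[OF ab])
    fix x
    have "1 + (\<phi>' x / \<mu>)\<^sup>2 = q x / \<mu>\<^sup>2"
      using mu by (simp add: q_def power_divide add_divide_distrib)
    then have "inverse (1 + (\<phi>' x / \<mu>)\<^sup>2) * (\<phi>'' x / \<mu>) / \<mu> = \<phi>'' x / q x"
      using mu by (simp add: power2_eq_square)
    moreover have "((\<lambda>x. arctan (\<phi>' x / \<mu>) / \<mu>) has_real_derivative
        inverse (1 + (\<phi>' x / \<mu>)\<^sup>2) * (\<phi>'' x / \<mu>) / \<mu>) (at x)"
      by (intro DERIV_cdivide DERIV_chain2[OF DERIV_arctan] d2)
    ultimately have "((\<lambda>x. arctan (\<phi>' x / \<mu>) / \<mu>) has_real_derivative \<phi>'' x / q x) (at x)"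
      by simp
    from DERIV_cmult[OF this, of \<sigma>]
    have "((\<lambda>x. \<sigma> * (arctan (\<phi>' x / \<mu>) / \<mu>)) has_vector_derivative \<sigma> * \<phi>'' x / q x) (at x)"
      by (simp add: has_real_derivative_iff_has_vector_derivative)
    then show "((\<lambda>x. \<sigma> * (arctan (\<phi>' x / \<mu>) / \<mu>)) has_vector_derivative \<sigma> * \<phi>'' x / q x) (at x within {a..b})"
      by (rule has_vector_derivative_at_within)
  qed
  have gG: "cmod (g x) \<le> G x" if x: "x \<in> {a..b}" for x
  proof -
    have sp: "\<sigma> * \<phi>'' x = \<bar>\<phi>'' x\<bar>"
    proof -
      have "\<bar>\<sigma> * \<phi>'' x\<bar> = \<bar>\<phi>'' x\<bar>" by (simp add: abs_mult s)
      then show ?thesis using low[OF x] lam by linarith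
    qed
    have a: "\<bar>A' x\<bar> \<le> \<bar>\<phi>'' x\<bar> / q x"
    proof -
      have "\<bar>\<mu>\<^sup>2 - (\<phi>' x)\<^sup>2\<bar> \<le> q x" unfolding q_def abs_le_iff by simp
      then have "\<bar>\<phi>'' x\<bar> * \<bar>\<mu>\<^sup>2 - (\<phi>' x)\<^sup>2\<bar> / (q x)\<^sup>2 \<le> \<bar>\<phi>'' x\<bar> * q x / (q x)\<^sup>2"
        by (intro divide_right_mono mult_left_mono) auto
      then show ?thesis using q[of x] unfolding A'_def by (simp add: abs_mult power2_eq_square)
    qed
    have b: "\<mu>\<^sup>2 / q x \<le> \<mu>\<^sup>2 / \<kappa> * (\<bar>\<phi>'' x\<bar> / q x)"
    proof -
      have "\<mu>\<^sup>2 / q x * 1 \<le> \<mu>\<^sup>2 / q x * (\<bar>\<phi>'' x\<bar> / \<kappa>)"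
        using low[OF x] lam q[of x] sp by (intro mult_left_mono) (auto simp: less_imp_le)
      then show ?thesis by (simp add: ac_simps)
    qed
    have "cmod (g x) \<le> \<bar>A' x\<bar> + \<mu>\<^sup>2 / q x"
      unfolding g_def using q[of x]
      by (intro order_trans[OF norm_triangle_ineq4]) (simp add: norm_mult norm_divide norm_power)
    also have "\<dots> \<le> \<bar>\<phi>'' x\<bar> / q x + \<mu>\<^sup>2 / \<kappa> * (\<bar>\<phi>'' x\<bar> / q x)" using a b by (rule add_mono)
    also have "\<dots> = G x" unfolding G_def sp by (simp add: algebra_simps)
    finally show ?thesis .
  qed
  have Abd: "\<bar>A x\<bar> \<le> 1 / (2 * \<mu>)" for x
  proof -
    have "0 \<le> (\<bar>\<phi>' x\<bar> - \<mu>)\<^sup>2" by simp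
    then have "2 * \<mu> * \<bar>\<phi>' x\<bar> \<le> q x" by (simp add: q_def power2_eq_square algebra_simps)
    then show ?thesis using q[of x] mu unfolding A_def by (simp add: field_simps)
  qed
  have "cmod (integral {a..b} g) \<le> integral {a..b} G"
    by (rule integral_norm_bound_integral) (use h3 h4 gG in \<open>auto intro: has_integral_integrable\<close>)
  also have "\<dots> \<le> (1 + \<mu>\<^sup>2 / \<kappa>) * (pi / \<mu>)"
    unfolding integral_unique[OF h4]
  proof (intro mult_left_mono)
    define u v where "u = arctan (\<phi>' b / \<mu>)" and "v = arctan (\<phi>' a / \<mu>)"
    have "\<sigma> * (u - v) \<le> \<bar>\<sigma> * (u - v)\<bar>" by simp
    also have "\<dots> = \<bar>u - v\<bar>" using s by (simp add: abs_mult)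
    also have "\<dots> \<le> pi"
      using arctan_lbound[of "\<phi>' b / \<mu>"] arctan_ubound[of "\<phi>' b / \<mu>"] arctan_lbound[of "\<phi>' a / \<mu>"] arctan_ubound[of "\<phi>' a / \<mu>"]
      unfolding u_def v_def by (simp add: abs_le_iff)
    finally have "\<sigma> * (u - v) / \<mu> \<le> pi / \<mu>" using mu by (intro divide_right_mono) auto
    then show "\<sigma> * (u / \<mu>) - \<sigma> * (v / \<mu>) \<le> pi / \<mu>" by (simp add: right_diff_distrib diff_divide_distrib)
  qed (use lam in auto)
  finally have I: "cmod (integral {a..b} g) \<le> (1 + \<mu>\<^sup>2 / \<kappa>) * (pi / \<mu>)" .
  have "cmod (integral {a..b} (\<lambda>x. cis (\<phi> x))) = cmod (\<i> * integral {a..b} (\<lambda>x. cis (\<phi> x)))"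
    by (simp add: norm_mult)
  also have "\<i> * integral {a..b} (\<lambda>x. cis (\<phi> x)) = cis (\<phi> b) * of_real (A b) - cis (\<phi> a) * of_real (A a) - integral {a..b} g"
    using integral_unique[OF h3] by simp
  also have "cmod (cis (\<phi> b) * of_real (A b) - cis (\<phi> a) * of_real (A a) - integral {a..b} g)
     \<le> \<bar>A b\<bar> + \<bar>A a\<bar> + cmod (integral {a..b} g)"
    by (intro order_trans[OF norm_triangle_ineq4] add_mono order_refl) (simp_all add: norm_mult)
  also have "\<dots> \<le> 1 / (2 * \<mu>) + 1 / (2 * \<mu>) + (1 + \<mu>\<^sup>2 / \<kappa>) * (pi / \<mu>)"
    by (intro add_mono Abd I)
  also have "1 / (2 * \<mu>) + 1 / (2 * \<mu>) = 1 / \<mu>" using mu by (simp add: field_simps)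
  finally show ?thesis .
qed

lemma sin_ge_half:
  assumes "0 \<le> r" "r \<le> 1"
  shows "sin r \<ge> r / (2::real)"
proof (cases "r = 0")
  case False
  then have r: "0 < r" using assms by simp
  obtain \<xi> where \<xi>: "0 < \<xi>" "\<xi> < r" "sin r - sin 0 = (r - 0) * cos \<xi>"
    using MVT2[OF r, of sin cos] by (metis DERIV_sin)
  have "(sin (\<xi> / 2))\<^sup>2 \<le> (\<xi> / 2)\<^sup>2"
    using abs_sin_x_le_abs_x[of "\<xi> / 2"] by (simp only: abs_le_square_iff)
  also have "\<dots> \<le> (1 / 2)\<^sup>2" using \<xi> assms by (intro power_mono) auto
  finally have "cos \<xi> \<ge> 1 / 2"
    using cos_double_sin[of "\<xi> / 2"] by (simp add: power2_eq_square)
  then have "r * cos \<xi> \<ge> r * (1 / 2)" using r by (intro mult_left_mono) auto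
  then show ?thesis using \<xi> by simp
qed simp

text \<open>The linear phase drops out of the second derivative, hence uniformity in
  \<open>n\<close>. Near the zeros of \<open>cos\<close> that derivative degenerates, and intervals
  of radius \<open>r = t powr (-1/3)\<close> there are estimated by their length. Outside them it is
  at least \<open>t * r = \<mu>\<^sup>2\<close> with \<open>\<mu> = 1 / r\<close>, so the second
  derivative test gives a multiple of \<open>r\<close> as well: this scale balances the two.\<close>

lemma circle_integral_decay:
  assumes t: "t > 0"
  shows "cmod (\<integral>s. cis (real_of_int n * s + 2 * t * cos s) \<partial>circle_measure) \<le> 4 * t powr (-1/3)"
proof (cases "t \<ge> 1")
  case False
  have "cmod (\<integral>s. cis (real_of_int n * s + 2 * t * cos s) \<partial>circle_measure)
      \<le> (\<integral>s. cmod (cis (real_of_int n * s + 2 * t * cos s)) \<partial>circle_measure)"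
    by (rule integral_norm_bound)
  also have "\<dots> = 1" by (simp add: circles.M.prob_space[simplified])
  also have "1 \<le> t powr (-1/3)"
    using False t powr_mono'[of "-1/3" 0 t] by simp
  finally show ?thesis using powr_ge_zero[of t "-1/3"] by linarith
next
  case True
  define r where "r = t powr (-1/3)"
  define \<mu> where "\<mu> = t powr (1/3)"
  have r: "0 < r" "r \<le> 1" using True powr_mono[of "-1/3" 0 t] by (auto simp: r_def)
  have mu: "\<mu> > 0" "1 / \<mu> = r" using True by (auto simp: \<mu>_def r_def powr_minus_divide)
  have tr: "t * r = \<mu>\<^sup>2"
  proof -
    have "t * r = t powr (1 + -1/3)" unfolding powr_add r_def using True by simp
    also have "\<dots> = \<mu>\<^sup>2" unfolding \<mu>_def power2_eq_square powr_add[symmetric] by simp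
    finally show ?thesis .
  qed
  define \<phi> where "\<phi> s = real_of_int n * s + 2 * t * cos s" for s
  let ?f = "\<lambda>s. cis (\<phi> s)"
  have d1: "(\<phi> has_real_derivative real_of_int n - 2 * t * sin x) (at x)" for x
    unfolding \<phi>_def[abs_def] by (auto intro!: derivative_eq_intros)
  have d2: "((\<lambda>x. real_of_int n - 2 * t * sin x) has_real_derivative - 2 * t * cos x) (at x)" for x
    by (auto intro!: derivative_eq_intros)
  have int: "?f integrable_on {a..b}" for a b
    unfolding \<phi>_def by (intro integrable_continuous_interval continuous_intros)
  have small: "cmod (integral {a..b} ?f) \<le> b - a" if "a \<le> b" for a b
  proof -
    have "cmod (integral {a..b} ?f) \<le> integral {a..b} (\<lambda>_. 1)"
      by (rule integral_norm_bound_integral) (auto intro: int)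
    then show ?thesis using that by simp
  qed
  have pi2: "pi / 2 \<ge> 1" using pi_ge_two by simp
  have mid1: "cmod (integral {- (pi / 2) + r..pi / 2 - r} ?f) \<le> 1 / \<mu> + (1 + \<mu>\<^sup>2 / \<mu>\<^sup>2) * (pi / \<mu>)"
  proof (rule van_der_corput_second[OF _ mu(1) _ d1 d2, where \<sigma> = "-1"])
    fix x assume x: "x \<in> {- (pi / 2) + r..pi / 2 - r}"
    have "cos x = cos \<bar>x\<bar>" by (simp add: abs_if)
    also have "\<dots> \<ge> cos (pi / 2 - r)" using x r pi2 by (intro cos_monotone_0_pi_le) auto
    also have "cos (pi / 2 - r) = sin r" by (simp add: cos_diff)
    finally have "cos x \<ge> r / 2" using sin_ge_half[of r] r by linarith
    then have "2 * t * cos x \<ge> 2 * t * (r / 2)" using t by (intro mult_left_mono) auto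
    then show "- 1 * (- 2 * t * cos x) \<ge> \<mu>\<^sup>2" using tr by simp
  qed (use r pi2 mu in auto)
  have mid2: "cmod (integral {pi / 2 + r..3 * pi / 2 - r} ?f) \<le> 1 / \<mu> + (1 + \<mu>\<^sup>2 / \<mu>\<^sup>2) * (pi / \<mu>)"
  proof (rule van_der_corput_second[OF _ mu(1) _ d1 d2, where \<sigma> = 1])
    fix x assume x: "x \<in> {pi / 2 + r..3 * pi / 2 - r}"
    have "- cos x = cos \<bar>x - pi\<bar>" by (simp add: abs_if cos_diff)
    also have "\<dots> \<ge> cos (pi / 2 - r)" using x r pi2 by (intro cos_monotone_0_pi_le) auto
    also have "cos (pi / 2 - r) = sin r" by (simp add: cos_diff)
    finally have "- cos x \<ge> r / 2" using sin_ge_half[of r] r by linarith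
    then have "2 * t * (- cos x) \<ge> 2 * t * (r / 2)" using t by (intro mult_left_mono) auto
    then show "1 * (- 2 * t * cos x) \<ge> \<mu>\<^sup>2" using tr by simp
  qed (use r pi2 mu in auto)
  define I1 I2 I3 I4 I5 where "I1 = integral {- (pi / 2)..- (pi / 2) + r} ?f"
    and "I2 = integral {- (pi / 2) + r..pi / 2 - r} ?f" and "I3 = integral {pi / 2 - r..pi / 2 + r} ?f"
    and "I4 = integral {pi / 2 + r..3 * pi / 2 - r} ?f" and "I5 = integral {3 * pi / 2 - r..3 * pi / 2} ?f"
  have split: "integral period ?f = I1 + (I2 + (I3 + (I4 + I5)))"
    unfolding I1_def I2_def I3_def I4_def I5_def
    using r pi2 int by (simp add: Henstock_Kurzweil_Integration.integral_combine)
  have m: "1 / \<mu> + (1 + \<mu>\<^sup>2 / \<mu>\<^sup>2) * (pi / \<mu>) = r + 2 * (pi * r)"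
    using mu by (simp flip: mu(2))
  have b1: "cmod I1 \<le> r" and b3: "cmod I3 \<le> 2 * r" and b5: "cmod I5 \<le> r"
    using small[of "- (pi / 2)" "- (pi / 2) + r"] small[of "pi / 2 - r" "pi / 2 + r"]
      small[of "3 * pi / 2 - r" "3 * pi / 2"] r
    unfolding I1_def I3_def I5_def by simp_all
  have b2: "cmod I2 \<le> r + 2 * (pi * r)" and b4: "cmod I4 \<le> r + 2 * (pi * r)"
    using mid1 mid2 unfolding m I2_def I4_def by simp_all
  have "cmod (integral period ?f) \<le> cmod I1 + (cmod I2 + (cmod I3 + (cmod I4 + cmod I5)))"
    unfolding split by (intro norm_triangle_le add_mono order_refl)
  \<comment> \<open>The excised intervals have total length \<open>4 * r\<close>; each of the two
    others gives \<open>r + 2 * pi * r\<close>.\<close>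
  then have tot: "cmod (integral period ?f) \<le> (6 + 4 * pi) * r"
    using b1 b2 b3 b4 b5 by (simp add: algebra_simps)
  have "(?f has_integral (2 * pi) *\<^sub>R (\<integral>s. ?f s \<partial>circle_measure)) period"
    by (rule circle_measure_has_integral[where B = 1]) (auto simp: \<phi>_def)
  from integral_unique[OF this]
  have "(2 * pi) * cmod (\<integral>s. ?f s \<partial>circle_measure) = cmod (integral period ?f)"
    by (simp only: norm_scaleR) simp
  also have "\<dots> \<le> (6 + 4 * pi) * r" by (rule tot)
  also have "\<dots> \<le> (8 * pi) * r" using pi2 r by (intro mult_right_mono) auto
  also have "\<dots> = (2 * pi) * (4 * r)" by simp
  finally show ?thesis unfolding r_def \<phi>_def by simp
qed

subsection \<open>Dispersive decay of the propagator\<close>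

text \<open>\<open>hsym\<close> is a sum over coordinates, so the kernel factorises into circle
  integrals.\<close>

lemma propagator_kernel_decay:
  fixes x :: "int ^ 'n"
  assumes t: "t > 0"
  shows "cmod (\<integral>\<xi>. cis (- (t * hsym \<xi>)) * ch x \<xi> \<partial>torus) \<le> (4 * t powr (-1/3)) ^ CARD('n)"
proof -
  let ?w = "\<lambda>j s. cis (- (2 * t)) * cis (real_of_int (x $ j) * s + 2 * t * cos s)"
  have "cis (- (t * hsym \<xi>)) * ch x \<xi> = (\<Prod>j\<in>UNIV. ?w j (\<xi> j))" for \<xi>
  proof -
    have "cis (\<Sum>j\<in>S. a j) = (\<Prod>j\<in>S. cis (a j))" if "finite S" for S and a :: "'n \<Rightarrow> real"
      using that by (induction S) (auto simp flip: cis_mult)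
    from this[of UNIV "\<lambda>j. - (t * (2 - 2 * cos (\<xi> j)))"]
    have "cis (- (t * hsym \<xi>)) = (\<Prod>j\<in>UNIV. cis (- (t * (2 - 2 * cos (\<xi> j)))))"
      unfolding hsym_def by (simp add: sum_distrib_left sum_negf)
    then show ?thesis
      unfolding ch_def by (simp add: prod.distrib[symmetric] cis_mult algebra_simps)
  qed
  then have "(\<integral>\<xi>. cis (- (t * hsym \<xi>)) * ch x \<xi> \<partial>torus) = (\<Prod>j\<in>UNIV. integral\<^sup>L circle_measure (?w j))"
    by (simp only:) (rule torus_integral_prod, auto intro!: integrable_circle_bounded[where B = 1] simp: norm_mult)
  then have "cmod (\<integral>\<xi>. cis (- (t * hsym \<xi>)) * ch x \<xi> \<partial>torus) = (\<Prod>j\<in>UNIV. cmod (integral\<^sup>L circle_measure (?w j)))"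
    by (simp add: prod_norm)
  also have "\<dots> \<le> (\<Prod>j\<in>(UNIV::'n set). 4 * t powr (-1/3))"
    using circle_integral_decay[OF t] by (intro prod_mono) (auto simp: norm_mult)
  finally show ?thesis by simp
qed

section \<open>Bounds on the propagator form for finitely supported data\<close>

abbreviation l2sum :: "'a set \<Rightarrow> ('a \<Rightarrow> complex) \<Rightarrow> real" where
  "l2sum E f \<equiv> sqrt (\<Sum>x\<in>E. (cmod (f x))\<^sup>2)"

text \<open>For \<open>\<Psi> = trig E f * cnj (trig E' g)\<close> this is the form of
  \<open>exp (-i t H0)\<close>. A general \<open>\<Psi>\<close> is kept because passing from time
  decay to the resolvent uses only its boundedness and the size of this function of
  \<open>t\<close>.\<close>

definition prop_form :: "real \<Rightarrow> (('n::finite \<Rightarrow> real) \<Rightarrow> complex) \<Rightarrow> complex" where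
  "prop_form t \<Psi> = (\<integral>\<xi>. cis (- (t * hsym \<xi>)) * \<Psi> \<xi> \<partial>torus)"

lemma bounded_meas_cis_hsym: "bounded_meas (\<lambda>\<xi>::'n::finite \<Rightarrow> real. cis (- (t * hsym \<xi>)))"
proof -
  have [measurable]: "(hsym :: ('n \<Rightarrow> real) \<Rightarrow> real) \<in> borel_measurable torus"
    by (rule conjunct1[OF bounded_meas_hsym[unfolded bounded_meas_def]])
  show ?thesis by (auto simp: bounded_meas_def intro!: exI[of _ 1])
qed

lemma prop_form_le_l2:
  assumes "finite E" "finite E'"
  shows "cmod (prop_form t (\<lambda>\<xi>. trig E f \<xi> * cnj (trig E' g \<xi>))) \<le> l2sum E f * l2sum E' g"
proof -
  have "cmod (prop_form t (\<lambda>\<xi>. trig E f \<xi> * cnj (trig E' g \<xi>))) = cmod (\<integral>\<xi>. (cis (- (t * hsym \<xi>)) * trig E f \<xi>) * cnj (trig E' g \<xi>) \<partial>torus)"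
    by (simp add: prop_form_def mult.assoc)
  also have "\<dots> \<le> sqrt (\<integral>\<xi>. (cmod (cis (- (t * hsym \<xi>)) * trig E f \<xi>))\<^sup>2 \<partial>torus) * sqrt (\<integral>\<xi>. (cmod (trig E' g \<xi>))\<^sup>2 \<partial>torus)"
    by (intro torus_integral_cauchy_schwarz bounded_meas_intros bounded_meas_cis_hsym bounded_meas_trig)
  also have "\<dots> = l2sum E f * l2sum E' g"
    using assms by (simp add: norm_mult trig_parseval_norm)
  finally show ?thesis .
qed

lemma sum_norm_le_card_l2:
  assumes "finite E"
  shows "(\<Sum>x\<in>E. cmod (f x)) \<le> sqrt (real (card E)) * l2sum E f"
proof -
  have "(\<Sum>x\<in>E. cmod (f x))\<^sup>2 \<le> (\<Sum>x\<in>E. 1\<^sup>2) * (\<Sum>x\<in>E. (cmod (f x))\<^sup>2)"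
    using Cauchy_Schwarz_ineq_sum[of "\<lambda>_. 1" "\<lambda>x. cmod (f x)" E] by simp
  then have "\<bar>\<Sum>x\<in>E. cmod (f x)\<bar> \<le> sqrt (real (card E) * (\<Sum>x\<in>E. (cmod (f x))\<^sup>2))"
    by (intro real_le_rsqrt) simp
  then show ?thesis by (simp add: real_sqrt_mult)
qed

text \<open>The kernel bound estimates the form by a product of l1 norms, and on a finite set the l1
  norm costs the square root of the cardinality.\<close>

lemma prop_form_le_card:
  fixes f g :: "int ^ 'n \<Rightarrow> complex"
  assumes t: "t > 0" and E: "finite E" "finite E'"
  shows "cmod (prop_form t (\<lambda>\<xi>. trig E f \<xi> * cnj (trig E' g \<xi>)))
    \<le> (4 * t powr (-1/3)) ^ CARD('n) * (sqrt (real (card E)) * sqrt (real (card E'))) * (l2sum E f * l2sum E' g)"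
proof -
  let ?k = "(4 * t powr (-1/3)) ^ CARD('n)"
  let ?K = "\<lambda>x. \<integral>\<xi>. cis (- (t * hsym \<xi>)) * ch x \<xi> \<partial>torus"
  have "prop_form t (\<lambda>\<xi>. trig E f \<xi> * cnj (trig E' g \<xi>))
     = (\<integral>\<xi>. (\<Sum>x\<in>E. \<Sum>y\<in>E'. f x * cnj (g y) * (cis (- (t * hsym \<xi>)) * ch (x - y) \<xi>)) \<partial>torus)"
    unfolding prop_form_def
  proof (intro Bochner_Integration.integral_cong refl)
    fix \<xi> :: "'n \<Rightarrow> real"
    have "ch (x - y) \<xi> = ch x \<xi> * cnj (ch y \<xi>)" for x y :: "int ^ 'n"
      by (simp add: cnj_ch flip: ch_add)
    then show "cis (- (t * hsym \<xi>)) * (trig E f \<xi> * cnj (trig E' g \<xi>))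
       = (\<Sum>x\<in>E. \<Sum>y\<in>E'. f x * cnj (g y) * (cis (- (t * hsym \<xi>)) * ch (x - y) \<xi>))"
      unfolding trig_def cnj_sum unfolding sum_product unfolding sum_distrib_left by (simp add: ac_simps)
  qed
  also have "\<dots> = (\<Sum>x\<in>E. \<Sum>y\<in>E'. f x * cnj (g y) * ?K (x - y))"
    by (subst Bochner_Integration.integral_sum Bochner_Integration.integral_mult_right_zero;
      (intro bounded_meas_integrable bounded_meas_intros bounded_meas_ch bounded_meas_cis_hsym)?)+ (rule refl)
  finally have "cmod (prop_form t (\<lambda>\<xi>. trig E f \<xi> * cnj (trig E' g \<xi>))) \<le> (\<Sum>x\<in>E. \<Sum>y\<in>E'. cmod (f x) * cmod (g y) * ?k)"
    by (simp only:) (intro sum_norm_le, simp only: norm_mult complex_mod_cnj,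
        intro mult_left_mono propagator_kernel_decay t mult_nonneg_nonneg norm_ge_zero)
  also have "\<dots> = ?k * ((\<Sum>x\<in>E. cmod (f x)) * (\<Sum>y\<in>E'. cmod (g y)))"
    unfolding sum_product unfolding sum_distrib_left by (simp only: mult.commute mult.left_commute)
  also have "\<dots> \<le> ?k * ((sqrt (real (card E)) * l2sum E f) * (sqrt (real (card E')) * l2sum E' g))"
    using E by (intro mult_left_mono mult_mono sum_norm_le_card_l2 sum_nonneg mult_nonneg_nonneg)
      (auto intro!: sum_nonneg zero_le_power)
  finally show ?thesis by (simp only: ac_simps)
qed

text \<open>Only the exponent \<open>4/3 \<le> d/3\<close> matters once time is measured in units of \<open>L\<close>.\<close>

lemma prop_form_decay:
  fixes f g :: "int ^ 'n \<Rightarrow> complex"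
  assumes d: "CARD('n) \<ge> 4" and E: "finite E" "finite E'" and AB: "A > 0" "B > 0"
    and card: "real (card E) \<le> A powr (real CARD('n) / 3)" "real (card E') \<le> B powr (real CARD('n) / 3)"
    and t: "t \<ge> 0"
  defines "L \<equiv> 64 * sqrt (A * B)"
  shows "cmod (prop_form t (\<lambda>\<xi>. trig E f \<xi> * cnj (trig E' g \<xi>)))
    \<le> 4 * (l2sum E f * l2sum E' g) * (1 + t / L) powr (- 1 - 1/3)"
proof -
  let ?n = "l2sum E f * l2sum E' g"
  have n: "?n \<ge> 0" by (intro mult_nonneg_nonneg) (auto intro: sum_nonneg)
  have L: "L > 0" using AB by (simp add: L_def)
  have t1: "1 + t / L > 0" using t L by (simp add: add_pos_nonneg)
  show ?thesis
  proof (cases "t \<le> L")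
    case True
    have "1 \<le> 4 * (1 + t / L) powr (- 1 - 1/3)"
    proof -
      have "1 / 4 = (2::real) powr (-2)" by (simp add: powr_minus_divide powr_numeral)
      also have "\<dots> \<le> 2 powr (- 1 - 1/3)" by (intro powr_mono) auto
      also have "\<dots> \<le> (1 + t / L) powr (- 1 - 1/3)"
        using True t1 L by (intro powr_mono2') auto
      finally show ?thesis by simp
    qed
    from mult_left_mono[OF this n] prop_form_le_l2[OF E, of t f g] show ?thesis by simp
  next
    case False
    then have tp: "t > 0" using L by linarith
    let ?e = "real CARD('n) / 3"
    \<comment> \<open>As \<open>64 = 4 ^ 3\<close>, the constant of the kernel bound is a rescaling
      of time; this is the \<open>64\<close> in \<open>L\<close>.\<close>
    have k: "(4 * t powr (-1/3)) ^ CARD('n) = (64 / t) powr ?e"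
    proof -
      have "(64::real) powr (1/3) = (4 ^ 3) powr (1/3)" by simp
      also have "\<dots> = (4 powr 3) powr (1/3)" by (subst powr_numeral) auto
      also have "\<dots> = 4" by (simp add: powr_powr)
      finally have "(64::real) powr (1/3) = 4" .
      then have c: "4 * t powr (-1/3) = (64 / t) powr (1/3)"
        using tp by (simp add: powr_divide powr_minus_divide)
      have "((64 / t) powr (1/3)) ^ CARD('n) = ((64 / t) powr (1/3)) powr real CARD('n)"
        using tp by (intro powr_realpow[symmetric]) simp
      then show ?thesis unfolding c by (simp add: powr_powr)
    qed
    have c: "sqrt (real (card E)) * sqrt (real (card E')) \<le> sqrt (A * B) powr ?e"
    proof -
      have "sqrt (real (card E)) * sqrt (real (card E')) \<le> sqrt (A powr ?e) * sqrt (B powr ?e)"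
        using card by (intro mult_mono) auto
      also have "\<dots> = sqrt (A * B) powr ?e"
        using AB by (simp add: powr_mult powr_half_sqrt[symmetric] powr_powr mult.commute)
      finally show ?thesis .
    qed
    have "cmod (prop_form t (\<lambda>\<xi>. trig E f \<xi> * cnj (trig E' g \<xi>)))
       \<le> (64 / t) powr ?e * (sqrt (real (card E)) * sqrt (real (card E'))) * ?n"
      using prop_form_le_card[OF tp E, of f g] unfolding k .
    also have "\<dots> \<le> (64 / t) powr ?e * (sqrt (A * B) powr ?e) * ?n"
      by (intro mult_right_mono mult_left_mono c n) auto
    also have "(64 / t) powr ?e * (sqrt (A * B) powr ?e) = (L / t) powr ?e"
      using tp AB by (simp add: L_def powr_mult[symmetric])
    also have "(L / t) powr ?e * ?n \<le> (4 * (1 + t / L) powr (- 1 - 1/3)) * ?n"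
    proof (intro mult_right_mono n)
      have "(L / t) powr ?e \<le> (L / t) powr (1 + 1/3)"
        using d L tp False by (intro powr_mono') auto
      also have "\<dots> \<le> (2 / (1 + t / L)) powr (1 + 1/3)"
        using L tp False by (intro powr_mono2) (auto simp: field_simps)
      also have "\<dots> = 2 powr (1 + 1/3) * (1 + t / L) powr (- (1 + 1/3))"
        using t1 by (simp add: powr_divide powr_minus_divide)
      also have "\<dots> \<le> 4 * (1 + t / L) powr (- (1 + 1/3))"
      proof (intro mult_right_mono)
        have "(2::real) powr (1 + 1/3) \<le> 2 powr 2" by (intro powr_mono) auto
        then show "(2::real) powr (1 + 1/3) \<le> 4" by (simp add: powr_numeral)
      qed auto
      finally show "(L / t) powr ?e \<le> 4 * (1 + t / L) powr (- 1 - 1/3)" by simp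
    qed
    finally show ?thesis by (simp add: ac_simps)
  qed
qed

subsection \<open>From decay in time to bounds on the resolvent\<close>

text \<open>Up to the factor \<open>\<i>\<close>, the part from time \<open>T\<close> to infinity of
  the integral of \<open>exp (\<i> * t * z) * prop_form t \<Psi>\<close>, in closed form. Its value
  at \<open>0\<close> is the resolvent form, it vanishes at infinity, and its derivative carries no
  resolvent any more. Comparing derivatives thus replaces improper integrals.\<close>

definition flow :: "complex \<Rightarrow> (('n::finite \<Rightarrow> real) \<Rightarrow> complex) \<Rightarrow> real \<Rightarrow> complex" where
  "flow z \<Psi> T = (\<integral>\<xi>. exp (of_real T * (\<i> * (z - of_real (hsym \<xi>)))) * (\<Psi> \<xi> / (of_real (hsym \<xi>) - z)) \<partial>torus)"

lemma norm_exp_flow: "cmod (exp (of_real T * (\<i> * (z - of_real h)))) = exp (- (T * Im z))"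
  by simp

lemma bounded_meas_exp_flow:
  "bounded_meas (\<lambda>\<xi>::'n::finite \<Rightarrow> real. exp (of_real T * (\<i> * (z - of_real (hsym \<xi>)))))"
proof -
  have [measurable]: "(hsym :: ('n \<Rightarrow> real) \<Rightarrow> real) \<in> borel_measurable torus"
    by (rule conjunct1[OF bounded_meas_hsym[unfolded bounded_meas_def]])
  show ?thesis unfolding bounded_meas_def norm_exp_flow by (intro conjI exI[of _ "exp (- (T * Im z))"]) auto
qed

lemma flow_0: "flow z \<Psi> 0 = (\<integral>\<xi>. \<Psi> \<xi> / (of_real (hsym \<xi>) - z) \<partial>torus)"
  by (simp add: flow_def)

lemma flow_tendsto_0:
  assumes z: "Im z > 0" and \<Psi>: "bounded_meas \<Psi>"
  shows "(flow z \<Psi> \<longlongrightarrow> 0) at_top"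
proof (rule Lim_null_comparison)
  define K where "K = (\<integral>\<xi>. cmod (\<Psi> \<xi> / (of_real (hsym \<xi>) - z)) \<partial>torus)"
  have "cmod (flow z \<Psi> T) \<le> exp (- (T * Im z)) * K" for T
    unfolding flow_def K_def
    by (rule order_trans[OF integral_norm_bound]) (simp only: norm_mult norm_exp_flow Bochner_Integration.integral_mult_right_zero order_refl)
  then show "\<forall>\<^sub>F T in at_top. cmod (flow z \<Psi> T) \<le> exp (- (T * Im z)) * K" by simp
  have "((\<lambda>T. exp (- (T * Im z))) \<longlongrightarrow> 0) at_top"
    using z by (intro filterlim_compose[OF exp_at_bot])
      (auto intro!: filterlim_tendsto_pos_mult_at_bot simp: filterlim_uminus_at_bot
        filterlim_at_top_mult_tendsto_pos[OF tendsto_const _ filterlim_ident] mult.commute)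
  then show "((\<lambda>T. exp (- (T * Im z)) * K) \<longlongrightarrow> 0) at_top"
    using tendsto_mult_left_zero by blast
qed

lemma flow_derivative:
  fixes \<Psi> :: "('n::finite \<Rightarrow> real) \<Rightarrow> complex"
  assumes z: "Im z > 0" and \<Psi>: "bounded_meas \<Psi>"
  shows "(flow z \<Psi> has_vector_derivative - \<i> * exp (\<i> * of_real T * z) * prop_form T \<Psi>) (at T)"
proof -
  define w where "w \<xi> = \<i> * (z - of_real (hsym \<xi>))" for \<xi> :: "'n \<Rightarrow> real"
  define \<Theta> where "\<Theta> \<xi> = \<Psi> \<xi> / (of_real (hsym \<xi>) - z)" for \<xi>
  have bw: "bounded_meas w"
  proof -
    have "bounded_meas (\<lambda>\<xi>. w \<xi>)" unfolding w_def by (intro bounded_meas_intros bounded_meas_hsym)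
    then show ?thesis by simp
  qed
  have b\<Theta>: "bounded_meas \<Theta>"
    using bounded_meas_div_hsym[OF \<Psi>, of z] z unfolding \<Theta>_def[abs_def] by auto
  have be: "bounded_meas (\<lambda>\<xi>. exp (of_real T * w \<xi>))" for T
    unfolding w_def by (rule bounded_meas_exp_flow)
  note I = bounded_meas_integrable bounded_meas_intros bw b\<Theta> be
  obtain W where W: "\<And>\<xi>. cmod (w \<xi>) \<le> W" using bw by (auto simp: bounded_meas_def)
  have W0: "W \<ge> 0" using order_trans[OF norm_ge_zero W] by simp
  define D where "D = (\<integral>\<xi>. exp (of_real T * w \<xi>) * (w \<xi> * \<Theta> \<xi>) \<partial>torus)"
  define K where "K = exp W * W\<^sup>2 * (\<integral>\<xi>. cmod (exp (of_real T * w \<xi>) * \<Theta> \<xi>) \<partial>torus)"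
  have G: "flow z \<Psi> S = (\<integral>\<xi>. exp (of_real S * w \<xi>) * \<Theta> \<xi> \<partial>torus)" for S
    unfolding flow_def w_def \<Theta>_def ..
  have quad: "cmod (flow z \<Psi> (T + h) - flow z \<Psi> T - h *\<^sub>R D) \<le> K * h\<^sup>2" if h: "\<bar>h\<bar> \<le> 1" for h
  proof -
    have "flow z \<Psi> (T + h) - flow z \<Psi> T - h *\<^sub>R D = (\<integral>\<xi>. exp (of_real (T + h) * w \<xi>) * \<Theta> \<xi> - exp (of_real T * w \<xi>) * \<Theta> \<xi> - of_real h * (exp (of_real T * w \<xi>) * (w \<xi> * \<Theta> \<xi>)) \<partial>torus)"
      unfolding G D_def scaleR_conv_of_real
      by (subst Bochner_Integration.integral_diff Bochner_Integration.integral_mult_right_zero; (intro I)?)+ (rule refl)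
    also have "\<dots> = (\<integral>\<xi>. (exp (of_real T * w \<xi>) * \<Theta> \<xi>) * (exp (of_real h * w \<xi>) - 1 - of_real h * w \<xi>) \<partial>torus)"
      by (intro Bochner_Integration.integral_cong refl) (simp add: exp_add distrib_right algebra_simps)
    finally have "cmod (flow z \<Psi> (T + h) - flow z \<Psi> T - h *\<^sub>R D)
       \<le> (\<integral>\<xi>. cmod ((exp (of_real T * w \<xi>) * \<Theta> \<xi>) * (exp (of_real h * w \<xi>) - 1 - of_real h * w \<xi>)) \<partial>torus)"
      by (simp only: integral_norm_bound)
    also have "\<dots> \<le> (\<integral>\<xi>. (exp W * W\<^sup>2 * h\<^sup>2) * cmod (exp (of_real T * w \<xi>) * \<Theta> \<xi>) \<partial>torus)"
    proof (rule integral_mono)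
      fix \<xi> :: "'n \<Rightarrow> real"
      let ?a = "of_real h * w \<xi>"
      have aW: "cmod ?a \<le> \<bar>h\<bar> * W" using W[of \<xi>] by (simp add: norm_mult mult_left_mono)
      also have "\<dots> \<le> 1 * W" using h W0 by (intro mult_right_mono) auto
      finally have aW': "cmod ?a \<le> W" by simp
      have "cmod (exp ?a - 1 - ?a) \<le> exp \<bar>Re ?a\<bar> * (cmod ?a)\<^sup>2"
        using Taylor_exp[of ?a 1] by (simp add: power2_eq_square diff_diff_eq)
      also have "\<dots> \<le> exp W * (\<bar>h\<bar> * W)\<^sup>2"
        using aW aW' abs_Re_le_cmod[of ?a] by (intro mult_mono power_mono) auto
      finally have "cmod (exp ?a - 1 - ?a) \<le> exp W * W\<^sup>2 * h\<^sup>2" by (simp add: power_mult_distrib ac_simps)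
      then show "cmod ((exp (of_real T * w \<xi>) * \<Theta> \<xi>) * (exp ?a - 1 - ?a)) \<le> (exp W * W\<^sup>2 * h\<^sup>2) * cmod (exp (of_real T * w \<xi>) * \<Theta> \<xi>)"
        unfolding norm_mult[of "exp (of_real T * w \<xi>) * \<Theta> \<xi>"] by (subst mult.commute) (intro mult_right_mono norm_ge_zero)
    qed (intro I)+
    also have "\<dots> = K * h\<^sup>2" unfolding K_def by simp
    finally show ?thesis .
  qed
  have D: "D = - \<i> * exp (\<i> * of_real T * z) * prop_form T \<Psi>"
  proof -
    have "exp (of_real T * w \<xi>) * (w \<xi> * \<Theta> \<xi>) = - \<i> * exp (\<i> * of_real T * z) * (cis (- (T * hsym \<xi>)) * \<Psi> \<xi>)" for \<xi>
    proof -
      have "of_real (hsym \<xi>) - z \<noteq> 0" using z by (auto simp: complex_eq_iff)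
      then have "w \<xi> * \<Theta> \<xi> = - \<i> * \<Psi> \<xi>"
        unfolding w_def \<Theta>_def by (simp add: field_simps)
      moreover have "exp (of_real T * w \<xi>) = exp (\<i> * of_real T * z) * cis (- (T * hsym \<xi>))"
        unfolding w_def cis_conv_exp exp_add[symmetric] by (simp add: algebra_simps)
      ultimately show ?thesis by simp
    qed
    then show ?thesis unfolding D_def prop_form_def by (simp only: Bochner_Integration.integral_mult_right_zero)
  qed
  have "(flow z \<Psi> has_vector_derivative D) (at T)"
    unfolding has_vector_derivative_def has_derivative_at
  proof (intro conjI)
    show "bounded_linear (\<lambda>x. x *\<^sub>R D)" by (rule bounded_linear_scaleR_left)
    have "(\<lambda>h. K * \<bar>h\<bar>) \<midarrow>0\<rightarrow> K * \<bar>0\<bar>" by (intro tendsto_intros)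
    then have lim: "(\<lambda>h. K * \<bar>h\<bar>) \<midarrow>0\<rightarrow> 0" by simp
    show "(\<lambda>h. norm (flow z \<Psi> (T + h) - flow z \<Psi> T - h *\<^sub>R D) / norm h) \<midarrow>0\<rightarrow> 0"
    proof (rule Lim_null_comparison[OF _ lim])
      have *: "norm (norm (flow z \<Psi> (T + h) - flow z \<Psi> T - h *\<^sub>R D) / norm h) \<le> K * \<bar>h\<bar>" if "h \<noteq> 0" "\<bar>h\<bar> \<le> 1" for h
      proof -
        have "cmod (flow z \<Psi> (T + h) - flow z \<Psi> T - h *\<^sub>R D) / \<bar>h\<bar> \<le> K * h\<^sup>2 / \<bar>h\<bar>"
          using quad[OF that(2)] by (intro divide_right_mono) auto
        also have "\<dots> = K * \<bar>h\<bar>" using that by (simp add: power2_eq_square abs_if)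
        finally show ?thesis by simp
      qed
      show "\<forall>\<^sub>F h in at 0. norm (norm (flow z \<Psi> (T + h) - flow z \<Psi> T - h *\<^sub>R D) / norm h) \<le> K * \<bar>h\<bar>"
        unfolding eventually_at by (intro exI[of _ 1] conjI ballI impI *) (auto simp: dist_real_def)
    qed
  qed
  then show ?thesis unfolding D .
qed

text \<open>Comparison with the antiderivative \<open>\<Phi>\<close> of the derivative bound, whose
  total increase over the half line is at most \<open>c * L / a\<close>.\<close>

lemma bound_by_decaying_derivative:
  fixes G :: "real \<Rightarrow> complex"
  assumes G: "\<And>t. (G has_vector_derivative G' t) (at t)"
    and bd: "\<And>t. t > 0 \<Longrightarrow> cmod (G' t) \<le> c * (1 + t / L) powr (- 1 - a)"
    and lim: "(G \<longlongrightarrow> 0) at_top" and L: "L > 0" and a: "a > 0" and c: "c \<ge> 0"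
  shows "cmod (G 0) \<le> c * L / a"
proof (rule tendsto_upperbound)
  show "((\<lambda>T. cmod (G T - G 0)) \<longlongrightarrow> cmod (G 0)) at_top"
    using tendsto_norm[OF tendsto_diff[OF lim tendsto_const[of "G 0"]]] by simp
  define \<Phi> where "\<Phi> t = - (c * L / a) * (1 + t / L) powr (- a)" for t
  have d\<Phi>: "(\<Phi> has_real_derivative c * (1 + t / L) powr (- 1 - a)) (at t)" if "t \<ge> 0" for t
  proof -
    have pos: "1 + t / L > 0" using that L by (simp add: add_pos_nonneg)
    have "((\<lambda>t. 1 + t / L) has_real_derivative 1 / L) (at t)"
      using L by (auto intro!: derivative_eq_intros)
    from DERIV_chain2[where f = "\<lambda>z. z powr (- a)" and g = "\<lambda>t. 1 + t / L", OF has_real_derivative_powr[OF pos] this]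
    have "((\<lambda>t. (1 + t / L) powr (- a)) has_real_derivative - a * (1 + t / L) powr (- a - 1) * (1 / L)) (at t)" .
    from DERIV_cmult[OF this, of "- (c * L / a)"]
    have "(\<Phi> has_real_derivative c * (1 + t / L) powr (- a - 1)) (at t)"
      unfolding \<Phi>_def[abs_def] using L a by (simp add: algebra_simps)
    moreover have "- a - 1 = - 1 - a" by simp
    ultimately show ?thesis by (simp only:)
  qed
  have "cmod (G T - G 0) \<le> c * L / a" if T: "T > 0" for T
  proof -
    have "cmod (G T - G 0) \<le> \<Phi> T - \<Phi> 0"
    proof (rule differentiable_bound_general[OF T])
      show "continuous_on {0..T} G"
        using G by (meson continuous_at_imp_continuous_on has_vector_derivative_continuous)
      show "continuous_on {0..T} \<Phi>"
        by (intro continuous_at_imp_continuous_on ballI DERIV_isCont[OF d\<Phi>]) auto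
      show "(\<Phi> has_vector_derivative c * (1 + t / L) powr (- 1 - a)) (at t)" if "0 < t" for t
        using d\<Phi>[of t] that by (simp add: has_real_derivative_iff_has_vector_derivative)
    qed (use G bd in auto)
    also have "\<dots> \<le> c * L / a"
      unfolding \<Phi>_def using L a c by (simp add: mult_nonneg_nonneg divide_nonneg_pos)
    finally show ?thesis .
  qed
  then show "\<forall>\<^sub>F T in at_top. cmod (G T - G 0) \<le> c * L / a"
    by (auto intro: eventually_mono[OF eventually_gt_at_top[of 0]])
qed simp

lemma resolvent_le_of_decay:
  fixes \<Psi> :: "('n::finite \<Rightarrow> real) \<Rightarrow> complex"
  assumes z: "Im z > 0" and \<Psi>: "bounded_meas \<Psi>" and L: "L > 0" and c: "c \<ge> 0"
    and dec: "\<And>t. t \<ge> 0 \<Longrightarrow> cmod (prop_form t \<Psi>) \<le> c * (1 + t / L) powr (- 1 - 1/3)"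
  shows "cmod (\<integral>\<xi>. \<Psi> \<xi> / (of_real (hsym \<xi>) - z) \<partial>torus) \<le> 3 * c * L"
proof -
  have "cmod (flow z \<Psi> 0) \<le> c * L / (1/3)"
  proof (rule bound_by_decaying_derivative[OF flow_derivative[OF z \<Psi>] _ flow_tendsto_0[OF z \<Psi>] L _ c])
    fix t :: real assume t: "t > 0"
    have "cmod (- \<i> * exp (\<i> * of_real t * z) * prop_form t \<Psi>) = exp (- (t * Im z)) * cmod (prop_form t \<Psi>)"
      by (simp add: norm_mult)
    also have "\<dots> \<le> 1 * cmod (prop_form t \<Psi>)"
      using t z by (intro mult_right_mono) auto
    also have "\<dots> \<le> c * (1 + t / L) powr (- 1 - 1/3)" using dec[of t] t by simp
    finally show "cmod (- \<i> * exp (\<i> * of_real t * z) * prop_form t \<Psi>) \<le> c * (1 + t / L) powr (- 1 - 1/3)" .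
  qed simp
  then show ?thesis by (simp add: flow_0)
qed

text \<open>Moving \<open>z\<close> by \<open>\<i> / S\<close> damps the propagator by
  \<open>exp (- (t / S))\<close>, so the difference carries \<open>1 - exp (- (t / S))\<close>,
  which is at most \<open>min 1 (t / S)\<close> and hence at most \<open>(t / S) powr (1/6)\<close>.
  This spends half of the surplus decay \<open>1/3\<close>; the other half keeps the time integral
  finite and gives the factor \<open>6\<close>.\<close>

lemma resolvent_diff_le_of_decay:
  fixes \<Psi> :: "('n::finite \<Rightarrow> real) \<Rightarrow> complex"
  assumes z: "Im z > 0" and \<Psi>: "bounded_meas \<Psi>" and L: "L > 0" and c: "c \<ge> 0" and S: "S > 0"
    and dec: "\<And>t. t \<ge> 0 \<Longrightarrow> cmod (prop_form t \<Psi>) \<le> c * (1 + t / L) powr (- 1 - 1/3)"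
  shows "cmod ((\<integral>\<xi>. \<Psi> \<xi> / (of_real (hsym \<xi>) - z) \<partial>torus)
      - (\<integral>\<xi>. \<Psi> \<xi> / (of_real (hsym \<xi>) - (z + \<i> / of_real S)) \<partial>torus)) \<le> 6 * c * L * (L / S) powr (1/6)"
proof -
  let ?z = "z + \<i> / of_real S"
  have imz: "Im ?z = Im z + 1 / S" by (simp add: Im_divide_of_real)
  have z': "Im ?z > 0" unfolding imz using z S by (simp add: add_pos_pos)
  let ?G = "\<lambda>T. flow z \<Psi> T - flow ?z \<Psi> T"
  have "cmod (?G 0) \<le> (c * (L / S) powr (1/6)) * L / (1/6)"
  proof (rule bound_by_decaying_derivative[OF has_vector_derivative_diff[OF flow_derivative[OF z \<Psi>] flow_derivative[OF z' \<Psi>]]])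
    show "(?G \<longlongrightarrow> 0) at_top"
      using tendsto_diff[OF flow_tendsto_0[OF z \<Psi>] flow_tendsto_0[OF z' \<Psi>]] by simp
    fix t :: real assume t: "t > 0"
    have pos: "1 + t / L > 0" using t L by (simp add: add_pos_pos)
    have e: "exp (\<i> * of_real t * ?z) = exp (\<i> * of_real t * z) * of_real (exp (- (t / S)))"
    proof -
      have "\<i> * of_real t * ?z = \<i> * of_real t * z + of_real (- (t / S))"
        unfolding distrib_left by (simp add: complex_eq_iff)
      then show ?thesis by (simp only: exp_add exp_of_real)
    qed
    have "- \<i> * exp (\<i> * of_real t * z) * prop_form t \<Psi> - - \<i> * exp (\<i> * of_real t * ?z) * prop_form t \<Psi>
        = - \<i> * exp (\<i> * of_real t * z) * of_real (1 - exp (- (t / S))) * prop_form t \<Psi>"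
      unfolding e by (simp add: algebra_simps)
    then have "cmod (- \<i> * exp (\<i> * of_real t * z) * prop_form t \<Psi> - - \<i> * exp (\<i> * of_real t * ?z) * prop_form t \<Psi>)
        = exp (- (t * Im z)) * \<bar>1 - exp (- (t / S))\<bar> * cmod (prop_form t \<Psi>)"
      by (simp only: norm_mult norm_of_real norm_minus_cancel norm_ii norm_exp_eq_Re) simp
    also have "\<dots> \<le> 1 * ((t / S) powr (1/6)) * (c * (1 + t / L) powr (- 1 - 1/3))"
    proof (intro mult_mono)
      have le1: "exp (- (t / S)) \<le> 1" using t S by simp
      have "1 + - (t / S) \<le> exp (- (t / S))" by (rule exp_ge_add_one_self)
      then have u: "1 - exp (- (t / S)) \<le> t / S" "1 - exp (- (t / S)) \<le> 1" by auto
      show "\<bar>1 - exp (- (t / S))\<bar> \<le> (t / S) powr (1/6)"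
      proof (cases "t / S \<le> 1")
        case True
        have "t / S = (t / S) powr 1" using t S by simp
        also have "\<dots> \<le> (t / S) powr (1/6)" using True t S by (intro powr_mono') auto
        finally show ?thesis using u le1 by simp
      next
        case False
        have "1 \<le> (t / S) powr (1/6)" using False by (intro ge_one_powr_ge_zero) auto
        then show ?thesis unfolding abs_of_nonneg[OF diff_ge_0_iff_ge[THEN iffD2, OF le1]] using u(2) by linarith
      qed
      show "exp (- (t * Im z)) \<le> 1" using t z by simp
      show "cmod (prop_form t \<Psi>) \<le> c * (1 + t / L) powr (- 1 - 1/3)" using dec[of t] t by simp
    qed auto
    also have "\<dots> \<le> c * (L / S) powr (1/6) * (1 + t / L) powr (- 1 - 1/6)"
    proof -
      have "(t / S) powr (1/6) = (L / S) powr (1/6) * (t / L) powr (1/6)"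
        using t S L by (simp add: powr_mult[symmetric])
      also have "\<dots> \<le> (L / S) powr (1/6) * (1 + t / L) powr (1/6)"
        using t L by (intro mult_left_mono powr_mono2) auto
      finally have "(t / S) powr (1/6) * (c * (1 + t / L) powr (- 1 - 1/3))
          \<le> (L / S) powr (1/6) * (1 + t / L) powr (1/6) * (c * (1 + t / L) powr (- 1 - 1/3))"
        using c by (intro mult_right_mono) auto
      also have "\<dots> = c * (L / S) powr (1/6) * ((1 + t / L) powr (1/6) * (1 + t / L) powr (- 1 - 1/3))"
        by simp
      also have "(1 + t / L) powr (1/6) * (1 + t / L) powr (- 1 - 1/3) = (1 + t / L) powr (- 1 - 1/6)"
        unfolding powr_add[symmetric] by simp
      finally show ?thesis by simp
    qed
    finally show "cmod (- \<i> * exp (\<i> * of_real t * z) * prop_form t \<Psi> - - \<i> * exp (\<i> * of_real t * ?z) * prop_form t \<Psi>)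
       \<le> c * (L / S) powr (1/6) * (1 + t / L) powr (- 1 - 1/6)" .
  qed (use L c in auto)
  then show ?thesis by (simp add: flow_0 ac_simps)
qed

text \<open>\<open>S\<close> lies geometrically between \<open>sqrt (A * B)\<close> and \<open>max A B\<close>, which makes both the difference to the resolvent
  at \<open>z + i / S\<close> (long times) and the latter itself (short times) gain a power of \<open>min A B / max A B\<close>.\<close>

lemma resolvent_block_bound:
  fixes f g :: "int ^ 'n \<Rightarrow> complex"
  assumes z: "Im z > 0" and d: "CARD('n) \<ge> 4" and E: "finite E" "finite E'" and AB: "A > 0" "B > 0"
    and card: "real (card E) \<le> A powr (real CARD('n) / 3)" "real (card E') \<le> B powr (real CARD('n) / 3)"
  shows "cmod (\<integral>\<xi>. trig E f \<xi> * cnj (trig E' g \<xi>) / (of_real (hsym \<xi>) - z) \<partial>torus)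
    \<le> 3100 * sqrt (A * B) * (min A B / max A B) powr (1/24) * (l2sum E f * l2sum E' g)"
proof -
  let ?n = "l2sum E f * l2sum E' g"
  have n: "?n \<ge> 0" by (intro mult_nonneg_nonneg) (auto intro: sum_nonneg)
  define a where "a = max A B"
  define \<rho> where "\<rho> = min A B / max A B"
  have a: "a > 0" and \<rho>: "0 < \<rho>" "\<rho> \<le> 1" using AB by (auto simp: a_def \<rho>_def)
  have mn: "min A B = a * \<rho>" using a by (simp add: a_def \<rho>_def)
  have AB': "A * B = a * a * \<rho>" 
  proof -
    have "A * B = max A B * min A B" by (auto simp: max_def min_def)
    then show ?thesis unfolding mn by (simp add: a_def)
  qed
  have m: "sqrt (A * B) = a * \<rho> powr (1/2)" unfolding AB' using a \<rho> by (simp add: real_sqrt_mult powr_half_sqrt)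
  define S where "S = a * \<rho> powr (1/4)"
  have S: "S > 0" using a \<rho> by (simp add: S_def)
  define L where "L = 64 * sqrt (A * B)"
  have L: "L > 0" using AB by (simp add: L_def)
  let ?z = "z + \<i> / of_real S"
  have z': "Im ?z = Im z + 1 / S" by (simp add: Im_divide_of_real)
  have z'0: "Im ?z > 0" unfolding z' using z S by (simp add: add_pos_pos)
  let ?D = "\<lambda>\<xi>::'n \<Rightarrow> real. of_real (hsym \<xi>) - ?z"
  have bm: "bounded_meas (\<lambda>\<xi>. trig X u \<xi> * cnj (trig Y v \<xi>))" for X Y and u v :: "int ^ 'n \<Rightarrow> complex"
    by (intro bounded_meas_intros bounded_meas_trig)
  have tail: "cmod ((\<integral>\<xi>. trig E f \<xi> * cnj (trig E' g \<xi>) / (of_real (hsym \<xi>) - z) \<partial>torus)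
      - (\<integral>\<xi>. trig E f \<xi> * cnj (trig E' g \<xi>) / ?D \<xi> \<partial>torus)) \<le> 6 * (4 * ?n) * L * (L / S) powr (1/6)"
    using n unfolding L_def
    by (intro resolvent_diff_le_of_decay z bm S prop_form_decay d E AB card) (use L in \<open>auto simp: L_def\<close>)
  \<comment> \<open>Since \<open>- Im (?D \<xi>)\<close> is at least \<open>1 / S\<close>, the
    squared norm of \<open>trig X u / ?D\<close> is at most \<open>S\<close> times the imaginary
    part of the diagonal form, which the decay estimate bounds;
    \<open>768 = 3 * 4 * 64\<close>.\<close>
  have quad: "sqrt (\<integral>\<xi>. (cmod (trig X u \<xi> / ?D \<xi>))\<^sup>2 \<partial>torus) \<le> sqrt (768 * Q * S) * l2sum X u"
    if X: "finite X" and Q: "Q > 0" "real (card X) \<le> Q powr (real CARD('n) / 3)" for X and u :: "int ^ 'n \<Rightarrow> complex" and Q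
  proof -
    let ?u2 = "\<lambda>\<xi>. trig X u \<xi> * cnj (trig X u \<xi>)"
    have bD: "bounded_meas (\<lambda>\<xi>. h \<xi> / ?D \<xi>)" if "bounded_meas h" for h
      by (rule bounded_meas_div_hsym[OF that]) (use z'0 in linarith)
    have "1 / S * (\<integral>\<xi>. (cmod (trig X u \<xi> / ?D \<xi>))\<^sup>2 \<partial>torus) = (\<integral>\<xi>. 1 / S * (cmod (trig X u \<xi> / ?D \<xi>))\<^sup>2 \<partial>torus)"
      by (rule Bochner_Integration.integral_mult_right_zero[symmetric])
    also have "\<dots> \<le> (\<integral>\<xi>. Im (?u2 \<xi> / ?D \<xi>) \<partial>torus)"
    proof (rule integral_mono)
      fix \<xi> :: "'n \<Rightarrow> real"
      have "Im (of_real w / D) = w * (- Im D) / (cmod D)\<^sup>2" for w and D :: complex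
        by (simp add: Im_divide cmod_power2)
      from this[of "(cmod (trig X u \<xi>))\<^sup>2" "?D \<xi>"]
      have "Im (?u2 \<xi> / ?D \<xi>) = (Im z + 1 / S) * (cmod (trig X u \<xi> / ?D \<xi>))\<^sup>2"
        unfolding complex_norm_square norm_divide power_divide using z' by (simp add: mult.commute)
      also have "\<dots> \<ge> 1 / S * (cmod (trig X u \<xi> / ?D \<xi>))\<^sup>2" using z by (intro mult_right_mono) auto
      finally show "1 / S * (cmod (trig X u \<xi> / ?D \<xi>))\<^sup>2 \<le> Im (?u2 \<xi> / ?D \<xi>)" .
    next
      show "integrable torus (\<lambda>\<xi>. Im (?u2 \<xi> / ?D \<xi>))"
        by (intro integrable_Im bounded_meas_integrable bD bm)
    qed (intro bounded_meas_integrable bounded_meas_intros bD bounded_meas_trig)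
    also have "\<dots> = Im (\<integral>\<xi>. ?u2 \<xi> / ?D \<xi> \<partial>torus)"
      by (intro integral_Im bounded_meas_integrable bD bm)
    also have "\<dots> \<le> cmod (\<integral>\<xi>. ?u2 \<xi> / ?D \<xi> \<partial>torus)"
      by (rule order_trans[OF abs_ge_self abs_Im_le_cmod])
    also have "\<dots> \<le> 3 * (4 * (l2sum X u * l2sum X u)) * (64 * sqrt (Q * Q))"
      using Q by (intro resolvent_le_of_decay z'0 bm prop_form_decay d X) auto
    also have "\<dots> = 768 * Q * (l2sum X u)\<^sup>2" using Q by (simp add: power2_eq_square)
    finally have "(\<integral>\<xi>. (cmod (trig X u \<xi> / ?D \<xi>))\<^sup>2 \<partial>torus) \<le> 768 * Q * S * (l2sum X u)\<^sup>2"
      using S by (simp add: field_simps)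
    then have "sqrt (\<integral>\<xi>. (cmod (trig X u \<xi> / ?D \<xi>))\<^sup>2 \<partial>torus) \<le> sqrt (768 * Q * S * (l2sum X u)\<^sup>2)"
      by (rule real_sqrt_le_mono)
    also have "\<dots> = sqrt (768 * Q * S) * l2sum X u"
      unfolding real_sqrt_mult[of "768 * Q * S"] by (simp add: sum_nonneg)
    finally show ?thesis .
  qed
  have bD: "bounded_meas (\<lambda>\<xi>. h \<xi> / ?D \<xi>)" if "bounded_meas h" for h
    by (rule bounded_meas_div_hsym[OF that]) (use z'0 in linarith)
  \<comment> \<open>Cauchy-Schwarz with the denominator attached to the function on the smaller set,
    so that \<open>quad\<close> contributes \<open>min A B\<close>.\<close>
  have head: "cmod (\<integral>\<xi>. trig E f \<xi> * cnj (trig E' g \<xi>) / ?D \<xi> \<partial>torus) \<le> sqrt (768 * min A B * S) * ?n"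
  proof (cases "A \<le> B")
    case True
    have "cmod (\<integral>\<xi>. trig E f \<xi> * cnj (trig E' g \<xi>) / ?D \<xi> \<partial>torus) = cmod (\<integral>\<xi>. (trig E f \<xi> / ?D \<xi>) * cnj (trig E' g \<xi>) \<partial>torus)"
      by simp
    also have "\<dots> \<le> sqrt (\<integral>\<xi>. (cmod (trig E f \<xi> / ?D \<xi>))\<^sup>2 \<partial>torus) * sqrt (\<integral>\<xi>. (cmod (trig E' g \<xi>))\<^sup>2 \<partial>torus)"
      by (intro torus_integral_cauchy_schwarz bounded_meas_trig bD)
    also have "\<dots> \<le> sqrt (768 * A * S) * l2sum E f * l2sum E' g"
      unfolding trig_parseval_norm[OF E(2)] using E AB card by (intro mult_right_mono quad) (auto intro: sum_nonneg)
    finally show ?thesis using True by (simp add: min_def)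
  next
    case False
    have "cmod (\<integral>\<xi>. trig E f \<xi> * cnj (trig E' g \<xi>) / ?D \<xi> \<partial>torus) = cmod (\<integral>\<xi>. trig E f \<xi> * cnj (trig E' g \<xi> / cnj (?D \<xi>)) \<partial>torus)"
      by simp
    also have "\<dots> \<le> sqrt (\<integral>\<xi>. (cmod (trig E f \<xi>))\<^sup>2 \<partial>torus) * sqrt (\<integral>\<xi>. (cmod (trig E' g \<xi> / cnj (?D \<xi>)))\<^sup>2 \<partial>torus)"
    proof (intro torus_integral_cauchy_schwarz bounded_meas_trig)
      have "bounded_meas (\<lambda>\<xi>. trig E' g \<xi> / (of_real (hsym \<xi>) - cnj ?z))"
        by (rule bounded_meas_div_hsym[OF bounded_meas_trig]) (use z'0 in simp)
      then show "bounded_meas (\<lambda>\<xi>. trig E' g \<xi> / cnj (?D \<xi>))" by simp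
    qed
    also have "(\<lambda>\<xi>. (cmod (trig E' g \<xi> / cnj (?D \<xi>)))\<^sup>2) = (\<lambda>\<xi>. (cmod (trig E' g \<xi> / ?D \<xi>))\<^sup>2)"
      by (simp only: norm_divide complex_mod_cnj)
    also have "sqrt (\<integral>\<xi>. (cmod (trig E f \<xi>))\<^sup>2 \<partial>torus) * sqrt (\<integral>\<xi>. (cmod (trig E' g \<xi> / ?D \<xi>))\<^sup>2 \<partial>torus)
        \<le> l2sum E f * (sqrt (768 * B * S) * l2sum E' g)"
      unfolding trig_parseval_norm[OF E(1)] using E AB card by (intro mult_left_mono quad) (auto intro: sum_nonneg)
    finally show ?thesis using False by (simp add: min_def ac_simps)
  qed
  \<comment> \<open>\<open>min A B * S\<close> equals \<open>a\<^sup>2 * \<rho> powr (5/4)\<close>,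
    whose root exceeds the target \<open>\<rho> powr (1/2)\<close> of \<open>sqrt (A * B)\<close> by
    the power \<open>1/8\<close>; that is weakened to \<open>1/24\<close>.\<close>
  have h1: "sqrt (768 * min A B * S) \<le> 28 * (sqrt (A * B) * \<rho> powr (1/24))"
  proof -
    have "min A B * S = a\<^sup>2 * (\<rho> * \<rho> powr (1/4))" unfolding mn S_def by (simp add: power2_eq_square)
    also have "\<rho> * \<rho> powr (1/4) = \<rho> powr (5/4)" using \<rho> powr_add[of \<rho> 1 "1/4"] by simp
    finally have e: "768 * min A B * S = 768 * (a\<^sup>2 * \<rho> powr (5/4))" by simp
    have "sqrt (768 * min A B * S) = sqrt 768 * (a * sqrt (\<rho> powr (5/4)))"
      unfolding e using a by (simp add: real_sqrt_mult)
    also have "sqrt (\<rho> powr (5/4)) = \<rho> powr (5/8)" using \<rho> by (simp add: powr_half_sqrt[symmetric] powr_powr)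
    also have "\<rho> powr (5/8) = \<rho> powr (1/2) * \<rho> powr (1/8)" unfolding powr_add[symmetric] by simp
    also have "sqrt 768 * (a * (\<rho> powr (1/2) * \<rho> powr (1/8))) \<le> 28 * (a * (\<rho> powr (1/2) * \<rho> powr (1/24)))"
    proof (intro mult_mono)
      show "sqrt 768 \<le> 28" by (rule real_le_lsqrt) auto
      show "\<rho> powr (1/8) \<le> \<rho> powr (1/24)" using \<rho> by (intro powr_mono') auto
    qed (use a in auto)
    finally show ?thesis unfolding m by simp
  qed
  \<comment> \<open>The origin of \<open>1/24\<close>: \<open>L / S\<close> is
    \<open>64 * \<rho> powr (1/4)\<close>, taken to the power \<open>1/6\<close>.\<close>
  have h2: "L * (L / S) powr (1/6) = 128 * (sqrt (A * B) * \<rho> powr (1/24))"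
  proof -
    have "L / S = 64 * (\<rho> powr (1/2) / \<rho> powr (1/4))" unfolding L_def m S_def using a by simp
    also have "\<rho> powr (1/2) / \<rho> powr (1/4) = \<rho> powr (1/4)" unfolding powr_diff[symmetric] by simp
    finally have "(L / S) powr (1/6) = 64 powr (1/6) * \<rho> powr (1/24)" using \<rho> by (simp add: powr_mult powr_powr)
    moreover have "(64::real) powr (1/6) = 2"
    proof -
      have "(64::real) powr (1/6) = (2 ^ 6) powr (1/6)" by simp
      also have "\<dots> = (2 powr 6) powr (1/6)" by (subst powr_numeral) auto
      finally show ?thesis by (simp add: powr_powr)
    qed
    ultimately show ?thesis by (simp add: L_def)
  qed
  let ?X = "\<integral>\<xi>. trig E f \<xi> * cnj (trig E' g \<xi>) / (of_real (hsym \<xi>) - z) \<partial>torus"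
  let ?Y = "\<integral>\<xi>. trig E f \<xi> * cnj (trig E' g \<xi>) / ?D \<xi> \<partial>torus"
  have "cmod ?X \<le> cmod (?X - ?Y) + cmod ?Y" using norm_triangle_ineq[of "?X - ?Y" ?Y] by simp
  also have "\<dots> \<le> 6 * (4 * ?n) * L * (L / S) powr (1/6) + sqrt (768 * min A B * S) * ?n"
    by (intro add_mono tail head)
  also have "\<dots> = 24 * (L * (L / S) powr (1/6)) * ?n + sqrt (768 * min A B * S) * ?n" by simp
  \<comment> \<open>The constant is \<open>24 * 128 + 28 = 3100\<close>.\<close>
  also have "\<dots> \<le> 24 * (128 * (sqrt (A * B) * \<rho> powr (1/24))) * ?n + 28 * (sqrt (A * B) * \<rho> powr (1/24)) * ?n"
    unfolding h2 using n by (intro add_left_mono mult_right_mono h1) auto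
  also have "\<dots> = 3100 * sqrt (A * B) * \<rho> powr (1/24) * ?n" by simp
  finally show ?thesis unfolding \<rho>_def .
qed

subsection \<open>Summation over the level sets of the potential\<close>

text \<open>\<open>max k l - min k l\<close> is the distance of \<open>k\<close> and
  \<open>l\<close> within the naturals. The sum is covered by two geometric series, with
  \<open>l = k\<close> counted in both when \<open>N > 0\<close>.\<close>

lemma sum_power_dist_le:
  fixes \<theta> :: real
  assumes \<theta>: "0 \<le> \<theta>" "\<theta> < 1"
  shows "(\<Sum>l<N. \<theta> ^ (max k l - min k l)) \<le> 2 / (1 - \<theta>)"
proof -
  have geo: "(\<Sum>i<M. \<theta> ^ i) \<le> 1 / (1 - \<theta>)" for M
    using \<theta> by (simp add: sum_gp_strict divide_right_mono)
  have "(\<Sum>l<N. \<theta> ^ (max k l - min k l)) \<le> (\<Sum>l\<in>{..<Suc k} \<union> {k..<k + N}. \<theta> ^ (max k l - min k l))"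
    using \<theta> by (intro sum_mono2) auto
  also have "\<dots> \<le> (\<Sum>l<Suc k. \<theta> ^ (max k l - min k l)) + (\<Sum>l\<in>{k..<k + N}. \<theta> ^ (max k l - min k l))"
  proof -
    let ?f = "\<lambda>l. \<theta> ^ (max k l - min k l)"
    have "sum ?f ({..<Suc k} \<union> {k..<k + N}) + sum ?f ({..<Suc k} \<inter> {k..<k + N}) = sum ?f {..<Suc k} + sum ?f {k..<k + N}"
      by (rule sum.union_inter) auto
    moreover have "sum ?f ({..<Suc k} \<inter> {k..<k + N}) \<ge> 0" using \<theta> by (intro sum_nonneg) auto
    ultimately show ?thesis by linarith
  qed
  also have "(\<Sum>l<Suc k. \<theta> ^ (max k l - min k l)) = (\<Sum>l<Suc k. \<theta> ^ (Suc k - Suc l))"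
    by (intro sum.cong) auto
  also have "\<dots> = (\<Sum>i<Suc k. \<theta> ^ i)" by (rule sum.nat_diff_reindex)
  also have "(\<Sum>l\<in>{k..<k + N}. \<theta> ^ (max k l - min k l)) = (\<Sum>i<N. \<theta> ^ i)"
    by (rule sum.reindex_bij_witness[of _ "\<lambda>i. i + k" "\<lambda>l. l - k"]) auto
  finally show ?thesis using geo[of "Suc k"] geo[of N] by simp
qed

lemma schur_test_power_dist:
  fixes a b :: "nat \<Rightarrow> real"
  assumes \<theta>: "0 \<le> \<theta>" "\<theta> < 1" and ab: "\<And>k. a k \<ge> 0" "\<And>k. b k \<ge> 0"
  shows "(\<Sum>k<N. \<Sum>l<N. \<theta> ^ (max k l - min k l) * (a k + b l)) \<le> 2 / (1 - \<theta>) * ((\<Sum>k<N. a k) + (\<Sum>k<N. b k))"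
proof -
  have "(\<Sum>k<N. \<Sum>l<N. \<theta> ^ (max k l - min k l) * (a k + b l))
     = (\<Sum>k<N. (\<Sum>l<N. \<theta> ^ (max k l - min k l)) * a k) + (\<Sum>k<N. \<Sum>l<N. \<theta> ^ (max k l - min k l) * b l)"
    by (simp add: distrib_left sum.distrib sum_distrib_right)
  also have "(\<Sum>k<N. \<Sum>l<N. \<theta> ^ (max k l - min k l) * b l) = (\<Sum>l<N. (\<Sum>k<N. \<theta> ^ (max l k - min l k)) * b l)"
    by (subst sum.swap) (simp add: sum_distrib_right max.commute min.commute)
  also have "(\<Sum>k<N. (\<Sum>l<N. \<theta> ^ (max k l - min k l)) * a k) + (\<Sum>l<N. (\<Sum>k<N. \<theta> ^ (max l k - min l k)) * b l)
     \<le> (\<Sum>k<N. 2 / (1 - \<theta>) * a k) + (\<Sum>l<N. 2 / (1 - \<theta>) * b l)"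
    by (intro add_mono sum_mono mult_right_mono sum_power_dist_le \<theta> ab)
  finally show ?thesis by (simp add: sum_distrib_left distrib_left)
qed

text \<open>On level \<open>k\<close> the potential is comparable to \<open>a / 2 ^ k\<close>, on at
  most \<open>(2 ^ k) powr (d / 3)\<close> points. The factor \<open>sqrt (A k * A l)\<close> of the
  block bound cancels exactly against these sizes, so blocks on the diagonal do not decay;
  summability rests on the extra power of \<open>min / max\<close>, which is geometric in the
  distance of the levels.\<close>

theorem weak_lp_uniform_bound:
  fixes V :: "int ^ 'n \<Rightarrow> real"
  assumes d: "CARD('n) \<ge> 4" and V: "weak_lp (real CARD('n) / 3) V"
  shows "uniform_resolvent_bound V"
proof -
  let ?p = "real CARD('n) / 3"
  obtain C0 where C0: "\<And>\<alpha>. \<alpha> > 0 \<Longrightarrow> \<alpha> * (real (card {x. \<bar>V x\<bar> > \<alpha>})) powr (1 / ?p) \<le> C0"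
    and fin: "\<And>\<alpha>. \<alpha> > 0 \<Longrightarrow> finite {x. \<bar>V x\<bar> > \<alpha>}"
    using V unfolding weak_lp_def by blast
  \<comment> \<open>\<open>C0\<close> may be zero, as for \<open>V = 0\<close>; the scale
    \<open>a\<close> has to be positive.\<close>
  define C where "C = max C0 1"
  have C: "C > 0" by (simp add: C_def)
  have CC: "\<alpha> * (real (card {x. \<bar>V x\<bar> > \<alpha>})) powr (1 / ?p) \<le> C" if "\<alpha> > 0" for \<alpha>
    unfolding C_def by (rule order_trans[OF C0[OF that] max.cobounded1])
  have card: "real (card {x. \<bar>V x\<bar> > \<alpha>}) \<le> (C / \<alpha>) powr ?p" if \<alpha>: "\<alpha> > 0" for \<alpha>
  proof (cases "card {x. \<bar>V x\<bar> > \<alpha>} = 0")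
    case False
    let ?c = "real (card {x. \<bar>V x\<bar> > \<alpha>})"
    have "?c powr (1 / ?p) \<le> C / \<alpha>" using CC[OF \<alpha>] \<alpha> by (simp add: field_simps)
    then have "(?c powr (1 / ?p)) powr ?p \<le> (C / \<alpha>) powr ?p" by (intro powr_mono2) auto
    then show ?thesis using False d by (simp add: powr_powr)
  qed simp
  \<comment> \<open>Larger than \<open>C\<close>, so that no point has
    \<open>\<bar>V x\<bar> > a\<close>, and chosen so that \<open>C / (a / 2 ^ Suc k)\<close> is
    exactly \<open>2 ^ k\<close>.\<close>
  define a where "a = 2 * C"
  have a: "a > 0" using C by (simp add: a_def)
  have Va: "\<bar>V x\<bar> \<le> a" for x
  proof (rule ccontr)
    assume "\<not> \<bar>V x\<bar> \<le> a"
    then have "x \<in> {x. \<bar>V x\<bar> > a}" by simp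
    then have "card {x. \<bar>V x\<bar> > a} \<ge> 1" using fin[OF a] by (metis One_nat_def Suc_leI card_gt_0_iff empty_iff)
    then have "a * 1 \<le> a * (real (card {x. \<bar>V x\<bar> > a})) powr (1 / ?p)"
      using a d by (intro mult_left_mono ge_one_powr_ge_zero) auto
    then show False using CC[OF a] C unfolding a_def by linarith
  qed
  \<comment> \<open>Meaningless where \<open>V x = 0\<close>; such points are dropped in
    \<open>F'\<close>, where both functions in the form vanish.\<close>
  define lev where "lev x = nat \<lfloor>log 2 (a / \<bar>V x\<bar>)\<rfloor>" for x
  have lev: "a / 2 ^ Suc (lev x) < \<bar>V x\<bar>" "\<bar>V x\<bar> \<le> a / 2 ^ lev x" if "V x \<noteq> 0" for x
  proof -
    have p: "\<bar>V x\<bar> > 0" using that by simp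
    have ge1: "1 \<le> a / \<bar>V x\<bar>" using Va[of x] p by simp
    then have "0 \<le> log 2 (a / \<bar>V x\<bar>)" by (subst zero_le_log_cancel_iff) (use ge1 in linarith)+
    then have k: "of_int \<lfloor>log 2 (a / \<bar>V x\<bar>)\<rfloor> = real (lev x)" unfolding lev_def by simp
    have "2 powr real (lev x) \<le> a / \<bar>V x\<bar> \<and> a / \<bar>V x\<bar> < 2 powr (real (lev x) + 1)"
      using floor_log_eq_powr_iff[of "a / \<bar>V x\<bar>" 2 "\<lfloor>log 2 (a / \<bar>V x\<bar>)\<rfloor>"] ge1 k by simp
    then have "2 ^ lev x \<le> a / \<bar>V x\<bar>" "a / \<bar>V x\<bar> < 2 ^ Suc (lev x)"
      by (simp_all add: powr_realpow powr_add)
    then show "a / 2 ^ Suc (lev x) < \<bar>V x\<bar>" "\<bar>V x\<bar> \<le> a / 2 ^ lev x"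
      using p by (simp_all add: field_simps)
  qed
  \<comment> \<open>One level further halves \<open>min / max\<close>, and the block bound takes
    this to the power \<open>1/24\<close>.\<close>
  define \<theta> :: real where "\<theta> = 2 powr (- 1/24)"
  have \<theta>: "0 \<le> \<theta>" "\<theta> < 1" unfolding \<theta>_def using powr_less_mono[of "- 1/24" 0 "2::real"] by auto
  define M where "M = 3100 * C * (2 / (1 - \<theta>))"
  show ?thesis
  proof (rule uniform_resolvent_boundI[where K = a and M = M])
    show "M > 0" unfolding M_def using C \<theta> by simp
    fix z and F :: "(int ^ 'n) set" and u v :: "int ^ 'n \<Rightarrow> complex"
    assume z: "Im z > 0" and F: "finite F"
    let ?q = "\<lambda>x. complex_of_real (sqrt \<bar>V x\<bar>)"
    define F' where "F' = {x \<in> F. V x \<noteq> 0}"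
    \<comment> \<open>One more than the highest level that occurs; the inserted \<open>0\<close>
      covers an empty \<open>F'\<close>.\<close>
    define N where "N = Suc (Max (insert 0 (lev ` F')))"
    define E where "E k = {x \<in> F'. lev x = k}" for k
    have F': "finite F'" using F by (simp add: F'_def)
    have levN: "lev ` F' \<subseteq> {..<N}" unfolding N_def using F' by (auto simp: less_Suc_eq_le)
    have E: "finite (E k)" for k using F' by (simp add: E_def)
    have group: "(\<Sum>k<N. \<Sum>x\<in>E k. h x) = (\<Sum>x\<in>F'. h x)" for h :: "int ^ 'n \<Rightarrow> 'b::comm_monoid_add"
      unfolding E_def by (rule sum.group[OF F' _ levN]) simp
    have trigF: "trig F (\<lambda>x. ?q x * w x) \<xi> = (\<Sum>k<N. trig (E k) (\<lambda>x. ?q x * w x) \<xi>)" for w \<xi>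
      unfolding trig_def group
      by (rule sum.mono_neutral_right) (use F in \<open>auto simp: F'_def\<close>)
    let ?X = "\<lambda>k l. \<integral>\<xi>. trig (E k) (\<lambda>x. ?q x * u x) \<xi> * cnj (trig (E l) (\<lambda>x. ?q x * v x) \<xi>) / (of_real (hsym \<xi>) - z) \<partial>torus"
    have I: "integrable torus (\<lambda>\<xi>. trig (E k) f \<xi> * cnj (trig (E l) g \<xi>) / (of_real (hsym \<xi>) - z))" for k l f g
      using z by (intro bounded_meas_integrable bounded_meas_div_hsym bounded_meas_intros bounded_meas_trig) auto
    have "rform z F (\<lambda>x. ?q x * u x) (\<lambda>x. ?q x * v x)
       = (\<integral>\<xi>. (\<Sum>k<N. \<Sum>l<N. trig (E k) (\<lambda>x. ?q x * u x) \<xi> * cnj (trig (E l) (\<lambda>x. ?q x * v x) \<xi>) / (of_real (hsym \<xi>) - z)) \<partial>torus)"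
      unfolding rform_def trigF cnj_sum sum_product sum_divide_distrib ..
    also have "\<dots> = (\<Sum>k<N. \<Sum>l<N. ?X k l)"
      by (subst Bochner_Integration.integral_sum; (intro Bochner_Integration.integrable_sum I)?)+ (rule refl)
    finally have "cmod (rform z F (\<lambda>x. ?q x * u x) (\<lambda>x. ?q x * v x)) \<le> (\<Sum>k<N. \<Sum>l<N. cmod (?X k l))"
      by (simp only:) (intro sum_norm_le order_refl)
    also have "\<dots> \<le> (\<Sum>k<N. \<Sum>l<N. \<theta> ^ (max k l - min k l) * (3100 * C * (\<Sum>x\<in>E k. (cmod (u x))\<^sup>2) + 3100 * C * (\<Sum>x\<in>E l. (cmod (v x))\<^sup>2)))"
    proof (intro sum_mono)
      fix k l
      define A where "A k = (2::real) ^ k" for k :: nat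
      have cE: "real (card (E k)) \<le> (A k) powr ?p" for k
      proof -
        have al: "a / 2 ^ Suc k > 0" using a by simp
        have "card (E k) \<le> card {x. \<bar>V x\<bar> > a / 2 ^ Suc k}"
          by (rule card_mono[OF fin[OF al]]) (use lev(1) in \<open>auto simp: E_def F'_def\<close>)
        then have "real (card (E k)) \<le> (C / (a / 2 ^ Suc k)) powr ?p" using card[OF al] by linarith
        also have "C / (a / 2 ^ Suc k) = A k" unfolding a_def A_def using C by simp
        finally show ?thesis .
      qed
      have l2: "l2sum (E k) (\<lambda>x. ?q x * w x) \<le> sqrt (a / A k) * l2sum (E k) w" for k and w :: "int ^ 'n \<Rightarrow> complex"
      proof -
        have "(\<Sum>x\<in>E k. (cmod (?q x * w x))\<^sup>2) \<le> (\<Sum>x\<in>E k. a / A k * (cmod (w x))\<^sup>2)"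
        proof (intro sum_mono)
          fix x assume "x \<in> E k"
          then have "\<bar>V x\<bar> \<le> a / A k" using lev(2)[of x] by (auto simp: E_def F'_def A_def)
          from mult_right_mono[OF this, of "(cmod (w x))\<^sup>2"]
          show "(cmod (?q x * w x))\<^sup>2 \<le> a / A k * (cmod (w x))\<^sup>2"
            by (simp add: norm_mult power_mult_distrib)
        qed
        also have "\<dots> = a / A k * (\<Sum>x\<in>E k. (cmod (w x))\<^sup>2)" by (rule sum_distrib_left[symmetric])
        finally have "l2sum (E k) (\<lambda>x. ?q x * w x) \<le> sqrt (a / A k * (\<Sum>x\<in>E k. (cmod (w x))\<^sup>2))"
          by (rule real_sqrt_le_mono)
        then show ?thesis by (simp only: real_sqrt_mult)
      qed
      have Apos: "A k > 0" for k by (simp add: A_def)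
      have rho: "(min (A k) (A l) / max (A k) (A l)) powr (1/24) = \<theta> ^ (max k l - min k l)"
      proof -
        have mono: "mono A" unfolding A_def by (intro monoI power_increasing) auto
        have "min (A k) (A l) = A (min k l)" "max (A k) (A l) = A (max k l)"
          using mono by (auto simp: min_of_mono max_of_mono)
        then have "min (A k) (A l) / max (A k) (A l) = 2 powr (- real (max k l - min k l))"
          unfolding A_def by (simp add: powr_diff powr_realpow)
        then show ?thesis unfolding \<theta>_def by (simp add: powr_powr powr_realpow[symmetric] diff_divide_distrib)
      qed
      have "cmod (?X k l) \<le> 3100 * sqrt (A k * A l) * \<theta> ^ (max k l - min k l)
           * (l2sum (E k) (\<lambda>x. ?q x * u x) * l2sum (E l) (\<lambda>x. ?q x * v x))"
        unfolding rho[symmetric] by (intro resolvent_block_bound z d E Apos cE)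
      also have "\<dots> \<le> 3100 * sqrt (A k * A l) * \<theta> ^ (max k l - min k l)
           * ((sqrt (a / A k) * l2sum (E k) u) * (sqrt (a / A l) * l2sum (E l) v))"
        using \<theta> a Apos[of k] Apos[of l] by (intro mult_left_mono mult_mono l2 mult_nonneg_nonneg) (auto intro!: sum_nonneg simp: less_imp_le)
      also have "\<dots> = \<theta> ^ (max k l - min k l) * (3100 * a * (l2sum (E k) u * l2sum (E l) v))"
        using a Apos[of k] Apos[of l] by (simp add: real_sqrt_mult real_sqrt_divide)
      also have "\<dots> \<le> \<theta> ^ (max k l - min k l) * (3100 * C * ((l2sum (E k) u)\<^sup>2 + (l2sum (E l) v)\<^sup>2))"
      proof (intro mult_left_mono)
        have "2 * (l2sum (E k) u * l2sum (E l) v) \<le> (l2sum (E k) u)\<^sup>2 + (l2sum (E l) v)\<^sup>2"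
          using sum_squares_bound[of "l2sum (E k) u" "l2sum (E l) v"] by (simp only: mult.assoc)
        then show "3100 * a * (l2sum (E k) u * l2sum (E l) v) \<le> 3100 * C * ((l2sum (E k) u)\<^sup>2 + (l2sum (E l) v)\<^sup>2)"
          using mult_left_mono[of _ _ "3100 * C"] C unfolding a_def by fastforce
      qed (use \<theta> in auto)
      finally show "cmod (?X k l) \<le> \<theta> ^ (max k l - min k l) * (3100 * C * (\<Sum>x\<in>E k. (cmod (u x))\<^sup>2) + 3100 * C * (\<Sum>x\<in>E l. (cmod (v x))\<^sup>2))"
        by (simp add: sum_nonneg distrib_left)
    qed
    also have "\<dots> \<le> 2 / (1 - \<theta>) * ((\<Sum>k<N. 3100 * C * (\<Sum>x\<in>E k. (cmod (u x))\<^sup>2)) + (\<Sum>k<N. 3100 * C * (\<Sum>x\<in>E k. (cmod (v x))\<^sup>2)))"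
      using C by (intro schur_test_power_dist \<theta> mult_nonneg_nonneg sum_nonneg) auto
    also have "\<dots> = M * ((\<Sum>x\<in>F'. (cmod (u x))\<^sup>2) + (\<Sum>x\<in>F'. (cmod (v x))\<^sup>2))"
      unfolding sum_distrib_left[symmetric] group M_def by (simp add: distrib_left)
    also have "\<dots> \<le> M * ((\<Sum>x\<in>F. (cmod (u x))\<^sup>2) + (\<Sum>x\<in>F. (cmod (v x))\<^sup>2))"
      using F C \<theta> unfolding M_def F'_def by (intro mult_left_mono add_mono sum_mono2) auto
    finally show "cmod (rform z F (\<lambda>x. ?q x * u x) (\<lambda>x. ?q x * v x))
      \<le> M * ((\<Sum>x\<in>F. (cmod (u x))\<^sup>2) + (\<Sum>x\<in>F. (cmod (v x))\<^sup>2))" .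
  qed (rule Va)
qed

theorem theorem1p1:
  fixes V :: "int ^ 'n \<Rightarrow> real"
  shows "(CARD('n) \<ge> 4 \<and> weak_lp (real CARD('n) / 3) V \<longrightarrow> uniform_resolvent_bound V)
       \<and> (CARD('n) \<ge> 3 \<and> (\<exists>C>0. \<forall>x. \<bar>V x\<bar> \<le> C * (1 + lat_norm x) powr (-2))
            \<longrightarrow> uniform_resolvent_bound V)"
  using weak_lp_uniform_bound inverse_square_uniform_bound by blast

end
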